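(* The problem $d$-$SC1P$-$0E$ — given an $m\times n$ binary matrix $M$ and an integer $d\ge0$ (the parameter), decide whether there is a set of at most $d$ $0$-entries of $M$ whose flipping to $1$ yields a matrix with the simultaneous consecutive ones property — can be solved in time $O^*(18^d)$; consequently it is fixed-parameter tractable.
   Context: A binary matrix has the consecutive ones property (C1P) for rows if its columns can be permuted so that in every row the $1$-entries occur consecutively; it has the C1P for columns if its rows can be permuted so that in every column the $1$-entries occur consecutively. It has the simultaneous consecutive ones property (SC1P) if it has both. $O^*(f(d))$ denotes $f(d)\cdot N^{O(1)}$ where $N$ is the input size. *)

theory Defs
  imports
    "Jordan_Normal_Form.Matrix"
    "HOL-Combinatorics.Permutations"
    "HOL-Computational_Algebra.Polynomial"
begin

section \<open>The consecutive ones properties\<close>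

text \<open>An \<open>m \<times> n\<close> binary matrix is a Boolean matrix of dimensions \<open>m\<close> and \<open>n\<close>;
  \<open>True\<close> stands for the entry 1.\<close>

definition consecutive :: "nat set \<Rightarrow> bool" where
  "consecutive S \<longleftrightarrow> (\<exists>a b. S = {a..<b})"

text \<open>The permutation \<open>p\<close> puts the old column \<open>p j\<close> at position \<open>j\<close>
  (respectively the old row \<open>p i\<close> at position \<open>i\<close>).\<close>

definition c1p_rows :: "bool mat \<Rightarrow> bool" where
  "c1p_rows M \<longleftrightarrow>
     (\<exists>p. p permutes {..<dim_col M} \<and>
          (\<forall>i<dim_row M. consecutive {j. j < dim_col M \<and> M $$ (i, p j)}))"

definition c1p_cols :: "bool mat \<Rightarrow> bool" where
  "c1p_cols M \<longleftrightarrow>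
     (\<exists>p. p permutes {..<dim_row M} \<and>
          (\<forall>j<dim_col M. consecutive {i. i < dim_row M \<and> M $$ (p i, j)}))"

definition sc1p :: "bool mat \<Rightarrow> bool" where
  "sc1p M \<longleftrightarrow> c1p_rows M \<and> c1p_cols M"

definition zero_entries :: "bool mat \<Rightarrow> (nat \<times> nat) set" where
  "zero_entries M = {(i, j). i < dim_row M \<and> j < dim_col M \<and> \<not> M $$ (i, j)}"

definition flip :: "bool mat \<Rightarrow> (nat \<times> nat) set \<Rightarrow> bool mat" where
  "flip M F = mat (dim_row M) (dim_col M) (\<lambda>ij. if ij \<in> F then \<not> M $$ ij else M $$ ij)"

definition d_sc1p_0e :: "bool mat \<times> nat \<Rightarrow> bool" where
  "d_sc1p_0e = (\<lambda>(M, d). \<exists>F. F \<subseteq> zero_entries M \<and> card F \<le> d \<and> sc1p (flip M F))"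


section \<open>A machine model with a running time\<close>

text \<open>
  Programs are terms of a first-order functional language over binary trees, in the style of
  Jones' languages \<open>F\<close> and \<open>WHILE\<close> (Computability and Complexity from a Programming
  Perspective, 1997). The only data are binary trees built from one atom; the primitive operations
  are the constant atom, pairing, the two projections, a test for the atom, binding a variable and
  calling a program function. Each of them costs one time unit. There is no equality test and no
  arithmetic, so no primitive inspects or creates more than one tree node. Since trees are
  immutable, they can be kept in memory as pointers to shared nodes, and for a fixed program (whose
  function arities and environment lengths are then constants) each primitive takes a constant
  number of steps on a random access machine. Up to a constant factor, a running time in this model
  therefore is a running time of a random access machine; in particular a bound
  \<open>O\<^sup>*(c\<^sup>d)\<close> carries over with the same base \<open>c\<close>.
\<close>

datatype tree = Leaf | Branch tree tree

datatype expr =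
    Var nat            \<comment> \<open>de Bruijn index into the environment\<close>
  | Atom
  | Pair expr expr
  | First expr
  | Second expr
  | Cond expr expr expr  \<comment> \<open>takes the second branch if the test yields \<^const>\<open>Leaf\<close>\<close>
  | Bind expr expr       \<comment> \<open>the second expression sees the value of the first as variable 0\<close>
  | Call nat "expr list"

text \<open>A program is a list of function bodies; \<open>Call f\<close> invokes body number \<open>f\<close>, whose
  variables are its arguments.\<close>

type_synonym program = "expr list"

fun first_child :: "tree \<Rightarrow> tree" where
  "first_child Leaf = Leaf"
| "first_child (Branch a b) = a"

fun second_child :: "tree \<Rightarrow> tree" where
  "second_child Leaf = Leaf"
| "second_child (Branch a b) = b"

text \<open>\<open>evaluates P env e v t\<close>: in environment \<open>env\<close>, the expression \<open>e\<close> terminates with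
  value \<open>v\<close> after \<open>t\<close> time units.\<close>

inductive evaluates :: "program \<Rightarrow> tree list \<Rightarrow> expr \<Rightarrow> tree \<Rightarrow> nat \<Rightarrow> bool"
  and evaluates_list :: "program \<Rightarrow> tree list \<Rightarrow> expr list \<Rightarrow> tree list \<Rightarrow> nat \<Rightarrow> bool"
  for P :: program where
  Var: "i < length env \<Longrightarrow> evaluates P env (Var i) (env ! i) 1"
| Atom: "evaluates P env Atom Leaf 1"
| Pair: "evaluates P env e1 v1 t1 \<Longrightarrow> evaluates P env e2 v2 t2 \<Longrightarrow>
    evaluates P env (Pair e1 e2) (Branch v1 v2) (t1 + t2 + 1)"
| First: "evaluates P env e v t \<Longrightarrow> evaluates P env (First e) (first_child v) (t + 1)"
| Second: "evaluates P env e v t \<Longrightarrow> evaluates P env (Second e) (second_child v) (t + 1)"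
| Cond_Branch: "evaluates P env e (Branch a b) t \<Longrightarrow> evaluates P env e1 v t' \<Longrightarrow>
    evaluates P env (Cond e e1 e2) v (t + t' + 1)"
| Cond_Leaf: "evaluates P env e Leaf t \<Longrightarrow> evaluates P env e2 v t' \<Longrightarrow>
    evaluates P env (Cond e e1 e2) v (t + t' + 1)"
| Bind: "evaluates P env e1 v1 t1 \<Longrightarrow> evaluates P (v1 # env) e2 v2 t2 \<Longrightarrow>
    evaluates P env (Bind e1 e2) v2 (t1 + t2 + 1)"
| Call: "f < length P \<Longrightarrow> evaluates_list P env es vs t \<Longrightarrow> evaluates P vs (P ! f) v t' \<Longrightarrow>
    evaluates P env (Call f es) v (t + t' + 1)"
| Nil: "evaluates_list P env [] [] 0"
| Cons: "evaluates P env e v t \<Longrightarrow> evaluates_list P env es vs t' \<Longrightarrow>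
    evaluates_list P env (e # es) (v # vs) (t + t')"

inductive_cases evaluates_elims:
  "evaluates P env (Var i) v t"
  "evaluates P env Atom v t"
  "evaluates P env (Pair e1 e2) v t"
  "evaluates P env (First e) v t"
  "evaluates P env (Second e) v t"
  "evaluates P env (Cond e e1 e2) v t"
  "evaluates P env (Bind e1 e2) v t"
  "evaluates P env (Call f es) v t"

inductive_cases evaluates_list_elims:
  "evaluates_list P env [] vs t"
  "evaluates_list P env (e # es) vs t"

lemma evaluates_deterministic:
  "evaluates P env e v t \<Longrightarrow> evaluates P env e v' t' \<Longrightarrow> v' = v \<and> t' = t"
  "evaluates_list P env es vs t \<Longrightarrow> evaluates_list P env es vs' t' \<Longrightarrow> vs' = vs \<and> t' = t"
proof (induction arbitrary: v' t' and vs' t' rule: evaluates_evaluates_list.inducts)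
  case (Var i env)
  from Var.prems show ?case
    by (auto elim: evaluates_elims(1))
next
  case (Atom env)
  from Atom.prems show ?case
    by (auto elim: evaluates_elims(2))
next
  case (Pair env e1 v1 t1 e2 v2 t2)
  from Pair.prems show ?case
    by (rule evaluates_elims(3)) (metis Pair.IH Suc_eq_plus1)
next
  case (First env e v t)
  from First.prems show ?case
    by (rule evaluates_elims(4)) (metis First.IH Suc_eq_plus1)
next
  case (Second env e v t)
  from Second.prems show ?case
    by (rule evaluates_elims(5)) (metis Second.IH Suc_eq_plus1)
next
  case (Cond_Branch env e a b t e1 v t1 e2)
  from Cond_Branch.prems show ?case
    by (rule evaluates_elims(6)) (metis Cond_Branch.IH Suc_eq_plus1 tree.distinct)+
next
  case (Cond_Leaf env e t e2 v t1 e1)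
  from Cond_Leaf.prems show ?case
    by (rule evaluates_elims(6)) (metis Cond_Leaf.IH Suc_eq_plus1 tree.distinct)+
next
  case (Bind env e1 v1 t1 e2 v2 t2)
  from Bind.prems show ?case
    by (rule evaluates_elims(7)) (metis Bind.IH Suc_eq_plus1)
next
  case (Call f env es vs t v t1)
  from Call.prems show ?case
    by (rule evaluates_elims(8)) (metis Call.IH Suc_eq_plus1)
next
  case (Nil env)
  from Nil.prems show ?case
    by (auto elim: evaluates_list_elims(1))
next
  case (Cons env e v t es vs t1)
  from Cons.prems show ?case
    by (rule evaluates_list_elims(2)) (metis Cons.IH)
qed

text \<open>\<open>runs P x y t\<close>: body 0 of \<open>P\<close>, called with the single argument \<open>x\<close>, returns \<open>y\<close> after
  \<open>t\<close> time units.\<close>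

definition runs :: "program \<Rightarrow> tree \<Rightarrow> tree \<Rightarrow> nat \<Rightarrow> bool" where
  "runs P x y t \<longleftrightarrow> evaluates P [x] (Call 0 [Var 0]) y t"


section \<open>Encodings\<close>

fun tree_of_bool :: "bool \<Rightarrow> tree" where
  "tree_of_bool False = Leaf"
| "tree_of_bool True = Branch Leaf Leaf"

fun tree_of_list :: "('a \<Rightarrow> tree) \<Rightarrow> 'a list \<Rightarrow> tree" where
  "tree_of_list enc [] = Leaf"
| "tree_of_list enc (x # xs) = Branch (enc x) (tree_of_list enc xs)"

text \<open>Binary digits, least significant first, without leading zeros.\<close>

fun binary :: "nat \<Rightarrow> bool list" where
  "binary n = (if n = 0 then [] else odd n # binary (n div 2))"

declare binary.simps [simp del]

text \<open>A matrix is given by the list of its rows, and the integer in binary. The size of the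
  encoding, which is the number of its \<^const>\<open>Branch\<close> nodes, is of order
  \<open>m n + m + log d\<close>. (The encoding only confuses matrices without rows with each other.)\<close>

fun encode_instance :: "bool mat \<times> nat \<Rightarrow> tree" where
  "encode_instance (M, d) =
     Branch (tree_of_list (tree_of_list tree_of_bool) (mat_to_list M))
            (tree_of_list tree_of_bool (binary d))"

fun parameter :: "bool mat \<times> nat \<Rightarrow> nat" where
  "parameter (M, d) = d"


section \<open>Parameterized running times\<close>

text \<open>A parameterized problem is given by an encoding \<open>enc\<close> of its instances, the predicate \<open>L\<close>
  of yes-instances, and the parameter \<open>\<kappa>\<close> of an instance.\<close>

definition solvable_in_O_star ::
  "('i \<Rightarrow> tree) \<Rightarrow> ('i \<Rightarrow> bool) \<Rightarrow> ('i \<Rightarrow> nat) \<Rightarrow> (nat \<Rightarrow> nat) \<Rightarrow> bool" where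
  "solvable_in_O_star enc L \<kappa> f \<longleftrightarrow>
     (\<exists>P (q :: nat poly). \<forall>x. \<exists>t.
        runs P (enc x) (tree_of_bool (L x)) t \<and> t \<le> f (\<kappa> x) * poly q (size (enc x)))"

text \<open>For computability of a function on the natural numbers, without time bound, the
  representation of numbers is irrelevant; we use unary.\<close>

fun unary :: "nat \<Rightarrow> tree" where
  "unary 0 = Leaf"
| "unary (Suc n) = Branch Leaf (unary n)"

definition computable :: "(nat \<Rightarrow> nat) \<Rightarrow> bool" where
  "computable f \<longleftrightarrow> (\<exists>P. \<forall>n. \<exists>t. runs P (unary n) (unary (f n)) t)"

definition fixed_parameter_tractable ::
  "('i \<Rightarrow> tree) \<Rightarrow> ('i \<Rightarrow> bool) \<Rightarrow> ('i \<Rightarrow> nat) \<Rightarrow> bool" where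
  "fixed_parameter_tractable enc L \<kappa> \<longleftrightarrow>
     (\<exists>f. computable f \<and> solvable_in_O_star enc L \<kappa> f)"

end

theory Submission
  imports Defs
begin

text \<open>
  View the matrix as a bipartite graph whose vertices are the rows and the columns and whose edges are
  the 1-entries. It has the simultaneous consecutive ones property iff each side can be ordered such
  that all neighbourhoods in it are intervals, and by Tucker's theorem a side can be ordered so unless
  it contains an asteroidal triple: three vertices any two of which are joined by a path that avoids
  the neighbourhood of the third.

  If some asteroidal triple is short, that is, its three paths have at most 36 edges in total, then
  every solution joins one of the three vertices to an inner vertex of the opposite path. There are at
  most 18 such 0-entries, so one branches into 18 instances with parameter \<open>d - 1\<close>. If no asteroidal
  triple is short, then either there is none at all, or there is a chordless cycle, and it has
  \<open>2 f + 4 \<ge> 38\<close> vertices. Every solution contains \<open>f\<close> noncrossing chords that cut the cycle into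
  quadrangles. The sets of such chords are enumerated by pushing the vertices of the cycle on a stack
  and deciding at each step whether to cut off the three edges between the topmost four of them. This
  gives at most \<open>2 ^ (3 f + 6)\<close> instances with parameter \<open>d - f\<close>, which is less than \<open>18 ^ f\<close>
  because \<open>f \<ge> 17\<close>. So the search tree has \<open>O(18 ^ d)\<close> nodes.
\<close>

section \<open>Orderings with consecutive neighbourhoods\<close>

text \<open>Lengths are counted in links; a link joins two vertices of one side with a common
  neighbour and so consists of two edges. A triple with k links yields k candidate entries, which is
  why the base 18 allows 18 links. The triples constructed below have at most 17.

  That a graph without short triples and chordless cycles has no triple at all rests on nestedness:
  in such a graph the neighbourhoods of any two neighbours of \<open>c\<close> are nested on every
  component of links that avoids \<open>c\<close> (\<open>chain\<close>). Given a triple, take a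
  shortest path between two of its vertices and see where the component of the third vertex
  \<open>u\<close> is attached to it: next to an end, between two consecutive vertices, or at one
  vertex only. Each case yields a triple of bounded length if the path has two links or more. So all
  three paths have one link, and the triple itself is short.

  The obstacle is a long chordless cycle: its own triples are long, and branching on one of them
  would have unbounded width. It is paid for by the many insertions that the cycle forces.\<close>

definition link :: "('r \<Rightarrow> 'a \<Rightarrow> bool) \<Rightarrow> 'a set \<Rightarrow> 'a set \<Rightarrow> ('a \<times> 'a) set" where
  "link I X Z = {(u, v). u \<in> X \<and> v \<in> X \<and> (\<exists>r. I r u \<and> I r v \<and> (\<forall>z\<in>Z. \<not> I r z))}"

definition asteroidal :: "('r \<Rightarrow> 'a \<Rightarrow> bool) \<Rightarrow> 'a set \<Rightarrow> 'a \<Rightarrow> 'a \<Rightarrow> 'a \<Rightarrow> bool" where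
  "asteroidal I X a b c \<longleftrightarrow> a \<in> X \<and> b \<in> X \<and> c \<in> X \<and> a \<noteq> b \<and> b \<noteq> c \<and> a \<noteq> c \<and>
     (a, b) \<in> (link I X {c})\<^sup>* \<and> (b, c) \<in> (link I X {a})\<^sup>* \<and> (c, a) \<in> (link I X {b})\<^sup>*"

definition arrangement :: "('r \<Rightarrow> 'a \<Rightarrow> bool) \<Rightarrow> 'a set \<Rightarrow> ('a \<Rightarrow> 'a \<Rightarrow> bool) \<Rightarrow> bool" where
  "arrangement I X lt \<longleftrightarrow>
     (\<forall>x\<in>X. \<not> lt x x) \<and>
     (\<forall>x\<in>X. \<forall>y\<in>X. \<forall>z\<in>X. lt x y \<longrightarrow> lt y z \<longrightarrow> lt x z) \<and>
     (\<forall>x\<in>X. \<forall>y\<in>X. x \<noteq> y \<longrightarrow> lt x y \<or> lt y x) \<and>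
     (\<forall>r. \<forall>x\<in>X. \<forall>y\<in>X. \<forall>z\<in>X. lt x y \<longrightarrow> lt y z \<longrightarrow> I r x \<longrightarrow> I r z \<longrightarrow> I r y)"

lemma arrangementI:
  assumes "\<And>x. x \<in> X \<Longrightarrow> \<not> lt x x"
    and "\<And>x y z. x \<in> X \<Longrightarrow> y \<in> X \<Longrightarrow> z \<in> X \<Longrightarrow> lt x y \<Longrightarrow> lt y z \<Longrightarrow> lt x z"
    and "\<And>x y. x \<in> X \<Longrightarrow> y \<in> X \<Longrightarrow> x \<noteq> y \<Longrightarrow> lt x y \<or> lt y x"
    and "\<And>r x y z. x \<in> X \<Longrightarrow> y \<in> X \<Longrightarrow> z \<in> X \<Longrightarrow> lt x y \<Longrightarrow> lt y z \<Longrightarrow> I r x \<Longrightarrow> I r z \<Longrightarrow> I r y"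
  shows "arrangement I X lt"
  unfolding arrangement_def by (intro conjI ballI allI impI) (fact assms)+

lemma arrangementD:
  assumes "arrangement I X lt"
  shows "x \<in> X \<Longrightarrow> \<not> lt x x"
    and "x \<in> X \<Longrightarrow> y \<in> X \<Longrightarrow> z \<in> X \<Longrightarrow> lt x y \<Longrightarrow> lt y z \<Longrightarrow> lt x z"
    and "x \<in> X \<Longrightarrow> y \<in> X \<Longrightarrow> x \<noteq> y \<Longrightarrow> lt x y \<or> lt y x"
    and "x \<in> X \<Longrightarrow> y \<in> X \<Longrightarrow> z \<in> X \<Longrightarrow> lt x y \<Longrightarrow> lt y z \<Longrightarrow> I r x \<Longrightarrow> I r z \<Longrightarrow> I r y"
  using assms unfolding arrangement_def by metis+

lemma link_mono: "X \<subseteq> Y \<Longrightarrow> Z' \<subseteq> Z \<Longrightarrow> link I X Z \<subseteq> link I Y Z'"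
  unfolding link_def by blast

lemma reach_mono: "(u, v) \<in> (link I X Z)\<^sup>* \<Longrightarrow> X \<subseteq> Y \<Longrightarrow> Z' \<subseteq> Z \<Longrightarrow> (u, v) \<in> (link I Y Z')\<^sup>*"
  using rtrancl_mono[OF link_mono] by blast

lemma sym_link: "sym (link I X Z)"
  unfolding link_def sym_def by blast

lemma reach_sym: "(u, v) \<in> (link I X Z)\<^sup>* \<Longrightarrow> (v, u) \<in> (link I X Z)\<^sup>*"
  using sym_rtrancl[OF sym_link] by (meson symD)

lemma reach_in: "(u, v) \<in> (link I X Z)\<^sup>* \<Longrightarrow> u \<in> X \<Longrightarrow> v \<in> X"
  by (induction rule: rtrancl_induct) (auto simp: link_def)

lemma linkI: "u \<in> X \<Longrightarrow> v \<in> X \<Longrightarrow> I r u \<Longrightarrow> I r v \<Longrightarrow> \<forall>z\<in>Z. \<not> I r z \<Longrightarrow> (u, v) \<in> link I X Z"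
  unfolding link_def by blast

lemma reach_avoid_source: "(u, v) \<in> (link I X {z})\<^sup>* \<Longrightarrow> u \<noteq> z \<Longrightarrow> v \<noteq> z"
  by (induction rule: rtrancl_induct) (auto simp: link_def)

text \<open>A row on the path that met \<open>q\<close> would make \<open>q\<close> itself
  reachable, so the path avoids \<open>q\<close> automatically.\<close>

lemma reach_avoid_unreachable:
  assumes "(u, v) \<in> (link I X Z)\<^sup>*" "(u, q) \<notin> (link I X Z)\<^sup>*" "q \<in> X"
  shows "(u, v) \<in> (link I X (insert q Z))\<^sup>*"
  using assms(1)
proof (induction rule: rtrancl_induct)
  case (step y w)
  then obtain r where r: "y \<in> X" "w \<in> X" "I r y" "I r w" "\<forall>z\<in>Z. \<not> I r z"
    unfolding link_def by blast
  have "\<not> I r q"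
    using step.hyps(1) assms(2,3) r linkI[of y X q I r Z] by (meson rtrancl.rtrancl_into_rtrancl)
  with r have "(y, w) \<in> link I X (insert q Z)"
    by (intro linkI[of _ _ _ _ r]) auto
  with step.IH show ?case by simp
qed simp

lemma asteroidal_mono: "asteroidal I X a b c \<Longrightarrow> X \<subseteq> Y \<Longrightarrow> asteroidal I Y a b c"
  unfolding asteroidal_def using reach_mono[of _ _ I X _ Y] by blast

lemma arrangement_dual: "arrangement I X lt \<Longrightarrow> arrangement I X (\<lambda>x y. lt y x)"
  by (rule arrangementI) (use arrangementD[of I X lt] in metis)+

text \<open>Two vertices linked by a row that misses \<open>a\<close> lie on the same side of
  \<open>a\<close>, since convexity would otherwise put \<open>a\<close> into the row. Connectedness
  leaves only one side, and reversing the order makes it the desired one.\<close>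

lemma arrangement_end:
  assumes arr: "arrangement I X lt" and "a \<in> X" "k \<in> X" "k \<noteq> a"
    and conn: "\<And>v. v \<in> X \<Longrightarrow> v \<noteq> a \<Longrightarrow> (k, v) \<in> (link I X {a})\<^sup>*"
  shows "\<exists>lt'. arrangement I X lt' \<and> (\<forall>v\<in>X. v \<noteq> a \<longrightarrow> lt' a v)"
proof -
  have "lt a k \<longleftrightarrow> lt a v" if "(k, v) \<in> (link I X {a})\<^sup>*" for v
    using that
  proof (induction rule: rtrancl_induct)
    case (step y z)
    then obtain r where r: "y \<in> X" "z \<in> X" "I r y" "I r z" "\<not> I r a"
      unfolding link_def by blast
    then have "y \<noteq> a" "z \<noteq> a" by auto
    moreover have "\<not> (lt y a \<and> lt a z)" "\<not> (lt z a \<and> lt a y)"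
      using r arrangementD(4)[OF arr, of _ a _ r] \<open>a \<in> X\<close> by blast+
    moreover have "\<not> (lt y a \<and> lt a y)" "\<not> (lt z a \<and> lt a z)"
      using r arrangementD(1,2)[OF arr] \<open>a \<in> X\<close> by blast+
    ultimately have "lt a y \<longleftrightarrow> lt a z"
      using r arrangementD(3)[OF arr] \<open>a \<in> X\<close> by metis
    with step.IH show ?case by simp
  qed simp
  then have same: "v \<in> X \<Longrightarrow> v \<noteq> a \<Longrightarrow> lt a k \<longleftrightarrow> lt a v" for v
    using conn by blast
  show ?thesis
  proof (cases "lt a k")
    case True
    with same arr show ?thesis by blast
  next
    case False
    then have "\<forall>v\<in>X. v \<noteq> a \<longrightarrow> lt v a"
      using same arrangementD(3)[OF arr] \<open>a \<in> X\<close> by metis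
    with arrangement_dual[OF arr] show ?thesis by blast
  qed
qed

lemma finite_arg_max:
  fixes f :: "'a \<Rightarrow> nat"
  assumes "finite A" "A \<noteq> {}"
  obtains a where "a \<in> A" "\<And>b. b \<in> A \<Longrightarrow> f b \<le> f a"
proof -
  have "Max (f ` A) \<in> f ` A"
    using assms by (intro Max_in) auto
  then obtain a where "a \<in> A" "f a = Max (f ` A)" by force
  then show ?thesis
    using that[of a] assms(1) by simp
qed

text \<open>Substitution of an ordered block for its representative \<open>a\<close>: a row that
  meets \<open>K\<close> contains all or nothing of \<open>U\<close>, so the whole of
  \<open>U\<close> may be placed where \<open>a\<close> stands.\<close>

lemma arrangement_block:
  assumes U: "arrangement I U lt2" and K: "arrangement I (insert a K) lt1"
    and "a \<in> U" "U \<inter> K = {}"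
    and block: "\<And>r u k v. u \<in> U \<Longrightarrow> k \<in> K \<Longrightarrow> I r u \<Longrightarrow> I r k \<Longrightarrow> v \<in> U \<Longrightarrow> I r v"
  shows "\<exists>lt. arrangement I (U \<union> K) lt"
proof -
  define rep where "rep v = (if v \<in> U then a else v)" for v
  define lt where "lt u v = (if u \<in> U \<and> v \<in> U then lt2 u v else lt1 (rep u) (rep v))" for u v
  have rep: "rep v \<in> insert a K" if "v \<in> U \<union> K" for v
    using that unfolding rep_def by auto
  have inU: "rep v = a \<longleftrightarrow> v \<in> U" for v
    using \<open>a \<in> U\<close> unfolding rep_def by auto
  note K1 = arrangementD[OF K] and U1 = arrangementD[OF U]
  have ltU: "lt u v \<longleftrightarrow> lt2 u v" if "u \<in> U" "v \<in> U" for u v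
    using that unfolding lt_def by simp
  have ltK: "lt u v \<longleftrightarrow> lt1 (rep u) (rep v)" if "\<not> (u \<in> U \<and> v \<in> U)" for u v
    using that unfolding lt_def by auto
  have antisym: "\<not> lt1 (rep u) (rep v)" if "u \<in> U \<union> K" "v \<in> U \<union> K" "lt1 (rep v) (rep u)" for u v
    using K1(1,2) rep that by blast
  have repI: "I r (rep v)" if "v \<in> U \<union> K" "w \<in> K" "I r w" "I r v" for r v w
    using that block[of v w r a] \<open>a \<in> U\<close> unfolding rep_def by auto
  have "arrangement I (U \<union> K) lt"
  proof (rule arrangementI)
    fix x assume "x \<in> U \<union> K"
    then show "\<not> lt x x"
      using U1(1) K1(1)[OF rep] ltU ltK by blast
  next
    fix x y assume xy: "x \<in> U \<union> K" "y \<in> U \<union> K" "x \<noteq> y"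
    show "lt x y \<or> lt y x"
    proof (cases "x \<in> U \<and> y \<in> U")
      case True
      with U1(3) xy ltU show ?thesis by blast
    next
      case False
      then have "rep x \<noteq> rep y"
        using xy \<open>a \<in> U\<close> unfolding rep_def by auto
      with K1(3)[of "rep x" "rep y"] rep xy ltK False show ?thesis by metis
    qed
  next
    fix x y z assume xyz: "x \<in> U \<union> K" "y \<in> U \<union> K" "z \<in> U \<union> K" and lt: "lt x y" "lt y z"
    show "lt x z"
    proof (cases "x \<in> U \<and> y \<in> U"; cases "y \<in> U \<and> z \<in> U")
      assume "x \<in> U \<and> y \<in> U" "y \<in> U \<and> z \<in> U"
      with lt ltU U1(2) show ?thesis by metis
    next
      assume *: "x \<in> U \<and> y \<in> U" "\<not> (y \<in> U \<and> z \<in> U)"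
      then have "rep x = rep y" using inU by metis
      with * lt ltK show ?thesis by metis
    next
      assume *: "\<not> (x \<in> U \<and> y \<in> U)" "y \<in> U \<and> z \<in> U"
      then have "rep y = rep z" using inU by metis
      with * lt ltK show ?thesis by metis
    next
      assume *: "\<not> (x \<in> U \<and> y \<in> U)" "\<not> (y \<in> U \<and> z \<in> U)"
      with lt ltK have l: "lt1 (rep x) (rep y)" "lt1 (rep y) (rep z)" by blast+
      then have "\<not> (x \<in> U \<and> z \<in> U)"
        using antisym[OF xyz(2,1)] inU by metis
      with l K1(2)[of "rep x" "rep y" "rep z"] rep xyz ltK show ?thesis by blast
    qed
  next
    fix r x y z assume xyz: "x \<in> U \<union> K" "y \<in> U \<union> K" "z \<in> U \<union> K" and lt: "lt x y" "lt y z"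
      and r: "I r x" "I r z"
    show "I r y"
    proof (cases "x \<in> U \<and> z \<in> U")
      case True
      have "y \<in> U"
        using True lt ltK antisym[OF xyz(2,1)] inU by metis
      with True lt ltU r U1(4) show ?thesis by metis
    next
      case False
      then obtain w where w: "w \<in> K" "I r w" using xyz r by blast
      have repr: "I r (rep x)" "I r (rep z)" using repI[OF _ w] xyz r by blast+
      consider "x \<in> U \<and> y \<in> U" | "y \<in> U \<and> z \<in> U" | "lt1 (rep x) (rep y)" "lt1 (rep y) (rep z)"
        using lt ltK by blast
      then show ?thesis
      proof cases
        case 3
        then have ry: "I r (rep y)"
          using K1(4)[of "rep x" "rep y" "rep z" r] rep xyz repr by blast
        show ?thesis
        proof (cases "y \<in> U")
          case True
          with ry have "I r a" unfolding rep_def by simp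
          with block[of a w r y] w True \<open>a \<in> U\<close> show ?thesis by blast
        qed (use ry in \<open>simp add: rep_def\<close>)
      qed (use block w r in blast)+
    qed
  qed
  then show ?thesis by blast
qed

text \<open>Choosing \<open>a\<close> such that the component of \<open>a\<^sub>0\<close> avoiding \<open>a\<close> is as large as possible makes
  the complement of that component a block.\<close>

lemma block_exists:
  assumes fin: "finite X" and A: "A \<subseteq> X - {a0}" "A \<noteq> {}" and a0: "a0 \<in> X"
    and other: "\<And>a u r k. a \<in> A \<Longrightarrow> u \<in> X \<Longrightarrow> u \<notin> A \<Longrightarrow> (a0, u) \<notin> (link I X {a})\<^sup>* \<Longrightarrow>
       (a0, k) \<in> (link I X {a})\<^sup>* \<Longrightarrow> I r a \<Longrightarrow> I r k \<Longrightarrow> I r u"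
  obtains a where "a \<in> A"
    "\<And>r u k v. u \<in> X \<Longrightarrow> (a0, u) \<notin> (link I X {a})\<^sup>* \<Longrightarrow> (a0, k) \<in> (link I X {a})\<^sup>* \<Longrightarrow> I r u \<Longrightarrow>
       I r k \<Longrightarrow> v \<in> X \<Longrightarrow> (a0, v) \<notin> (link I X {a})\<^sup>* \<Longrightarrow> I r v"
proof -
  define K where "K a = {v \<in> X. (a0, v) \<in> (link I X {a})\<^sup>*}" for a
  have finK: "finite (K a)" for a unfolding K_def using fin by simp
  obtain a where aA: "a \<in> A" and amax: "\<And>b. b \<in> A \<Longrightarrow> card (K b) \<le> card (K a)"
    using finite_arg_max[of A "\<lambda>a. card (K a)"] A fin finite_subset[of A X] by blast
  have "a \<in> X" "a \<noteq> a0" using aA A by auto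
  have notK: "a \<notin> K a" using reach_avoid_source \<open>a \<noteq> a0\<close> unfolding K_def by fast
  show ?thesis
  proof (rule that[OF aA])
    fix r u k v
    assume u: "u \<in> X" "(a0, u) \<notin> (link I X {a})\<^sup>*" and k: "(a0, k) \<in> (link I X {a})\<^sup>*"
      and r: "I r u" "I r k" and v: "v \<in> X" "(a0, v) \<notin> (link I X {a})\<^sup>*"
    have kX: "k \<in> X" using reach_in[OF k a0] .
    have ra: "I r a"
    proof (rule ccontr)
      assume "\<not> I r a"
      then have "(k, u) \<in> link I X {a}" using r u kX by (intro linkI) auto
      with k u(2) show False by (meson rtrancl.rtrancl_into_rtrancl)
    qed
    show "I r v"
    proof (rule ccontr)
      assume nv: "\<not> I r v"
      show False
      proof (cases "v \<in> A")
        case True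
        \<comment> \<open>The component of \<open>a0\<close> that avoids \<open>a\<close> also
          avoids \<open>v\<close>, and \<open>r\<close> links \<open>k\<close> to \<open>a\<close>
          without meeting \<open>v\<close>. So \<open>v\<close> would have a strictly larger
          component, against the choice of \<open>a\<close>.\<close>
        have sub: "(a0, w) \<in> (link I X {v})\<^sup>*" if "(a0, w) \<in> (link I X {a})\<^sup>*" for w
          using reach_mono[OF reach_avoid_unreachable[OF that v(2,1)], of X "{v}"] by simp
        have "(k, a) \<in> link I X {v}"
          using kX \<open>a \<in> X\<close> r ra nv by (intro linkI) auto
        then have "a \<in> K v"
          using sub[OF k] \<open>a \<in> X\<close> unfolding K_def by (simp add: rtrancl.rtrancl_into_rtrancl)
        then have "K a \<subset> K v"
          using sub notK unfolding K_def by blast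
        then show False
          using amax[OF True] psubset_card_mono[OF finK] by (meson not_less)
      next
        case False
        then show False using other[OF aA v(1) False v(2) k ra r(2)] nv by blast
      qed
    qed
  qed
qed

text \<open>A minimal counterexample is cut into smaller sets whose arrangements can be glued. It
  has two vertices \<open>a\<close> and \<open>b\<close> that behave like ends, because the rest
  stays connected when one of them is avoided. The glued order begins with \<open>a\<close>,
  continues with a block \<open>U\<close> and closes with the component \<open>K\<close> of
  \<open>b\<close>.\<close>

theorem arrangement_if_no_asteroidal:
  assumes "finite X" "\<nexists>a b c. asteroidal I X a b c"
  shows "\<exists>lt. arrangement I X lt"
  using assms
proof (induction "card X" arbitrary: X rule: less_induct)
  case less
  note fin = less.prems(1) and noat = less.prems(2)
  have IH: "\<exists>lt. arrangement I Y lt" if "Y \<subset> X" for Y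
    using less.hyps[of Y] that fin noat asteroidal_mono[of I Y _ _ _ X] psubset_card_mono[OF fin that]
    by (meson finite_subset psubset_imp_subset)
  show ?case
  proof (cases "card X \<le> 1")
    case True
    then have "x = y" if "x \<in> X" "y \<in> X" for x y
      using that fin by (metis One_nat_def card_le_Suc0_iff_eq)
    then have "arrangement I X (\<lambda>_ _. False)"
      unfolding arrangement_def by blast
    then show ?thesis by blast
  next
    case False
    show ?thesis
    proof (rule ccontr)
      assume none: "\<not> ?thesis"
      \<comment> \<open>Arrangements of the block and of the component with a representative could
        be glued by \<open>arrangement_block\<close>; as there is no arrangement, the component must
        be everything except \<open>a\<close>.\<close>
      have ends: "\<exists>a\<in>X - {a0}. \<forall>v\<in>X - {a}. (a0, v) \<in> (link I X {a})\<^sup>*" if a0: "a0 \<in> X" for a0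
      proof -
        have "X - {a0} \<noteq> {}"
          using False fin a0 by (metis card_Suc_Diff1 card.empty le_refl One_nat_def)
        then obtain a where a: "a \<in> X - {a0}" and block:
          "\<And>r u k v. u \<in> X \<Longrightarrow> (a0, u) \<notin> (link I X {a})\<^sup>* \<Longrightarrow> (a0, k) \<in> (link I X {a})\<^sup>* \<Longrightarrow> I r u \<Longrightarrow>
             I r k \<Longrightarrow> v \<in> X \<Longrightarrow> (a0, v) \<notin> (link I X {a})\<^sup>* \<Longrightarrow> I r v"
          by (rule block_exists[OF fin subset_refl _ a0, of I]) blast+
        define K where "K = {v \<in> X. (a0, v) \<in> (link I X {a})\<^sup>*}"
        have aK: "a \<notin> K" using reach_avoid_source a unfolding K_def by fast
        have a0K: "a0 \<in> K" using a0 unfolding K_def by simp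
        have "X - K \<subset> X" using a0K a0 by blast
        then obtain lt2 where lt2: "arrangement I (X - K) lt2" using IH by blast
        have "X = insert a K"
        proof (rule ccontr)
          assume "X \<noteq> insert a K"
          then have "insert a K \<subset> X" using a unfolding K_def by blast
          then obtain lt1 where "arrangement I (insert a K) lt1" using IH by blast
          from arrangement_block[OF lt2 this] have "\<exists>lt. arrangement I (X - K \<union> K) lt"
            using a aK block unfolding K_def by blast
          moreover have "X - K \<union> K = X" unfolding K_def by blast
          ultimately show False using none by simp
        qed
        then show ?thesis using a unfolding K_def by blast
      qed
      obtain a0 where "a0 \<in> X" using False by fastforce
      from ends[OF this] obtain a where aX: "a \<in> X" and
        enda': "\<forall>v\<in>X - {a}. (a0, v) \<in> (link I X {a})\<^sup>*" by blast
      have enda: "(u, v) \<in> (link I X {a})\<^sup>*" if "u \<in> X" "u \<noteq> a" "v \<in> X" "v \<noteq> a" for u v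
        using enda' that reach_sym[of a0 u I X "{a}"] by (meson Diff_iff rtrancl_trans singletonD)
      from ends[OF aX] obtain b where b: "b \<in> X" "b \<noteq> a" and
        endb': "\<forall>v\<in>X - {b}. (a, v) \<in> (link I X {b})\<^sup>*" by blast
      have endb: "(u, v) \<in> (link I X {b})\<^sup>*" if "u \<in> X" "u \<noteq> b" "v \<in> X" "v \<noteq> b" for u v
        using endb' that reach_sym[of a u I X "{b}"] by (meson Diff_iff rtrancl_trans singletonD)
      \<comment> \<open>The rows that constrain the position of \<open>a\<close>: they contain more
        than \<open>a\<close>, but not everything. Asteroidal triples with \<open>a\<close> being
        absent, these rows form a chain of sets, and none of them contains \<open>b\<close>.\<close>
      define N where "N = {r. I r a \<and> (\<exists>v\<in>X. v \<noteq> a \<and> I r v) \<and> (\<exists>v\<in>X. \<not> I r v)}"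
      have N1: "\<not> I r b" if "r \<in> N" for r
      proof
        assume rb: "I r b"
        from that obtain y where y: "y \<in> X" "\<not> I r y" "I r a" unfolding N_def by blast
        have "(a, b) \<in> link I X {y}" using y rb b aX by (intro linkI) auto
        then have "asteroidal I X a b y"
          unfolding asteroidal_def using y rb b aX enda[of b y] endb[of y a] by blast
        with noat show False by blast
      qed
      have chain: "I r' x" if "r \<in> N" "r' \<in> N" "x \<in> X" "I r x" "y \<in> X" "I r' y" "\<not> I r y" for r r' x y
      proof (rule ccontr)
        assume nx: "\<not> I r' x"
        have ra: "I r a" "I r' a" using that unfolding N_def by auto
        have "(a, x) \<in> link I X {y}" "(y, a) \<in> link I X {x}"
          using that aX ra nx by (auto intro: linkI)
        then have "asteroidal I X x y a"
          unfolding asteroidal_def using that aX ra nx enda[of x y] by blast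
        with noat show False by blast
      qed
      have "X - {a} \<subset> X" using aX by blast
      then obtain lt0 where lt0: "arrangement I (X - {a}) lt0" using IH by blast
      \<comment> \<open>Without such rows, \<open>a\<close> could simply be put in front of an
        arrangement of the rest.\<close>
      have "N \<noteq> {}"
      proof
        assume "N = {}"
        then have N0: "I r a \<Longrightarrow> v \<in> X \<Longrightarrow> v \<noteq> a \<Longrightarrow> I r v \<Longrightarrow> w \<in> X \<Longrightarrow> I r w" for r v w
          unfolding N_def by blast
        define lt where "lt u v = (u = a \<and> v \<noteq> a \<or> u \<noteq> a \<and> v \<noteq> a \<and> lt0 u v)" for u v
        have "arrangement I X lt"
          using lt0 N0 unfolding arrangement_def lt_def by (smt (verit) Diff_iff singletonD)
        with none show False by blast
      qed
      \<comment> \<open>A smallest row of the chain is contained in all the others, so the rows of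
        \<open>N\<close> have a common vertex besides \<open>a\<close>.\<close>
      then obtain s where s: "s \<in> N" and smin: "\<And>r. r \<in> N \<Longrightarrow> card {v \<in> X. I s v} \<le> card {v \<in> X. I r v}"
        using ex_has_least_nat[of "\<lambda>r. r \<in> N" _ "\<lambda>r. card {v \<in> X. I r v}"] by blast
      have smin': "I r x" if r: "r \<in> N" and x: "x \<in> X" "I s x" for r x
      proof (rule ccontr)
        assume "\<not> I r x"
        then have "{v \<in> X. I r v} \<subset> {v \<in> X. I s v}"
          using chain[OF s r x(1,2)] x by blast
        then have "card {v \<in> X. I r v} < card {v \<in> X. I s v}"
          using fin by (intro psubset_card_mono) auto
        then show False using smin[OF r] by simp
      qed
      define A where "A = {x \<in> X - {a}. \<forall>r\<in>N. I r x}"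
      have Ab: "A \<subseteq> X - {a} - {b}" using N1 s unfolding A_def by blast
      have A0: "A \<noteq> {}" using s smin' unfolding A_def N_def by blast
      have bX: "b \<in> X - {a}" using b by blast
      have finXa: "finite (X - {a})" using fin by blast
      obtain x where xA: "x \<in> A" and block:
        "\<And>r u k v. u \<in> X - {a} \<Longrightarrow> (b, u) \<notin> (link I (X - {a}) {x})\<^sup>* \<Longrightarrow>
           (b, k) \<in> (link I (X - {a}) {x})\<^sup>* \<Longrightarrow> I r u \<Longrightarrow> I r k \<Longrightarrow> v \<in> X - {a} \<Longrightarrow>
           (b, v) \<notin> (link I (X - {a}) {x})\<^sup>* \<Longrightarrow> I r v"
      proof (rule block_exists[OF finXa Ab A0 bX, of I])
        \<comment> \<open>If \<open>r\<close> missed \<open>u\<close>, then a row of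
          \<open>N\<close> that misses \<open>u\<close> would lead from \<open>a\<close> to
          \<open>x\<close>, next \<open>r\<close> to \<open>k\<close>, and the component on to
          \<open>b\<close>, all avoiding \<open>u\<close>. With the end properties of
          \<open>a\<close> and \<open>b\<close> this makes \<open>a\<close>, \<open>b\<close>,
          \<open>u\<close> asteroidal.\<close>
        fix x u r k
        assume x: "x \<in> A" and u: "u \<in> X - {a}" "u \<notin> A" "(b, u) \<notin> (link I (X - {a}) {x})\<^sup>*"
          and k: "(b, k) \<in> (link I (X - {a}) {x})\<^sup>*" and r: "I r x" "I r k"
        show "I r u"
        proof (rule ccontr)
          assume nu: "\<not> I r u"
          from u obtain q where q: "q \<in> N" "\<not> I q u" unfolding A_def by blast
          have kX: "k \<in> X" using reach_in[OF k bX] by blast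
          have xX: "x \<in> X" "I q x" "I q a" using x q unfolding A_def N_def by auto
          have "(a, x) \<in> link I X {u}" "(x, k) \<in> link I X {u}"
            using aX xX q kX r nu by (auto intro: linkI)
          moreover have "(b, k) \<in> (link I X {u})\<^sup>*"
            using reach_mono[OF reach_avoid_unreachable[OF k u(3,1)], of X "{u}"] by blast
          ultimately have "(a, b) \<in> (link I X {u})\<^sup>*"
            by (meson converse_rtrancl_into_rtrancl reach_sym)
          moreover have "u \<noteq> b" using u(3) by blast
          ultimately have "asteroidal I X a b u"
            unfolding asteroidal_def using aX b u(1) enda[of b u] endb[of u a] by blast
          with noat show False by blast
        qed
      qed blast
      define K where "K = {v \<in> X - {a}. (b, v) \<in> (link I (X - {a}) {x})\<^sup>*}"
      define U where "U = X - {a} - K"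
      have block': "I r v" if "u \<in> U" "k \<in> K" "I r u" "I r k" "v \<in> U" for r u k v
        using block[of u k r v] that unfolding U_def K_def by blast
      have xX: "x \<in> X" "x \<noteq> a" "x \<noteq> b" using xA Ab by auto
      have bK: "b \<in> K" using bX unfolding K_def by simp
      have xK: "x \<notin> K" using reach_avoid_source xX(3) unfolding K_def by fast
      have xU: "x \<in> U" using xX xK unfolding U_def by blast
      \<comment> \<open>A path from \<open>x\<close> to \<open>b\<close> that avoids
        \<open>a\<close> has to leave \<open>U\<close>. The row of the leaving link contains all of
        \<open>U\<close> by the block property, so it connects \<open>U\<close> without
        \<open>a\<close>, and \<open>a\<close> can be made the first element of
        \<open>insert a U\<close>.\<close>
      have "\<exists>t. \<not> I t a \<and> (\<exists>u\<in>U. I t u) \<and> (\<exists>k\<in>K. I t k)"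
      proof -
        have "(v \<in> U \<or> (\<exists>t. \<not> I t a \<and> (\<exists>u\<in>U. I t u) \<and> (\<exists>k\<in>K. I t k)))" 
          if "(x, v) \<in> (link I X {a})\<^sup>*" for v
          using that
        proof (induction rule: rtrancl_induct)
          case (step y z)
          then obtain t where "y \<in> X" "z \<in> X" "I t y" "I t z" "\<not> I t a" unfolding link_def by blast
          then show ?case using step.IH unfolding U_def by blast
        qed (use xU in blast)
        with enda[of x b] xX b bK show ?thesis unfolding U_def by blast
      qed
      then obtain t where t: "\<not> I t a" "\<And>u. u \<in> U \<Longrightarrow> I t u" using block' by blast
      have "insert a U \<subset> X" using aX b bK unfolding U_def by blast
      then obtain lt2' where lt2': "arrangement I (insert a U) lt2'" using IH by blast
      have "\<exists>lt2. arrangement I (insert a U) lt2 \<and> (\<forall>v\<in>insert a U. v \<noteq> a \<longrightarrow> lt2 a v)"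
      proof (rule arrangement_end[OF lt2', of a x])
        fix v assume "v \<in> insert a U" "v \<noteq> a"
        then have "(x, v) \<in> link I (insert a U) {a}" using t xU by (auto intro!: linkI[of _ _ _ _ t])
        then show "(x, v) \<in> (link I (insert a U) {a})\<^sup>*" by blast
      qed (use xU xX in auto)
      then obtain lt2 where lt2: "arrangement I (insert a U) lt2"
        and lt2a: "\<forall>v\<in>U. v \<noteq> a \<longrightarrow> lt2 a v" by blast
      have "insert x K \<subset> X" using aX xX(1,2) unfolding K_def by auto
      then obtain lt1' where lt1': "arrangement I (insert x K) lt1'" using IH by blast
      have "\<exists>lt1. arrangement I (insert x K) lt1 \<and> (\<forall>v\<in>insert x K. v \<noteq> x \<longrightarrow> lt1 x v)"
      proof (rule arrangement_end[OF lt1', of x b])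
        fix v assume "v \<in> insert x K" "v \<noteq> x"
        then have "(b, v) \<in> (link I (X - {a}) {x})\<^sup>*" unfolding K_def by blast
        then show "(b, v) \<in> (link I (insert x K) {x})\<^sup>*"
        proof (induction rule: rtrancl_induct)
          case (step y z)
          then have "(b, z) \<in> (link I (X - {a}) {x})\<^sup>*" by (meson rtrancl.rtrancl_into_rtrancl)
          with step have "y \<in> K" "z \<in> K" unfolding K_def link_def by auto
          with step.hyps(2) have "(y, z) \<in> link I (insert x K) {x}" unfolding link_def by blast
          with step.IH show ?case by (meson rtrancl.rtrancl_into_rtrancl)
        qed simp
      qed (use bK xX in auto)
      then obtain lt1 where lt1: "arrangement I (insert x K) lt1"
        and lt1x: "\<forall>v\<in>K. v \<noteq> x \<longrightarrow> lt1 x v" by blast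
      have aK: "a \<notin> K" "a \<notin> U" unfolding K_def U_def by auto
      have UK: "U \<inter> K = {}" unfolding U_def by blast
      have XUK: "X = insert a U \<union> K" using aX unfolding U_def K_def by blast
      \<comment> \<open>A row that meets both \<open>insert a U\<close> and \<open>K\<close> is
        either full or contains all of \<open>U\<close>. In the second case it contains
        \<open>x\<close>, with which \<open>lt1\<close> begins, so its trace on \<open>K\<close> is
        an initial segment.\<close>
      define lt where "lt u v = (if u \<in> K \<and> v \<in> K then lt1 u v else if u \<in> K \<or> v \<in> K then v \<in> K else lt2 u v)"
        for u v
      have Nx: "I r x" if "I r a" "k \<in> K" "I r k" "\<exists>v\<in>X. \<not> I r v" for r k
      proof -
        have "r \<in> N" using that aK unfolding N_def K_def by blast
        then show ?thesis using xA unfolding A_def by blast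
      qed
      have prefix: "I r y" if "u \<in> insert a U" "k \<in> K" "I r u" "I r k" "y \<in> insert a U" "lt2 u y" for r u k y
      proof (cases "\<exists>v\<in>X. \<not> I r v")
        case True
        have "y \<in> U"
        proof -
          have "\<not> lt2 u a" using arrangementD(1,2)[OF lt2] lt2a that(1) by (metis insertE insertI1)
          with that show ?thesis by blast
        qed
        moreover have "\<exists>w\<in>U. I r w" using Nx[OF _ that(2,4) True] that xU by blast
        ultimately show ?thesis using block' that by blast
      next
        case False
        then show ?thesis using that(5) XUK by blast
      qed
      have Kpre: "I r y" if "u \<in> insert a U" "k \<in> K" "I r u" "I r k" "y \<in> K" "lt1 y k" for r u k y
      proof (cases "\<exists>v\<in>X. \<not> I r v")
        case True
        have "I r x" using Nx[OF _ that(2,4) True] that block' xU by blast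
        moreover have "lt1 x y" using lt1x that(5) xK by auto
        ultimately show ?thesis using lt1 that unfolding arrangement_def by blast
      next
        case False
        then show ?thesis using that(5) XUK by blast
      qed
      let ?U = "insert a U"
      note l1 = arrangementD[OF lt1] and l2 = arrangementD[OF lt2]
      have mem: "v \<in> X \<longleftrightarrow> v \<in> K \<or> v \<in> ?U" and disj: "v \<in> ?U \<Longrightarrow> v \<notin> K" for v
        using XUK UK aK by blast+
      have ltKK: "lt u v \<longleftrightarrow> lt1 u v" if "u \<in> K" "v \<in> K" for u v
        using that unfolding lt_def by simp
      have ltUU: "lt u v \<longleftrightarrow> lt2 u v" if "u \<in> ?U" "v \<in> ?U" for u v
        using that disj unfolding lt_def by auto
      have ltUK: "lt u v" "\<not> lt v u" if "u \<in> ?U" "v \<in> K" for u v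
        using that disj unfolding lt_def by auto
      have "arrangement I X lt"
      proof (rule arrangementI)
        fix p assume "p \<in> X"
        then show "\<not> lt p p"
          using l1(1)[of p] l2(1)[of p] ltKK[of p p] ltUU[of p p] mem[of p] by blast
      next
        fix p q w assume *: "p \<in> X" "q \<in> X" "w \<in> X" "lt p q" "lt q w"
        then consider "p \<in> K" "q \<in> K" "w \<in> K" | "p \<in> ?U" "w \<in> K" | "p \<in> ?U" "q \<in> ?U" "w \<in> ?U"
          using mem ltUK(2) by metis
        then show "lt p w"
        proof cases
          case 1
          with * l1(2)[of p q w] ltKK show ?thesis by blast
        next
          case 2
          with ltUK(1) show ?thesis by blast
        next
          case 3
          with * l2(2)[of p q w] ltUU show ?thesis by blast
        qed
      next
        fix p q assume "p \<in> X" "q \<in> X" "p \<noteq> q"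
        then show "lt p q \<or> lt q p"
          using l1(3) l2(3) ltKK ltUU ltUK(1) mem by (metis insertCI)
      next
        fix r p q w assume *: "p \<in> X" "q \<in> X" "w \<in> X" "lt p q" "lt q w" "I r p" "I r w"
        then consider "p \<in> K" "q \<in> K" "w \<in> K" | "p \<in> ?U" "q \<in> ?U" "w \<in> K"
          | "p \<in> ?U" "q \<in> K" "w \<in> K" | "p \<in> ?U" "q \<in> ?U" "w \<in> ?U"
          using mem ltUK(2) by metis
        then show "I r q"
        proof cases
          case 1
          with * l1(4)[of p q w r] ltKK show ?thesis by blast
        next
          case 2
          with * prefix[of p w r q] ltUU show ?thesis by blast
        next
          case 3
          with * Kpre[of p w r q] ltKK show ?thesis by blast
        next
          case 4
          with * l2(4)[of p q w r] ltUU show ?thesis by blast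
        qed
      qed
      with none show False by blast
    qed
  qed
qed

section \<open>Asteroidal triples without short ones\<close>

definition steps :: "('v \<Rightarrow> 'v \<Rightarrow> bool) \<Rightarrow> 'v set \<Rightarrow> ('v \<times> 'v) set" where
  "steps A S = {(u, v). A u v \<and> v \<in> S}"

locale bipartite_graph =
  fixes V :: "'v set" and side :: "'v \<Rightarrow> bool" and adj :: "'v \<Rightarrow> 'v \<Rightarrow> bool"
  assumes finite_V: "finite V"
    and adj_in: "adj u v \<Longrightarrow> u \<in> V"
    and adj_sym: "adj u v \<Longrightarrow> adj v u"
    and adj_side: "adj u v \<Longrightarrow> side u \<noteq> side v"
begin

definition L :: "'v set \<Rightarrow> ('v \<times> 'v) set" where
  "L Z = link adj V Z"

definition near :: "'v set \<Rightarrow> nat \<Rightarrow> 'v \<Rightarrow> 'v \<Rightarrow> bool" where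
  "near Z k u v \<longleftrightarrow> (\<exists>j\<le>k. (u, v) \<in> L Z ^^ j)"

definition short_triple :: "nat \<Rightarrow> 'v \<Rightarrow> 'v \<Rightarrow> 'v \<Rightarrow> bool" where
  "short_triple n a b c \<longleftrightarrow> a \<noteq> b \<and> side a = side b \<and> side b = side c \<and>
     (\<exists>i j k. (a, b) \<in> L {c} ^^ i \<and> (b, c) \<in> L {a} ^^ j \<and> (c, a) \<in> L {b} ^^ k \<and> i + j + k \<le> n)"

text \<open>The path from \<open>x\<close> to \<open>y\<close> together with \<open>r\<close>, \<open>c\<close> and \<open>r'\<close> is a cycle, which is
  chordless if the path is as short as possible.\<close>

definition hole :: "'v \<Rightarrow> 'v \<Rightarrow> 'v \<Rightarrow> 'v \<Rightarrow> 'v \<Rightarrow> bool" where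
  "hole x r c r' y \<longleftrightarrow> adj x r \<and> adj r c \<and> adj c r' \<and> adj r' y \<and> \<not> adj x r' \<and> \<not> adj r y \<and>
     (x, y) \<in> (steps adj (insert y {v \<in> V. \<not> adj c v \<and> \<not> adj r v \<and> \<not> adj r' v}))\<^sup>*"

lemma L_I: "adj r u \<Longrightarrow> adj r v \<Longrightarrow> \<forall>z\<in>Z. \<not> adj r z \<Longrightarrow> (u, v) \<in> L Z"
  unfolding L_def by (rule linkI) (auto dest: adj_sym adj_in)

lemma L_E:
  assumes "(u, v) \<in> L Z"
  obtains r where "adj r u" "adj r v" "\<forall>z\<in>Z. \<not> adj r z"
  using assms unfolding L_def link_def by blast

lemma L_sym: "(u, v) \<in> L Z \<Longrightarrow> (v, u) \<in> L Z"
  using sym_link[of adj V Z] unfolding L_def by (auto dest: symD)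

lemma L_mono: "Z' \<subseteq> Z \<Longrightarrow> L Z \<subseteq> L Z'"
  unfolding L_def by (intro link_mono) auto

lemma Ls_sym: "(u, v) \<in> (L Z)\<^sup>* \<Longrightarrow> (v, u) \<in> (L Z)\<^sup>*"
  unfolding L_def by (rule reach_sym)

lemma Ls_mono: "(u, v) \<in> (L Z)\<^sup>* \<Longrightarrow> Z' \<subseteq> Z \<Longrightarrow> (u, v) \<in> (L Z')\<^sup>*"
  using rtrancl_mono[OF L_mono] by blast

lemma L_side: "(u, v) \<in> L Z \<Longrightarrow> side u = side v"
  by (metis L_E adj_side)

lemma Ls_side: "(u, v) \<in> (L Z)\<^sup>* \<Longrightarrow> side u = side v"
  by (induction rule: rtrancl_induct) (auto dest: L_side)

lemma near_refl: "near Z k u u"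
  unfolding near_def by (rule exI[of _ 0]) simp

lemma near_L: "(u, v) \<in> L Z \<Longrightarrow> near Z 1 u v"
  unfolding near_def by (rule exI[of _ 1]) simp

lemma near_I: "adj r u \<Longrightarrow> adj r v \<Longrightarrow> \<forall>z\<in>Z. \<not> adj r z \<Longrightarrow> near Z 1 u v"
  by (intro near_L L_I)

lemma near_trans: "near Z i u v \<Longrightarrow> near Z j v w \<Longrightarrow> near Z (i + j) u w"
  unfolding near_def by (meson add_mono relpow_trans)

lemma near_Ls: "near Z k u v \<Longrightarrow> (u, v) \<in> (L Z)\<^sup>*"
  unfolding near_def by (auto dest: relpow_imp_rtrancl)

lemma near_sym: assumes "near Z k u v" shows "near Z k v u"
proof -
  have "(v, u) \<in> L Z ^^ j" if "(u, v) \<in> L Z ^^ j" for j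
    using that
  proof (induction j arbitrary: v)
    case (Suc j)
    then obtain w where "(u, w) \<in> L Z ^^ j" "(w, v) \<in> L Z" by auto
    with Suc.IH L_sym show ?case by (meson relpow_Suc_I2)
  qed simp
  with assms show ?thesis unfolding near_def by blast
qed

text \<open>The argument of \<open>reach_avoid_unreachable\<close>, with the number of links
  preserved.\<close>

lemma near_avoid:
  assumes "near Z k u v" "(u, q) \<notin> (L Z)\<^sup>*"
  shows "near (insert q Z) k u v"
proof -
  have "(u, v) \<in> L (insert q Z) ^^ j" if "(u, v) \<in> L Z ^^ j" for j
    using that
  proof (induction j arbitrary: v)
    case (Suc j)
    then obtain w where w: "(u, w) \<in> L Z ^^ j" "(w, v) \<in> L Z" by auto
    then obtain r where r: "adj r w" "adj r v" "\<forall>z\<in>Z. \<not> adj r z" by (auto elim: L_E)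
    have "\<not> adj r q"
      using assms(2) relpow_imp_rtrancl[OF w(1)] L_I[OF r(1) _ r(3)] by (meson rtrancl.rtrancl_into_rtrancl)
    with r have "(w, v) \<in> L (insert q Z)" by (intro L_I) auto
    with Suc.IH w show ?case by auto
  qed simp
  with assms(1) show ?thesis unfolding near_def by blast
qed

lemma near_anti:
  assumes "near Z k u v" "Z' \<subseteq> Z"
  shows "near Z' k u v"
proof -
  have "(u, v) \<in> L Z' ^^ j" if "(u, v) \<in> L Z ^^ j" for j
    using that L_mono[OF assms(2)] by (induction j arbitrary: v) auto
  with assms(1) show ?thesis unfolding near_def by blast
qed

text \<open>Take the first link whose row meets \<open>q\<close>: it starts at a vertex that is
  still reachable without \<open>q\<close>.\<close>

lemma first_hit:
  assumes "(u, b) \<in> (L Z)\<^sup>*" "(u, b) \<notin> (L (insert q Z))\<^sup>*"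
  obtains v r where "(u, v) \<in> (L (insert q Z))\<^sup>*" "adj r v" "adj r q" "\<forall>z\<in>Z. \<not> adj r z"
proof -
  have "(u, b) \<in> (L (insert q Z))\<^sup>* \<or>
      (\<exists>v r. (u, v) \<in> (L (insert q Z))\<^sup>* \<and> adj r v \<and> adj r q \<and> (\<forall>z\<in>Z. \<not> adj r z))"
    using assms(1)
  proof (induction rule: rtrancl_induct)
    case (step y z)
    from step.hyps(2) obtain r where r: "adj r y" "adj r z" "\<forall>z\<in>Z. \<not> adj r z" by (elim L_E)
    show ?case
    proof (cases "adj r q")
      case False
      with r have "(y, z) \<in> L (insert q Z)" by (intro L_I) auto
      with step.IH show ?thesis by (meson rtrancl.rtrancl_into_rtrancl)
    qed (use step.IH r in blast)
  qed simp
  with assms(2) that show ?thesis by blast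
qed

lemma first_entry:
  assumes "(u, v) \<in> (L Z)\<^sup>*" "\<not> adj r u" "adj r v"
  obtains z w where "(u, z) \<in> (L Z)\<^sup>*" "\<not> adj r z" "(z, w) \<in> L Z" "adj r w" "(w, v) \<in> (L Z)\<^sup>*"
proof -
  have "\<not> adj r v \<or> (\<exists>z w. (u, z) \<in> (L Z)\<^sup>* \<and> \<not> adj r z \<and> (z, w) \<in> L Z \<and> adj r w \<and> (w, v) \<in> (L Z)\<^sup>*)"
    using assms(1)
  proof (induction rule: rtrancl_induct)
    case (step y z)
    then show ?case by (cases "adj r y") (meson rtrancl.rtrancl_into_rtrancl rtrancl.rtrancl_refl)+
  qed (use assms in blast)
  with assms(3) that show ?thesis by blast
qed

lemma asteroidal_L:
  assumes "asteroidal adj {v \<in> V. side v = s} a b c"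
  shows "a \<noteq> b" "b \<noteq> c" "c \<noteq> a" "a \<in> V" "b \<in> V" "c \<in> V" "side a = s" "side b = s" "side c = s"
    "(a, b) \<in> (L {c})\<^sup>*" "(b, c) \<in> (L {a})\<^sup>*" "(c, a) \<in> (L {b})\<^sup>*"
  using assms reach_mono[of _ _ adj "{v \<in> V. side v = s}" _ V]
  unfolding asteroidal_def L_def by auto

section \<open>Shortest paths of links and their rows\<close>

definition geodesic :: "'v set \<Rightarrow> nat \<Rightarrow> (nat \<Rightarrow> 'v) \<Rightarrow> (nat \<Rightarrow> 'v) \<Rightarrow> bool" where
  "geodesic Z k y t \<longleftrightarrow>
     (\<forall>i<k. adj (t i) (y i) \<and> adj (t i) (y (Suc i)) \<and> (\<forall>z\<in>Z. \<not> adj (t i) z)) \<and>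
     (\<forall>i j. i < j \<longrightarrow> j \<le> k \<longrightarrow> y i \<noteq> y j) \<and>
     (\<forall>i j r. i < j \<longrightarrow> j \<le> k \<longrightarrow> adj r (y i) \<longrightarrow> adj r (y j) \<longrightarrow> (\<forall>z\<in>Z. \<not> adj r z) \<longrightarrow> j = Suc i)"

lemma geodesic_exists:
  assumes "(a, b) \<in> (L Z)\<^sup>*"
  obtains k y t where "geodesic Z k y t" "y 0 = a" "y k = b" "(a, b) \<in> L Z ^^ k"
proof -
  define k where "k = (LEAST k. (a, b) \<in> L Z ^^ k)"
  obtain k0 where "(a, b) \<in> L Z ^^ k0" using rtrancl_imp_relpow[OF assms] by blast
  then have k: "(a, b) \<in> L Z ^^ k" unfolding k_def by (rule LeastI)
  have least: "k \<le> k'" if "(a, b) \<in> L Z ^^ k'" for k' unfolding k_def using that by (rule Least_le)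
  from k obtain y where y: "y 0 = a" "y k = b" "\<forall>i<k. (y i, y (Suc i)) \<in> L Z"
    unfolding relpow_fun_conv by blast
  then have "\<forall>i<k. \<exists>r. adj r (y i) \<and> adj r (y (Suc i)) \<and> (\<forall>z\<in>Z. \<not> adj r z)"
    by (meson L_E)
  then obtain t where t: "\<forall>i<k. adj (t i) (y i) \<and> adj (t i) (y (Suc i)) \<and> (\<forall>z\<in>Z. \<not> adj (t i) z)"
    by metis
  have pre: "(a, y i) \<in> L Z ^^ i" if "i \<le> k" for i
    using that y unfolding relpow_fun_conv by (intro exI[of _ y]) auto
  have post: "(y j, b) \<in> L Z ^^ (k - j)" if "j \<le> k" for j
    using that y unfolding relpow_fun_conv by (intro exI[of _ "\<lambda>i. y (j + i)"]) auto
  have "y i \<noteq> y j" if "i < j" "j \<le> k" for i j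
  proof
    assume "y i = y j"
    then have "(a, b) \<in> L Z ^^ (i + (k - j))"
      using pre[of i] post[of j] that relpow_trans[of a "y j" i "L Z" b "k - j"] by simp
    from least[OF this] that show False by simp
  qed
  moreover have "j = Suc i" if "i < j" "j \<le> k" "adj r (y i)" "adj r (y j)" "\<forall>z\<in>Z. \<not> adj r z" for i j r
  proof -
    have "(y i, y j) \<in> L Z" using that by (intro L_I)
    then have "(a, y j) \<in> L Z ^^ Suc i" using pre[of i] that by (auto intro: relpow_Suc_I)
    then have "(a, b) \<in> L Z ^^ (Suc i + (k - j))"
      using post[OF that(2)] by (rule relpow_trans)
    from least[OF this] that show ?thesis by simp
  qed
  ultimately have "geodesic Z k y t" unfolding geodesic_def using t by blast
  with that y k show ?thesis by blast
qed

context
  fixes Z k y t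
  assumes geo: "geodesic Z k y t"
begin

lemma geo_adj: "i < k \<Longrightarrow> adj (t i) (y i)" "i < k \<Longrightarrow> adj (t i) (y (Suc i))"
  "i < k \<Longrightarrow> z \<in> Z \<Longrightarrow> \<not> adj (t i) z"
  using geo unfolding geodesic_def by blast+

lemma geo_distinct: "i < j \<Longrightarrow> j \<le> k \<Longrightarrow> y i \<noteq> y j"
  using geo unfolding geodesic_def by blast

lemma geo_induced: "i < j \<Longrightarrow> j \<le> k \<Longrightarrow> adj r (y i) \<Longrightarrow> adj r (y j) \<Longrightarrow> \<forall>z\<in>Z. \<not> adj r z \<Longrightarrow> j = Suc i"
  using geo unfolding geodesic_def by blast

lemma geo_adj_iff: "i < k \<Longrightarrow> j \<le> k \<Longrightarrow> adj (t i) (y j) \<longleftrightarrow> j = i \<or> j = Suc i"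
  using geo_adj geo_induced[of i j "t i"] geo_induced[of j "Suc i" "t i"]
  by (metis less_Suc_eq nat_neq_iff not_less_eq Suc_leI)

lemma geo_near: "i \<le> j \<Longrightarrow> j \<le> k \<Longrightarrow> (\<And>l z. i \<le> l \<Longrightarrow> l < j \<Longrightarrow> z \<in> Z' \<Longrightarrow> \<not> adj (t l) z) \<Longrightarrow>
    near Z' (j - i) (y i) (y j)"
proof (induction j rule: dec_induct)
  case base
  show ?case by (rule near_refl)
next
  case (step n)
  then have "near Z' (n - i) (y i) (y n)" by simp
  moreover have "near Z' 1 (y n) (y (Suc n))"
    using step geo_adj[of n] by (intro near_I[of "t n"]) auto
  ultimately have "near Z' (n - i + 1) (y i) (y (Suc n))" by (rule near_trans)
  then show ?case using step by (simp add: Suc_diff_le)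
qed

lemma geo_side: "i \<le> k \<Longrightarrow> side (y i) = side (y 0)"
  using near_Ls[OF geo_near[of 0 i Z]] geo_adj(3) Ls_side by fastforce

lemma geo_side_t: "i < k \<Longrightarrow> side (t i) \<noteq> side (y 0)"
  using geo_adj(1) adj_side geo_side by (metis less_imp_le)

lemma geo_walk:
  "i \<le> j \<Longrightarrow> j \<le> k \<Longrightarrow> (\<And>l. i \<le> l \<Longrightarrow> l < j \<Longrightarrow> t l \<in> A \<and> y (Suc l) \<in> A) \<Longrightarrow> (y i, y j) \<in> (steps adj A)\<^sup>*"
proof (induction j rule: dec_induct)
  case (step n)
  have "(y n, t n) \<in> steps adj A" "(t n, y (Suc n)) \<in> steps adj A"
    using step geo_adj[of n] adj_sym unfolding steps_def by auto
  with step show ?case by (meson Suc_leD less_Suc_eq rtrancl.rtrancl_into_rtrancl)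
qed simp

end

lemma geodesic_sub:
  assumes "geodesic Z k y t" "i \<le> j" "j \<le> k"
  shows "geodesic Z (j - i) (\<lambda>l. y (i + l)) (\<lambda>l. t (i + l))"
  unfolding geodesic_def
proof (intro conjI allI impI)
  fix l assume "l < j - i"
  then have "i + l < k" using assms by simp
  then show "adj (t (i + l)) (y (i + l))" "adj (t (i + l)) (y (i + Suc l))" "\<forall>z\<in>Z. \<not> adj (t (i + l)) z"
    using geo_adj[OF assms(1), of "i + l"] by auto
next
  fix a b assume "a < b" "b \<le> j - i"
  then show "y (i + a) \<noteq> y (i + b)" using geo_distinct[OF assms(1), of "i + a" "i + b"] assms by simp
next
  fix a b r assume "a < b" "b \<le> j - i" "adj r (y (i + a))" "adj r (y (i + b))" "\<forall>z\<in>Z. \<not> adj r z"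
  then show "b = Suc a" using geo_induced[OF assms(1), of "i + a" "i + b" r] assms by simp
qed

lemma geodesic_rev:
  assumes geo: "geodesic Z k y t"
  shows "geodesic Z k (\<lambda>i. y (k - i)) (\<lambda>i. t (k - Suc i))"
  unfolding geodesic_def
proof (intro conjI allI impI)
  fix i assume "i < k"
  then have "k - i = Suc (k - Suc i)" "k - Suc i < k" by auto
  then show "adj (t (k - Suc i)) (y (k - i))" "adj (t (k - Suc i)) (y (k - Suc i))"
    "\<forall>z\<in>Z. \<not> adj (t (k - Suc i)) z"
    using geo_adj[OF geo, of "k - Suc i"] by auto
next
  fix i j assume "i < j" "j \<le> k"
  then have "k - j < k - i" "k - i \<le> k" by arith+
  then show "y (k - i) \<noteq> y (k - j)" using geo_distinct[OF geo, of "k - j" "k - i"] by metis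
next
  fix i j r assume "i < j" "j \<le> k" "adj r (y (k - i))" "adj r (y (k - j))" "\<forall>z\<in>Z. \<not> adj r z"
  moreover from this have "k - j < k - i" "k - i \<le> k" by arith+
  ultimately have "k - i = Suc (k - j)" using geo_induced[OF geo, of "k - j" "k - i" r] by blast
  with \<open>i < j\<close> \<open>j \<le> k\<close> show "j = Suc i" by arith
qed

end

section \<open>Graphs with neither short triples nor chordless cycles\<close>

locale tame_graph = bipartite_graph +
  assumes no_short: "\<not> short_triple 18 a b c" and no_hole: "\<not> hole x r c r' y"
begin

lemma no_near:
  assumes "a \<noteq> b" "side a = side b" "side b = side c" "near {c} i a b" "near {a} j b c" "near {b} k c a"
    "i + j + k \<le> 18"
  shows False
proof -
  from assms(4-6) obtain i' j' k' where "i' \<le> i" "j' \<le> j" "k' \<le> k"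
    "(a, b) \<in> L {c} ^^ i'" "(b, c) \<in> L {a} ^^ j'" "(c, a) \<in> L {b} ^^ k'"
    unfolding near_def by blast
  with assms no_short show False unfolding short_triple_def by (meson add_mono order_trans)
qed

text \<open>A row that skips \<open>y l\<close> closes a chordless cycle with the stretch between
  its last neighbour before \<open>l\<close> and its first neighbour after \<open>l\<close>.
  Minimality of the path does not exclude this by itself, because the row may meet
  \<open>Z\<close>.\<close>

lemma geo_convex:
  assumes geo: "geodesic Z k y t" and r: "adj r (y i)" "adj r (y j)" and l: "i \<le> l" "l \<le> j" "j \<le> k"
  shows "adj r (y l)"
proof (rule ccontr)
  assume nl: "\<not> adj r (y l)"
  define i' where "i' = (GREATEST n. n \<le> l \<and> adj r (y n))"
  define j' where "j' = (LEAST n. l \<le> n \<and> adj r (y n))"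
  have i': "i' \<le> l \<and> adj r (y i')" unfolding i'_def
    by (rule GreatestI_nat[of "\<lambda>n. n \<le> l \<and> adj r (y n)" i l]) (use r l in auto)
  have i'max: "n \<le> i'" if "n \<le> l" "adj r (y n)" for n unfolding i'_def
    by (rule Greatest_le_nat[of "\<lambda>n. n \<le> l \<and> adj r (y n)" n l]) (use that in auto)
  have j': "l \<le> j' \<and> adj r (y j')" unfolding j'_def
    by (rule LeastI[of _ j]) (use r l in auto)
  have j'min: "j' \<le> n" if "l \<le> n" "adj r (y n)" for n unfolding j'_def
    by (rule Least_le) (use that in auto)
  have lt: "i' < l" "l < j'" using i' j' nl by (metis le_neq_implies_less)+
  have j'k: "j' \<le> k" using j'min[of j] r l by simp
  have between: "\<not> adj r (y n)" if "i' < n" "n < j'" for n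
    using i'max[of n] j'min[of n] that by (cases "n \<le> l") auto
  have i'k: "i' < k" "Suc i' < j'" using lt j'k by auto
  note iff = geo_adj_iff[OF geo] and sd = geo_side[OF geo] and sdt = geo_side_t[OF geo]
  define A where "A = insert (y j') {v \<in> V. \<not> adj (y i') v \<and> \<not> adj (t i') v \<and> \<not> adj r v}"
  have rs: "side r \<noteq> side (y 0)" using adj_side r(1) sd l by (metis le_trans)
  have "(y (Suc i'), y j') \<in> (steps adj A)\<^sup>*"
  proof (rule geo_walk[OF geo])
    fix n assume n: "Suc i' \<le> n" "n < j'"
    then have nk: "n < k" using j'k by simp
    have tn: "t n \<in> A"
      unfolding A_def
    proof (intro insertI2 CollectI conjI)
      show "t n \<in> V" using geo_adj(1)[OF geo nk] adj_in by blast
      show "\<not> adj (y i') (t n)" using iff[of n i'] n nk i'k adj_sym by (metis Suc_n_not_le_n le_SucI less_imp_le)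
      show "\<not> adj (t i') (t n)" using sdt[of n] sdt[of i'] nk i'k adj_side by metis
      show "\<not> adj r (t n)" using sdt[of n] rs nk adj_side by metis
    qed
    have "y (Suc n) \<in> A" 
    proof (cases "Suc n = j'")
      case False
      then have n': "Suc n < j'" using n by simp
      show ?thesis
        unfolding A_def
      proof (intro insertI2 CollectI conjI)
        show "y (Suc n) \<in> V" using geo_adj(2)[OF geo nk] adj_in adj_sym by blast
        show "\<not> adj (y i') (y (Suc n))" using sd[of "Suc n"] sd[of i'] nk i'k adj_side by (metis Suc_leI less_imp_le)
        show "\<not> adj (t i') (y (Suc n))" using iff[of i' "Suc n"] n nk i'k by auto
        show "\<not> adj r (y (Suc n))" using between[of "Suc n"] n n' by simp
      qed
    qed (simp add: A_def)
    with tn show "t n \<in> A \<and> y (Suc n) \<in> A" by blast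
  qed (use i'k j'k in auto)
  moreover have "\<not> adj (t i') (y j')" using iff[of i' j'] i'k j'k by auto
  moreover have "\<not> adj (y (Suc i')) r" using between[of "Suc i'"] i'k adj_sym by blast
  ultimately have "hole (y (Suc i')) (t i') (y i') r (y j')"
    unfolding hole_def A_def using geo_adj[OF geo i'k(1)] i' j' adj_sym by blast
  with no_hole show False by blast
qed

text \<open>On a longer path, \<open>t 0\<close>, \<open>t 2\<close> and \<open>t 4\<close> would
  form a triple with six links: any two of them are joined to \<open>r\<close> through one path
  vertex each, and these vertices are not adjacent to the third.\<close>

lemma geodesic_in_row:
  assumes geo: "geodesic Z k y t" and all: "\<And>i. i \<le> k \<Longrightarrow> adj r (y i)"
  shows "k \<le> 4"
proof (rule ccontr)
  note iff = geo_adj_iff[OF geo] and sdt = geo_side_t[OF geo]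
  assume "\<not> k \<le> 4"
  then have k5: "k \<ge> 5" by simp
  have sides: "side (t 0) = side (t 2)" "side (t 2) = side (t 4)" using sdt[of 0] sdt[of 2] sdt[of 4] k5 by auto
  have S: "near {z} 2 (t i) (t j)" if "i < k" "j < k" "\<not> adj z (y i)" "\<not> adj z (y j)" for i j z
  proof -
    have "near {z} 1 (t i) r"
      using that adj_sym[OF geo_adj(1)[OF geo]] adj_sym[OF all] adj_sym by (intro near_I[of "y i"]) auto
    moreover have "near {z} 1 r (t j)"
      using that adj_sym[OF geo_adj(1)[OF geo]] adj_sym[OF all] adj_sym by (intro near_I[of "y j"]) auto
    ultimately show ?thesis using near_trans[of "{z}" 1 _ _ 1] by (metis one_add_one)
  qed
  have "t 0 \<noteq> t 2" using iff[of 0 3] iff[of 2 3] k5 by auto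
  moreover have "near {t 4} 2 (t 0) (t 2)" "near {t 0} 2 (t 2) (t 4)" "near {t 2} 2 (t 4) (t 0)"
    using S[of 0 2 "t 4"] S[of 2 4 "t 0"] S[of 4 0 "t 2"] k5
      iff[of 4 0] iff[of 4 2] iff[of 0 2] iff[of 0 4] iff[of 2 4] iff[of 2 0] by auto
  ultimately show False using no_near[OF _ sides, of 2 2 2] by simp
qed

text \<open>The whole shortest path lies in the row by \<open>geo_convex\<close>. This is the source
  of the constant bounds: once a path has entered a row, four links suffice within it, even if the
  row itself meets \<open>Z\<close>.\<close>

lemma bounded_in_row:
  assumes r: "adj r v" "adj r w" and vw: "(v, w) \<in> (L Z)\<^sup>*"
  shows "near Z 4 v w"
proof -
  obtain k y t where geo: "geodesic Z k y t" and y: "y 0 = v" "y k = w" and k: "(v, w) \<in> L Z ^^ k"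
    using geodesic_exists[OF vw] .
  have "k \<le> 4"
    using geodesic_in_row[OF geo] geo_convex[OF geo, of r 0 k] r y by auto
  with k show ?thesis unfolding near_def by blast
qed

text \<open>On a shortest path from \<open>x\<close> to \<open>y\<close>, take a minimal stretch
  from a vertex that is only in \<open>r\<close> to one that is only in \<open>r'\<close>. If an
  inner vertex lies in both rows, the ends of the stretch and \<open>c\<close> form a triple with at
  most 5 + 1 + 1 links. Otherwise the stretch closes a hole with \<open>r\<close>, \<open>c\<close>
  and \<open>r'\<close>. Thus rows through \<open>c\<close> are nested on each component that avoids
  \<open>c\<close>.\<close>

lemma chain:
  assumes c: "adj r c" "adj r' c" and x: "adj r x" "\<not> adj r' x" and y: "adj r' y" "\<not> adj r y"
    and xy: "(x, y) \<in> (L {c})\<^sup>*"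
  shows False
proof -
  obtain k f t where geo: "geodesic {c} k f t" and f: "f 0 = x" "f k = y"
    using geodesic_exists[OF xy] by metis
  note sd = geo_side[OF geo] and sdt = geo_side_t[OF geo]
  define j where "j = (LEAST n. adj r' (f n) \<and> \<not> adj r (f n))"
  have j: "adj r' (f j) \<and> \<not> adj r (f j)" unfolding j_def by (rule LeastI[of _ k]) (use y f in auto)
  have jmin: "j \<le> n" if "adj r' (f n)" "\<not> adj r (f n)" for n unfolding j_def
    by (rule Least_le) (use that in auto)
  have jk: "j \<le> k" using jmin y f by simp
  define i where "i = (GREATEST n. n \<le> j \<and> adj r (f n) \<and> \<not> adj r' (f n))"
  have i: "i \<le> j \<and> adj r (f i) \<and> \<not> adj r' (f i)" unfolding i_def
    by (rule GreatestI_nat[of "\<lambda>n. n \<le> j \<and> adj r (f n) \<and> \<not> adj r' (f n)" 0 j]) (use x f in auto)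
  have imax: "n \<le> i" if "n \<le> j" "adj r (f n)" "\<not> adj r' (f n)" for n unfolding i_def
    by (rule Greatest_le_nat[of "\<lambda>n. n \<le> j \<and> adj r (f n) \<and> \<not> adj r' (f n)" n j]) (use that in auto)
  have ij: "i < j" using i j by (metis le_neq_implies_less)
  have same: "adj r (f n) \<longleftrightarrow> adj r' (f n)" if "i < n" "n < j" for n
    using jmin[of n] imax[of n] that by force
  have cs: "side c = side (f 0)" "side r \<noteq> side (f 0)" "side r' \<noteq> side (f 0)"
    using c x y adj_side f sd[of k] by (metis order_refl)+
  show False
  proof (cases "\<exists>n. i < n \<and> n < j \<and> adj r (f n)")
    case True
    then obtain n where n: "i < n" "n < j" "adj r (f n)" by blast
    have "adj r' (f (j - 1))"
      using geo_convex[OF geo, of r' n j "j - 1"] n same[of n] j jk by simp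
    then have "adj r (f (j - 1))" using same[of "j - 1"] n by simp
    then have "near {c} 4 (f i) (f (j - 1))"
      using i near_Ls[OF geo_near[OF geo, of i "j - 1" "{c}"]] geo_adj(3)[OF geo] n jk
      by (intro bounded_in_row[of r]) auto
    moreover have "near {c} 1 (f (j - 1)) (f j)"
      using geo_adj[OF geo, of "j - 1"] ij jk by (intro near_I[of "t (j - 1)"]) auto
    ultimately have "near {c} 5 (f i) (f j)" using near_trans[of "{c}" 4 _ _ 1] by simp
    moreover have "near {f i} 1 (f j) c" using i j c by (intro near_I[of r']) auto
    moreover have "near {f j} 1 c (f i)" using i j c by (intro near_I[of r]) auto
    moreover have "f i \<noteq> f j" using geo_distinct[OF geo ij jk] .
    ultimately show False using no_near[of "f i" "f j" c 5 1 1] cs sd[of i] sd[of j] ij jk by simp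
  next
    case False
    define A where "A = insert (f j) {v \<in> V. \<not> adj c v \<and> \<not> adj r v \<and> \<not> adj r' v}"
    have "(f i, f j) \<in> (steps adj A)\<^sup>*"
    proof (rule geo_walk[OF geo])
      fix n assume n: "i \<le> n" "n < j"
      then have nk: "n < k" using jk by simp
      have "t n \<in> A"
        unfolding A_def using sdt[OF nk] cs adj_side geo_adj[OF geo nk] adj_in adj_sym by blast
      moreover have "f (Suc n) \<in> A"
      proof (cases "Suc n = j")
        case False
        then have "\<not> adj r (f (Suc n)) \<and> \<not> adj r' (f (Suc n))"
          using \<open>\<nexists>n. i < n \<and> n < j \<and> adj r (f n)\<close> same[of "Suc n"] n by auto
        moreover have "\<not> adj c (f (Suc n))" using cs sd[of "Suc n"] adj_side nk by (metis Suc_leI)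
        ultimately show ?thesis
          unfolding A_def using geo_adj(2)[OF geo nk] adj_in adj_sym by blast
      qed (simp add: A_def)
      ultimately show "t n \<in> A \<and> f (Suc n) \<in> A" ..
    qed (use ij jk in auto)
    moreover have "A = insert (f j) {v \<in> V. \<not> adj c v \<and> \<not> adj r v \<and> \<not> adj r' v}" by (fact A_def)
    ultimately have "hole (f i) r c r' (f j)"
      unfolding hole_def using i j c adj_sym by metis
    with no_hole show False by blast
  qed
qed

section \<open>Where a third vertex is attached to a shortest path\<close>

context
  fixes p x t u
  assumes geo: "geodesic {u} p x t" and us: "side u = side (x 0)"
begin

text \<open>The rows \<open>t (m - 1)\<close> and \<open>t m\<close> share \<open>x m\<close>, while
  \<open>x (m - 1)\<close> and \<open>x (m + 1)\<close> belong to one of them only. Hence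
  \<open>chain\<close> forbids any detour around \<open>x m\<close>.\<close>

lemma ends_apart: "i < m \<Longrightarrow> m < j \<Longrightarrow> j \<le> p \<Longrightarrow> (x i, x j) \<notin> (L {x m})\<^sup>*"
  and before: "i < m \<Longrightarrow> j < m \<Longrightarrow> m \<le> p \<Longrightarrow> (x i, x j) \<in> (L {x m})\<^sup>*"
  and after: "m < i \<Longrightarrow> m < j \<Longrightarrow> i \<le> p \<Longrightarrow> j \<le> p \<Longrightarrow> (x i, x j) \<in> (L {x m})\<^sup>*"
proof -
  note iff = geo_adj_iff[OF geo]
  have before': "(x i, x j) \<in> (L {x m})\<^sup>*" if "i \<le> j" "j < m" "m \<le> p" for i j m
    using that iff by (intro near_Ls[OF geo_near[OF geo]]) auto
  have after': "(x i, x j) \<in> (L {x m})\<^sup>*" if "m < i" "i \<le> j" "j \<le> p" for i j m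
    using that iff by (intro near_Ls[OF geo_near[OF geo]]) auto
  show before: "(x i, x j) \<in> (L {x m})\<^sup>*" if "i < m" "j < m" "m \<le> p" for i j m
    using that before'[of i j m] Ls_sym[OF before'[of j i m]] by linarith
  show after: "(x i, x j) \<in> (L {x m})\<^sup>*" if "m < i" "m < j" "i \<le> p" "j \<le> p" for i j m
    using that after'[of m i j] Ls_sym[OF after'[of m j i]] by linarith
  show "(x i, x j) \<notin> (L {x m})\<^sup>*" if "i < m" "m < j" "j \<le> p" for i j m
  proof
    assume "(x i, x j) \<in> (L {x m})\<^sup>*"
    then have "(x (m - 1), x (Suc m)) \<in> (L {x m})\<^sup>*"
      using rtrancl_trans[OF rtrancl_trans[OF before[of "m - 1" m i]] after[of m j "Suc m"]] that by auto
    moreover have "m \<noteq> 0" using that by simp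
    then obtain m' where m': "m = Suc m'" using not0_implies_Suc by blast
    ultimately show False
      using chain[of "t m'" "x m" "t m" "x m'" "x (Suc m)"] iff that by auto
  qed
qed

lemma not_u: "i < p \<Longrightarrow> \<not> adj (t i) u"
  using geo_adj(3)[OF geo] by blast

text \<open>The vertex \<open>x 1\<close> separates \<open>u\<close> from \<open>x p\<close>, so the
  path to \<open>x p\<close> that avoids \<open>x 0\<close> reaches a row through
  \<open>x 1\<close>. By nestedness it has entered \<open>t 0\<close> before. The vertex
  \<open>z\<close> just before that entry forms a triple with \<open>x 0\<close> and
  \<open>x 2\<close>, with at most 2 + 7 + 2 links.\<close>

lemma not_near_first:
  assumes p: "2 \<le> p" and ua: "(u, x 0) \<in> (L {x 1})\<^sup>*" and ub: "(u, x p) \<in> (L {x 0})\<^sup>*"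
  shows False
proof -
  note iff = geo_adj_iff[OF geo] and sd = geo_side[OF geo]
  have "(u, x p) \<notin> (L {x 1})\<^sup>*"
    using ends_apart[of 0 1 p] ua p Ls_sym by (metis One_nat_def Suc_le_lessD less_one numeral_2_eq_2 order_refl rtrancl_trans)
  then have "(u, x p) \<notin> (L {x 1, x 0})\<^sup>*" using Ls_mono[of _ _ "{x 1, x 0}" "{x 1}"] by blast
  then obtain v r where v: "(u, v) \<in> (L {x 1, x 0})\<^sup>*" "adj r v" "adj r (x 1)" "\<not> adj r (x 0)"
    by (rule first_hit[OF ub]) auto
  have uv: "(u, v) \<in> (L {x 1})\<^sup>*" using Ls_mono[OF v(1)] by blast
  have tv: "adj (t 0) v"
    using chain[of "t 0" "x 1" r "x 0" v] iff[of 0 1] iff[of 0 0] v p rtrancl_trans[OF Ls_sym[OF ua] uv] by auto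
  obtain z w where z: "(u, z) \<in> (L {x 1, x 0})\<^sup>*" "\<not> adj (t 0) z" "(z, w) \<in> L {x 1, x 0}" "adj (t 0) w"
    "(w, v) \<in> (L {x 1, x 0})\<^sup>*"
    using first_entry[OF v(1) _ tv] not_u[of 0] p by auto
  have uz: "(u, z) \<in> (L {x 1})\<^sup>*" using Ls_mono[OF z(1)] by blast
  have zs: "side z = side (x 0)" using Ls_side[OF uz] us by simp
  have wv: "near {x 1, x 0} 4 w v" using bounded_in_row[OF z(4) tv z(5)] .
  have t1z: "\<not> adj (t 1) z"
    using chain[of "t 0" "x 1" "t 1" "x 0" z] iff[of 0 1] iff[of 0 0] iff[of 1 1] iff[of 1 0] p z(2)
      rtrancl_trans[OF Ls_sym[OF ua] uz] by auto
  have "near {z} (1 + 1) (x 0) (x 2)"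
    using near_trans[OF near_I[of "t 0" "x 0" "x 1" "{z}"] near_I[of "t 1" "x 1" "x 2" "{z}"]]
      iff[of 0 0] iff[of 0 1] iff[of 1 1] iff[of 1 2] p z(2) t1z by auto
  moreover have "near {x 0} (1 + 1 + 4 + 1) (x 2) z"
  proof -
    have "near {x 0} 1 (x 2) (x 1)" using iff[of 1 2] iff[of 1 1] iff[of 1 0] p by (intro near_I[of "t 1"]) auto
    moreover have "near {x 0} 1 (x 1) v" using v by (intro near_I[of r]) auto
    moreover have "near {x 0} 4 v w" using near_anti[OF near_sym[OF wv]] by blast
    moreover have "near {x 0} 1 w z" using near_anti[OF near_sym[OF near_L[OF z(3)]]] by blast
    ultimately show ?thesis using near_trans by blast
  qed
  moreover have "near {x 2} (1 + 1) z (x 0)"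
  proof -
    have "(z, x 2) \<notin> (L {x 1})\<^sup>*"
      using ends_apart[of 0 1 2] p rtrancl_trans[OF rtrancl_trans[OF Ls_sym[OF ua] uz]] by auto
    moreover have "near {x 1} 1 z w" using near_anti[OF near_L[OF z(3)]] by blast
    ultimately have "near {x 2} 1 z w" using near_anti[OF near_avoid, of "{x 1}" 1 z w "x 2"] by blast
    moreover have "near {x 2} 1 w (x 0)" using z(4) iff[of 0 0] iff[of 0 2] p by (intro near_I[of "t 0"]) auto
    ultimately show ?thesis by (rule near_trans)
  qed
  moreover have "x 0 \<noteq> x 2" using geo_distinct[OF geo, of 0 2] p by simp
  ultimately show False using no_near[of "x 0" "x 2" z "1 + 1" "1 + 1 + 4 + 1" "1 + 1"] sd[of 2] p zs by simp
qed

text \<open>A short asteroidal triple is formed by \<open>x m\<close>, \<open>x (m + 3)\<close> and the last vertex \<open>z\<close> outside the row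
  \<open>t (m + 1)\<close> on a path from \<open>u\<close> to it.\<close>

lemma not_between:
  assumes m: "m + 3 \<le> p" and ub: "(u, x p) \<in> (L {x (m + 1)})\<^sup>*" and ua: "(u, x 0) \<in> (L {x (m + 2)})\<^sup>*"
  shows False
proof -
  note iff = geo_adj_iff[OF geo] and sd = geo_side[OF geo]
  let ?Z = "{x (m + 1), x (m + 2)}"
  have nua: "(u, x 0) \<notin> (L {x (m + 1)})\<^sup>*"
    using ends_apart[of 0 "m + 1" p] m rtrancl_trans[OF Ls_sym, OF _ ub] by auto
  have nub: "(u, x p) \<notin> (L {x (m + 2)})\<^sup>*"
    using ends_apart[of 0 "m + 2" p] m rtrancl_trans[OF Ls_sym, OF ua] by auto
  have reach1: "(u, x i) \<in> (L {x (m + 1)})\<^sup>*" if "m + 1 < i" "i \<le> p" for i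
    using rtrancl_trans[OF ub after[of "m + 1" p i]] that by auto
  have reach2: "(u, x i) \<in> (L {x (m + 2)})\<^sup>*" if "i < m + 2" for i
    using rtrancl_trans[OF ua before[of 0 "m + 2" i]] that m by auto
  have nreach1: "(u, x i) \<notin> (L {x (m + 1)})\<^sup>*" if "i < m + 1" for i
    using nua rtrancl_trans[of u "x i" _ "x 0"] before[of i "m + 1" 0] that m by auto
  have nreach2: "(u, x i) \<notin> (L {x (m + 2)})\<^sup>*" if "m + 2 < i" "i \<le> p" for i
    using nub rtrancl_trans[of u "x i" _ "x p"] after[of "m + 2" i p] that by auto
  have to1: "(u, v) \<in> (L {x (m + 1)})\<^sup>*" and to2: "(u, v) \<in> (L {x (m + 2)})\<^sup>*" if "(u, v) \<in> (L ?Z)\<^sup>*" for v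
    using Ls_mono[OF that] by auto
  \<comment> \<open>By \<open>chain\<close> at \<open>x (m + 2)\<close>, a row through it that
    misses \<open>x (m + 1)\<close> is contained in \<open>t (m + 1)\<close> as far as the component
    of \<open>u\<close> is concerned. The fact \<open>left\<close> is the mirror image.\<close>
  have right: "adj (t (m + 1)) v"
    if "adj r v" "adj r (x (m + 2))" "\<not> adj r (x (m + 1))" "(u, v) \<in> (L {x (m + 2)})\<^sup>*" for r v
    using chain[of "t (m + 1)" "x (m + 2)" r "x (m + 1)" v] that iff[of "m + 1" "m + 1"] iff[of "m + 1" "m + 2"] m
      rtrancl_trans[OF Ls_sym[OF reach2[of "m + 1"]] that(4)] by auto
  have left: "adj (t (m + 1)) v"
    if "adj r v" "adj r (x (m + 1))" "\<not> adj r (x (m + 2))" "(u, v) \<in> (L {x (m + 1)})\<^sup>*" for r v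
    using chain[of "t (m + 1)" "x (m + 1)" r "x (m + 2)" v] that iff[of "m + 1" "m + 1"] iff[of "m + 1" "m + 2"] m
      rtrancl_trans[OF Ls_sym[OF reach1[of "m + 2"]] that(4)] by auto
  have "(u, x p) \<notin> (L {x (m + 2), x (m + 1)})\<^sup>*" using nub Ls_mono[of u "x p" _ "{x (m + 2)}"] by blast
  then obtain v r where v: "(u, v) \<in> (L ?Z)\<^sup>*" "adj r v" "adj r (x (m + 2))" "\<not> adj r (x (m + 1))"
    by (rule first_hit[OF ub]) (auto simp: insert_commute)
  have "(u, x 0) \<notin> (L {x (m + 1), x (m + 2)})\<^sup>*" using nua Ls_mono[of u "x 0" _ "{x (m + 1)}"] by blast
  then obtain v' r' where v': "(u, v') \<in> (L ?Z)\<^sup>*" "adj r' v'" "adj r' (x (m + 1))" "\<not> adj r' (x (m + 2))"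
    by (rule first_hit[OF ua]) auto
  have tv: "adj (t (m + 1)) v" using right v to2 by blast
  have tv': "adj (t (m + 1)) v'" using left v' to1 by blast
  \<comment> \<open>As \<open>w\<close>, \<open>v\<close> and \<open>v'\<close> all lie in the row
    \<open>t (m + 1)\<close>, four links lead from \<open>w\<close> to each of the others, hence
    five from \<open>z\<close>. The final triple has at most 3 + 7 + 7 links.\<close>
  obtain z w where z: "(u, z) \<in> (L ?Z)\<^sup>*" "\<not> adj (t (m + 1)) z" "(z, w) \<in> L ?Z" "adj (t (m + 1)) w"
    "(w, v) \<in> (L ?Z)\<^sup>*"
    by (rule first_entry[OF v(1) _ tv]) (use not_u[of "m + 1"] m in auto)
  have uw: "(u, w) \<in> (L ?Z)\<^sup>*" using z by (meson rtrancl.rtrancl_into_rtrancl)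
  have zs: "side z = side (x 0)" using Ls_side[OF z(1)] us by simp
  have wv: "near ?Z 4 w v" using bounded_in_row[OF z(4) tv z(5)] .
  have wv': "near ?Z 4 w v'"
    using bounded_in_row[OF z(4) tv'] rtrancl_trans[OF Ls_sym[OF uw] v'(1)] by blast
  have zv: "near ?Z 5 z v" "near ?Z 5 z v'"
    using near_trans[OF near_L[OF z(3)] wv] near_trans[OF near_L[OF z(3)] wv'] by simp_all
  have z1: "\<not> adj (t m) z" using left[of "t m" z] z to1 iff[of m "m + 1"] iff[of m "m + 2"] m by auto
  have z3: "\<not> adj (t (m + 2)) z"
    using right[of "t (m + 2)" z] z to2 iff[of "m + 2" "m + 1"] iff[of "m + 2" "m + 2"] m by auto
  have "near {z} 3 (x m) (x (m + 3))"
  proof -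
    have "l = m \<or> l = m + 1 \<or> l = m + 2" if "m \<le> l" "l < m + 3" for l using that by arith
    then have "near {z} (m + 3 - m) (x m) (x (m + 3))"
      using m z(2) z1 z3 by (intro geo_near[OF geo]) auto
    then show ?thesis by simp
  qed
  moreover have "near {x m} (1 + 1 + 5) (x (m + 3)) z"
  proof -
    have "near {x m} 1 (x (m + 3)) (x (m + 2))"
      using iff[of "m + 2" "m + 3"] iff[of "m + 2" "m + 2"] iff[of "m + 2" m] m by (intro near_I[of "t (m + 2)"]) auto
    moreover have "\<not> adj r (x m)"
      using right[OF _ v(3,4) reach2, of m] iff[of "m + 1" m] m by auto
    then have "near {x m} 1 (x (m + 2)) v" using v by (intro near_I[of r]) auto
    moreover have "(z, x m) \<notin> (L {x (m + 1)})\<^sup>*"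
      using nreach1[of m] rtrancl_trans[OF to1[OF z(1)]] by auto
    then have "(z, x m) \<notin> (L ?Z)\<^sup>*" using Ls_mono[of z "x m" ?Z "{x (m + 1)}"] by blast
    then have "near {x m} 5 v z" using near_anti[OF near_sym[OF near_avoid[OF zv(1)]]] by blast
    ultimately show ?thesis using near_trans by blast
  qed
  moreover have "near {x (m + 3)} (5 + 1 + 1) z (x m)"
  proof -
    have "near {x (m + 3)} 1 (x (m + 1)) (x m)"
      using iff[of m "m + 3"] iff[of m "m + 1"] iff[of m m] m by (intro near_I[of "t m"]) auto
    moreover have "\<not> adj r' (x (m + 3))"
      using left[OF _ v'(3,4) reach1, of "m + 3"] iff[of "m + 1" "m + 3"] m by auto
    then have "near {x (m + 3)} 1 v' (x (m + 1))" using v' by (intro near_I[of r']) auto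
    moreover have "(z, x (m + 3)) \<notin> (L {x (m + 2)})\<^sup>*"
      using nreach2[of "m + 3"] m rtrancl_trans[OF to2[OF z(1)]] by auto
    then have "(z, x (m + 3)) \<notin> (L ?Z)\<^sup>*" using Ls_mono[of z "x (m + 3)" ?Z "{x (m + 2)}"] by blast
    then have "near {x (m + 3)} 5 z v'" using near_anti[OF near_avoid[OF zv(2)]] by blast
    ultimately show ?thesis using near_trans by blast
  qed
  moreover have "x m \<noteq> x (m + 3)" using geo_distinct[OF geo, of m "m + 3"] m by simp
  ultimately show False
    using no_near[of "x m" "x (m + 3)" z 3 "1 + 1 + 5" "5 + 1 + 1"] sd[of m] sd[of "m + 3"] m zs by simp
qed

text \<open>Let \<open>x (n + 1)\<close> be the first vertex beyond \<open>x (m + 1)\<close> that some row meeting both \<open>x (m + 1)\<close> and the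
  component of \<open>u\<close> misses. Then \<open>x m\<close>, \<open>x (n + 1)\<close> and a vertex \<open>z\<close> of that component form a short
  asteroidal triple.\<close>

lemma not_beside:
  assumes m: "m + 2 \<le> p" and nua: "(u, x 0) \<notin> (L {x (m + 1)})\<^sup>*" and nub: "(u, x p) \<notin> (L {x (m + 1)})\<^sup>*"
    and ub: "(u, x p) \<in> (L {x m})\<^sup>*" and ua: "(u, x 0) \<in> (L {x p})\<^sup>*"
  shows False
proof -
  note iff = geo_adj_iff[OF geo] and sd = geo_side[OF geo]
  let ?c = "x (m + 1)"
  have nreach1: "(u, x i) \<notin> (L {?c})\<^sup>*" if "i < m + 1" for i
    using nua rtrancl_trans[of u "x i" _ "x 0"] before[of i "m + 1" 0] that m by auto
  have nreach2: "(u, x i) \<notin> (L {?c})\<^sup>*" if "m + 1 < i" "i \<le> p" for i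
    using nub rtrancl_trans[of u "x i" _ "x p"] after[of "m + 1" i p] that by auto
  \<comment> \<open>The rows that attach the component of \<open>u\<close> to
    \<open>x (m + 1)\<close>; by \<open>chain\<close> they are nested on this component.\<close>
  define leaves where "leaves r \<longleftrightarrow> adj r ?c \<and> (\<exists>v. (u, v) \<in> (L {?c})\<^sup>* \<and> adj r v)" for r
  have comparable: "adj r' v \<or> adj r w" if "leaves r" "leaves r'" "adj r v" "adj r' w"
    "(u, v) \<in> (L {?c})\<^sup>*" "(u, w) \<in> (L {?c})\<^sup>*" for r r' v w
    using chain[of r ?c r' v w] that rtrancl_trans[OF Ls_sym[OF that(5)] that(6)] unfolding leaves_def by blast
  \<comment> \<open>The path to \<open>x p\<close> that avoids \<open>x m\<close> supplies an
    attaching row \<open>r1\<close> without \<open>x m\<close>. The path to \<open>x 0\<close> that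
    avoids \<open>x p\<close> supplies one without \<open>x p\<close>, which shows that the index
    \<open>n\<close> exists.\<close>
  have "(u, x p) \<notin> (L {?c, x m})\<^sup>*" using nub Ls_mono[of u "x p" _ "{?c}"] by blast
  then obtain v1 r1 where v1: "(u, v1) \<in> (L {?c, x m})\<^sup>*" "adj r1 v1" "adj r1 ?c" and r1: "\<not> adj r1 (x m)"
    by (rule first_hit[OF ub]) auto
  have v1c: "(u, v1) \<in> (L {?c})\<^sup>*" using Ls_mono[OF v1(1)] by blast
  have "(u, x 0) \<notin> (L {?c, x p})\<^sup>*" using nua Ls_mono[of u "x 0" _ "{?c}"] by blast
  then obtain v2' r2' where v2': "(u, v2') \<in> (L {?c, x p})\<^sup>*" "adj r2' v2'" "adj r2' ?c" "\<not> adj r2' (x p)"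
    by (rule first_hit[OF ua]) auto
  have r2': "leaves r2'" unfolding leaves_def using v2' Ls_mono[OF v2'(1), of "{?c}"] by blast
  define n where "n = (LEAST n. m + 1 \<le> n \<and> (\<exists>r. leaves r \<and> \<not> adj r (x (Suc n))))"
  have "m + 1 \<le> n \<and> (\<exists>r. leaves r \<and> \<not> adj r (x (Suc n)))"
    unfolding n_def by (rule LeastI[of _ "p - 1"]) (use r2' v2' m in auto)
  then obtain r2 where n: "m + 1 \<le> n" and r2: "leaves r2" "\<not> adj r2 (x (Suc n))" by blast
  have "n \<le> p - 1"
    unfolding n_def by (rule Least_le) (use r2' v2' m in auto)
  then have np: "n < p" using m by simp
  have all: "adj r (x l)" if "leaves r" "m + 1 \<le> l" "l \<le> n" for r l
  proof (cases "l = m + 1")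
    case False
    with that have "l - 1 < n" "m + 1 \<le> l - 1" "Suc (l - 1) = l" by auto
    with that show ?thesis
      using not_less_Least[of "l - 1" "\<lambda>n. m + 1 \<le> n \<and> (\<exists>r. leaves r \<and> \<not> adj r (x (Suc n)))", folded n_def] by metis
  qed (use that leaves_def in auto)
  have leaves1: "leaves r1" unfolding leaves_def using v1 v1c by blast
  obtain v2 where v2: "(u, v2) \<in> (L {?c})\<^sup>*" "adj r2 v2" using r2 unfolding leaves_def by blast
  obtain v where v: "(u, v) \<in> (L {?c})\<^sup>*" "adj r1 v" "adj r2 v"
    using comparable[OF leaves1 r2(1) v1(2) v2(2) v1c v2(1)] v1 v1c v2 by blast
  have n4: "n - (m + 1) \<le> 4"
  proof (rule geodesic_in_row[OF geodesic_sub[OF geo n]])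
    fix i assume "i \<le> n - (m + 1)"
    then show "adj r1 (x (m + 1 + i))" using n by (intro all[OF leaves1]) auto
  qed (use np in simp)
  \<comment> \<open>On the component of \<open>u\<close>, one of these two rows covers the other by
    nestedness. A vertex of the component outside the larger one is therefore missed by
    both.\<close>
  have "\<exists>r\<in>{t m, t (m + 1)}. \<forall>z. (u, z) \<in> (L {?c})\<^sup>* \<longrightarrow> adj (t m) z \<or> adj (t (m + 1)) z \<longrightarrow> adj r z"
  proof (rule ccontr)
    assume "\<not> ?thesis"
    then obtain z z' where z: "(u, z) \<in> (L {?c})\<^sup>*" "adj (t (m + 1)) z" "\<not> adj (t m) z"
      "(u, z') \<in> (L {?c})\<^sup>*" "adj (t m) z'" "\<not> adj (t (m + 1)) z'" by blast
    moreover have "leaves (t m)" "leaves (t (m + 1))"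
      unfolding leaves_def using z iff[of m "m + 1"] iff[of "m + 1" "m + 1"] m by auto
    ultimately show False using comparable[of "t (m + 1)" "t m" z z'] by blast
  qed
  then obtain r where r: "r = t m \<or> r = t (m + 1)"
    and rmax: "\<And>z. (u, z) \<in> (L {?c})\<^sup>* \<Longrightarrow> adj (t m) z \<or> adj (t (m + 1)) z \<Longrightarrow> adj r z" by blast
  \<comment> \<open>If \<open>r\<close> misses \<open>v\<close>, take \<open>z = v\<close>; since
    \<open>n - m <= 5\<close>, at most 6 + 4 links are used. Otherwise \<open>r\<close> is an
    attaching row and contains \<open>x n\<close>, which forces \<open>n <= m + 2\<close>. This
    leaves room for five links from \<open>z\<close> to \<open>v\<close>, in total at most 3 +
    14.\<close>
  have "\<exists>z k. (u, z) \<in> (L {?c})\<^sup>* \<and> \<not> adj r z \<and> near {?c} k z v \<and> n - m + 1 + 2 * (k + 2) \<le> 18"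
  proof (cases "adj r v")
    case False
    then show ?thesis using v n4 near_refl by (intro exI[of _ v] exI[of _ 0]) auto
  next
    case True
    then have "leaves r"
      unfolding leaves_def using r v iff[of m "m + 1"] iff[of "m + 1" "m + 1"] m by auto
    then have "n \<le> m + 2"
      using all[of r n] n r iff[of m n] iff[of "m + 1" n] np m by auto
    moreover obtain z w where z: "(u, z) \<in> (L {?c})\<^sup>*" "\<not> adj r z" "(z, w) \<in> L {?c}" "adj r w" "(w, v) \<in> (L {?c})\<^sup>*"
      by (rule first_entry[OF v(1) _ True]) (use not_u r m in auto)
    moreover have "near {?c} 5 z v"
      using near_trans[OF near_L[OF z(3)] bounded_in_row[OF z(4) True z(5)]] by simp
    ultimately show ?thesis by (intro exI[of _ z] exI[of _ 5]) auto
  qed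
  then obtain z k where z: "(u, z) \<in> (L {?c})\<^sup>*" "\<not> adj r z" and zv: "near {?c} k z v"
    and k: "n - m + 1 + 2 * (k + 2) \<le> 18" by blast
  have zs: "side z = side (x 0)" using Ls_side[OF z(1)] us by simp
  have tz: "\<not> adj (t l) z" if "m \<le> l" "l \<le> n" for l
  proof (cases "l \<le> m + 1")
    case True
    then show ?thesis using rmax[OF z(1)] z(2) that by (metis Suc_eq_plus1 le_SucE le_antisym)
  next
    case False
    show ?thesis
    proof
      assume "adj (t l) z"
      then have "(z, x l) \<in> L {?c}"
        using iff[of l l] iff[of l "m + 1"] that np False by (intro L_I[of "t l"]) auto
      with z(1) have "(u, x l) \<in> (L {?c})\<^sup>*" by (meson rtrancl.rtrancl_into_rtrancl)
      with nreach2[of l] False that np show False by auto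
    qed
  qed
  have "near {z} (n - m + 1) (x m) (x (n + 1))"
    using geo_near[OF geo, of m "n + 1" "{z}"] tz np n by (simp add: Suc_diff_le)
  moreover have "near {x m} (1 + 1 + k) (x (n + 1)) z"
  proof -
    have "near {x m} 1 (x (n + 1)) (x n)"
      using iff[of n n] iff[of n "n + 1"] iff[of n m] n np by (intro near_I[of "t n"]) auto
    moreover have "near {x m} 1 (x n) v"
      using all[OF leaves1, of n] n v r1 by (intro near_I[of r1]) auto
    moreover have "(z, x m) \<notin> (L {?c})\<^sup>*" using nreach1[of m] rtrancl_trans[OF z(1)] by auto
    then have "near {x m} k v z" using near_anti[OF near_sym[OF near_avoid[OF zv]]] by blast
    ultimately show ?thesis using near_trans by blast
  qed
  moreover have "near {x (n + 1)} (k + 1 + 1) z (x m)"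
  proof -
    have "near {x (n + 1)} 1 ?c (x m)"
      using iff[of m "n + 1"] iff[of m "m + 1"] iff[of m m] n np by (intro near_I[of "t m"]) auto
    moreover have "near {x (n + 1)} 1 v ?c"
      using r2 v unfolding leaves_def by (intro near_I[of r2]) auto
    moreover have "(z, x (n + 1)) \<notin> (L {?c})\<^sup>*"
      using nreach2[of "n + 1"] n np rtrancl_trans[OF z(1)] by auto
    then have "near {x (n + 1)} k z v" using near_anti[OF near_avoid[OF zv]] by blast
    ultimately show ?thesis using near_trans by blast
  qed
  moreover have "x m \<noteq> x (n + 1)" using geo_distinct[OF geo, of m "n + 1"] n np by simp
  moreover have "n - m + 1 + (1 + 1 + k) + (k + 1 + 1) \<le> 18" using k by presburger
  moreover have "side (x m) = side (x (n + 1))" "side (x (n + 1)) = side z"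
    using sd[of m] sd[of "n + 1"] n np zs by simp_all
  ultimately show False by (intro no_near[of "x m" "x (n + 1)" z])
qed

end

text \<open>Attachment next to either end is excluded first. On a longer path let \<open>x m\<close>
  be the first vertex after \<open>x 0\<close> that separates \<open>u\<close> from
  \<open>x p\<close>. As \<open>x (m - 1)\<close> does not separate them, \<open>u\<close> is
  attached between \<open>x (m - 1)\<close> and \<open>x m\<close> or at \<open>x m\<close> alone,
  and both have been excluded.\<close>

lemma path_length_le_1:
  assumes geo: "geodesic {u} p x t" and us: "side u = side (x 0)"
    and ub: "(u, x p) \<in> (L {x 0})\<^sup>*" and ua: "(u, x 0) \<in> (L {x p})\<^sup>*"
  shows "p \<le> 1"
proof (rule ccontr)
  assume "\<not> p \<le> 1"
  then have p: "2 \<le> p" by simp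
  have first: "(u, x 0) \<notin> (L {x 1})\<^sup>*"
    using not_near_first[OF geo us p _ ub] by blast
  have last: "(u, x p) \<notin> (L {x (p - 1)})\<^sup>*"
    using not_near_first[OF geodesic_rev[OF geo] _ p] us ub ua geo_side[OF geo, of p] by auto
  define m where "m = (LEAST m. 1 \<le> m \<and> (u, x p) \<notin> (L {x m})\<^sup>*)"
  have m: "1 \<le> m \<and> (u, x p) \<notin> (L {x m})\<^sup>*" unfolding m_def
    by (rule LeastI[of _ "p - 1"]) (use last p in auto)
  have "m \<le> p - 1" unfolding m_def by (rule Least_le) (use last p in auto)
  then have mp: "m + 1 \<le> p" using p by simp
  have "(u, x p) \<in> (L {x (m - 1)})\<^sup>*"
  proof (cases "m = 1")
    case False
    then have "m - 1 < m" "1 \<le> m - 1" using m by auto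
    then show ?thesis
      using not_less_Least[of "m - 1" "\<lambda>m. 1 \<le> m \<and> (u, x p) \<notin> (L {x m})\<^sup>*", folded m_def] by blast
  qed (use ub in simp)
  moreover obtain m' where m': "m = m' + 1" using m by (metis Suc_eq_plus1 Suc_le_D One_nat_def)
  ultimately have ub': "(u, x p) \<in> (L {x m'})\<^sup>*" by simp
  show False
  proof (cases "(u, x 0) \<in> (L {x m})\<^sup>*")
    case True
    with first m' have "m' \<noteq> 0" by (metis add_0)
    then obtain m'' where "m' = m'' + 1" by (metis Suc_eq_plus1 not0_implies_Suc)
    then show False using not_between[OF geo us, of m''] True ub' m' mp by simp
  next
    case False
    then show False using not_beside[OF geo us, of m'] m m' mp ub' ua by simp
  qed
qed

text \<open>Applied to each of the three vertices, \<open>path_length_le_1\<close> leaves one link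
  per path, so the triple would itself be short.\<close>

theorem no_asteroidal: "\<not> asteroidal adj {v \<in> V. side v = s} a b c"
proof
  assume "asteroidal adj {v \<in> V. side v = s} a b c"
  note ast = asteroidal_L[OF this]
  have "near {u} 1 v w"
    if sd: "side u = side v" and vw: "(v, w) \<in> (L {u})\<^sup>*" and wu: "(w, u) \<in> (L {v})\<^sup>*" and uv: "(u, v) \<in> (L {w})\<^sup>*"
    for u v w
  proof -
    obtain p x t where geo: "geodesic {u} p x t" "x 0 = v" "x p = w" and p: "(v, w) \<in> L {u} ^^ p"
      using geodesic_exists[OF vw] .
    have "p \<le> 1" using path_length_le_1[OF geo(1)] geo sd uv Ls_sym[OF wu] by simp
    with p show ?thesis unfolding near_def by blast
  qed
  then have "near {c} 1 a b" "near {a} 1 b c" "near {b} 1 c a" using ast by simp_all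
  then show False using no_near[of a b c 1 1 1] ast by simp
qed

theorem arrangement_exists: "\<exists>lt. arrangement adj {v \<in> V. side v = s} lt"
  using arrangement_if_no_asteroidal[of "{v \<in> V. side v = s}" adj] no_asteroidal finite_V by auto

end

section \<open>Adding edges\<close>

lemma arrangement_separates:
  assumes arr: "arrangement I X lt" and c: "c \<in> X" and a: "a \<in> X" "lt a c"
    and ab: "(a, b) \<in> (link I X {c})\<^sup>*"
  shows "lt b c"
  using ab
proof (induction rule: rtrancl_induct)
  case (step y z)
  then obtain r where r: "y \<in> X" "z \<in> X" "I r y" "I r z" "\<not> I r c" unfolding link_def by blast
  then have "z \<noteq> c" by auto
  then show ?case
    using arrangementD(3)[OF arr r(2) c] arrangementD(4)[OF arr r(1) c r(2) step.IH _ r(3,4)] r(5) by blast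
qed (use a in simp)

text \<open>In an arrangement, the middle one of three vertices separates the outer two.\<close>

lemma arrangement_no_asteroidal:
  assumes arr: "arrangement I X lt"
  shows "\<not> asteroidal I X a b c"
proof
  assume ast: "asteroidal I X a b c"
  have sep: "\<not> (lt x z \<and> lt z y)" if "x \<in> X" "y \<in> X" "z \<in> X" "(x, y) \<in> (link I X {z})\<^sup>*" for x y z
    using arrangement_separates[OF arr that(3,1) _ that(4)] arrangementD(1,2)[OF arr] that by blast
  have "\<not> (lt a c \<and> lt c b)" "\<not> (lt b c \<and> lt c a)" "\<not> (lt b a \<and> lt a c)" "\<not> (lt c a \<and> lt a b)"
    "\<not> (lt c b \<and> lt b a)" "\<not> (lt a b \<and> lt b c)"
    using sep ast reach_sym unfolding asteroidal_def by meson+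
  moreover have "lt a b \<or> lt b a" "lt b c \<or> lt c b" "lt a c \<or> lt c a"
    using arrangementD(3)[OF arr] ast unfolding asteroidal_def by auto
  ultimately show False by blast
qed

context bipartite_graph
begin

lemma L_restrict:
  assumes "(u, v) \<in> (L Z)\<^sup>*" "u \<in> V"
  shows "(u, v) \<in> (link adj {w \<in> V. side w = side u} Z)\<^sup>*"
  using assms
proof (induction rule: rtrancl_induct)
  case (step y z)
  have "side y = side u" "side z = side u"
    using Ls_side[OF step.hyps(1)] L_side[OF step.hyps(2)] by simp_all
  with step.hyps(2) have "(y, z) \<in> link adj {w \<in> V. side w = side u} Z"
    unfolding L_def link_def by blast
  with step show ?case by (meson rtrancl.rtrancl_into_rtrancl)
qed simp

definition biconvex :: bool where
  "biconvex \<longleftrightarrow> (\<forall>s. \<exists>lt. arrangement adj {v \<in> V. side v = s} lt)"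

lemma biconvex_no_triple:
  assumes bc: biconvex and s: "side a = side b" "side b = side c" and ab: "a \<noteq> b"
    and V: "a \<in> V" "b \<in> V" "c \<in> V"
    and reach: "(a, b) \<in> (L {c})\<^sup>*" "(b, c) \<in> (L {a})\<^sup>*" "(c, a) \<in> (L {b})\<^sup>*"
  shows False
proof -
  have ne: "w \<noteq> q" if "(v, w) \<in> (L {q})\<^sup>*" "v \<noteq> q" for v w q
    using reach_avoid_source that unfolding L_def by fast
  have "c \<noteq> a" using ne[OF reach(2)] ab by metis
  moreover have "b \<noteq> c" using ne[OF reach(1)] calculation by metis
  ultimately have "asteroidal adj {v \<in> V. side v = side a} a b c"
    unfolding asteroidal_def using L_restrict[OF reach(1) V(1)] L_restrict[OF reach(2) V(2)]
      L_restrict[OF reach(3) V(3)] ab s V by auto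
  with arrangement_no_asteroidal bc show False unfolding biconvex_def by metis
qed

text \<open>A chord of minimal span, with the closing edge counted as a chord, cuts off a chordless
  piece; its span is odd because the graph is bipartite. If the span exceeds 3, the vertices 0, 2
  and 4 of the piece form an asteroidal triple. Repeated use shows that a biconvex completion
  divides every cycle into quadrangles.\<close>

lemma ear_exists:
  assumes bc: biconvex and l: "6 \<le> length l" and step: "\<And>i. Suc i < length l \<Longrightarrow> adj (l ! i) (l ! Suc i)"
    and close: "adj (l ! 0) (l ! (length l - 1))" and dist: "distinct l"
  obtains i where "i + 3 < length l" "adj (l ! i) (l ! (i + 3))"
proof -
  have sides: "side (l ! i) = (side (l ! 0) \<noteq> odd i)" if "i < length l" for i
    using that
  proof (induction i)
    case (Suc i)
    then have "side (l ! i) \<noteq> side (l ! Suc i)" using adj_side step by blast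
    with Suc show ?case by auto
  qed simp
  have odd: "odd (j - i)" if "i < j" "j < length l" "adj (l ! i) (l ! j)" for i j
    using sides[of i] sides[of j] adj_side[OF that(3)] that by auto
  define chord where "chord d \<longleftrightarrow> 3 \<le> d \<and> (\<exists>i. i + d < length l \<and> adj (l ! i) (l ! (i + d)))" for d
  define d where "d = (LEAST d. chord d)"
  have "chord (length l - 1)" unfolding chord_def using close l by (intro conjI exI[of _ 0]) auto
  then have "chord d" unfolding d_def by (rule LeastI)
  then obtain i where d3: "3 \<le> d" and i: "i + d < length l" "adj (l ! i) (l ! (i + d))" unfolding chord_def by blast
  have dmin: "d \<le> d'" if "chord d'" for d' unfolding d_def using that by (rule Least_le)
  have dodd: "odd d" using odd[of i "i + d"] i d3 by simp
  have no: "b = Suc a" if "i \<le> a" "a < b" "b \<le> i + d" "a \<noteq> i \<or> b \<noteq> i + d" "adj (l ! a) (l ! b)" for a b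
  proof (rule ccontr)
    assume "b \<noteq> Suc a"
    have "odd (b - a)" using odd that i by simp
    with \<open>b \<noteq> Suc a\<close> that have "3 \<le> b - a" by presburger
    then have "chord (b - a)" unfolding chord_def using that i by (intro conjI exI[of _ a]) auto
    with dmin that show False by fastforce
  qed
  show ?thesis
  proof (cases "d = 3")
    case True
    with i that show ?thesis by simp
  next
    case False
    with d3 dodd have d5: "5 \<le> d" by presburger
    define x where "x k = l ! (i + k)" for k
    have st: "adj (x k) (x (Suc k))" "adj (x (Suc k)) (x k)" if "k < d" for k
      using step[of "i + k"] adj_sym that i unfolding x_def by auto
    have far: "\<not> adj (x b) (x a)" "\<not> adj (x a) (x b)" if "Suc a < b" "b \<le> d" "a \<noteq> 0 \<or> b \<noteq> d" for a b
      using no[of "i + a" "i + b"] adj_sym that unfolding x_def by auto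
    have sd: "side (x k) = (side (x 0) \<noteq> odd k)" if "k \<le> d" for k
      using that
    proof (induction k)
      case (Suc k)
      then show ?case using adj_side[OF st(1)[of k]] by auto
    qed simp
    define a b c where "a = x 0" and "b = x 2" and "c = x 4"
    have hop: "(x k, x (k + 2)) \<in> L {x m}" if "k + 2 \<le> d" "\<not> adj (x (Suc k)) (x m)" for k m
      using st(2)[of k] st(1)[of "Suc k"] that by (intro L_I[of "x (Suc k)"]) auto
    have "(a, b) \<in> (L {c})\<^sup>*"
      using hop[of 0 4] far[of 1 4] d5 unfolding a_def b_def c_def by (auto simp: numeral_2_eq_2)
    moreover have "(b, c) \<in> (L {a})\<^sup>*"
      using hop[of 2 0] far[of 0 3] d5 unfolding a_def b_def c_def by auto
    \<comment> \<open>The long way round: along the even vertices to \<open>x (d - 1)\<close>, and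
      from there over \<open>x d\<close> back to \<open>x 0\<close>.\<close>
    moreover have "(c, a) \<in> (L {b})\<^sup>*"
    proof -
      have run: "(c, x (4 + 2 * k)) \<in> (L {b})\<^sup>*" if "4 + 2 * k < d" for k
        using that
      proof (induction k)
        case (Suc k)
        have "(x (4 + 2 * k), x (4 + 2 * k + 2)) \<in> L {b}"
          unfolding b_def using Suc.prems by (intro hop far) auto
        moreover have "(c, x (4 + 2 * k)) \<in> (L {b})\<^sup>*" using Suc by simp
        ultimately show ?case by (simp add: rtrancl.rtrancl_into_rtrancl)
      qed (simp add: c_def)
      define k where "k = (d - 5) div 2"
      have k: "d = Suc (4 + 2 * k)" using d5 dodd unfolding k_def by presburger
      have "(x (4 + 2 * k), a) \<in> L {b}"
        using st(2)[of "4 + 2 * k"] far[of 2 d] i(2) k adj_sym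
        unfolding a_def b_def x_def by (intro L_I[of "l ! (i + d)"]) auto
      with run[of k] k show ?thesis by (auto intro: rtrancl.rtrancl_into_rtrancl)
    qed
    moreover have "a \<noteq> b" using dist d5 i unfolding a_def b_def x_def by (simp add: nth_eq_iff_index_eq)
    moreover have "side a = side b" "side b = side c"
      using sd[of 2] sd[of 4] d5 unfolding a_def b_def c_def by auto
    moreover have "a \<in> V" "b \<in> V" "c \<in> V"
      using st[of 0] st[of 2] st[of 4] d5 adj_in unfolding a_def b_def c_def by auto
    ultimately have False using biconvex_no_triple[OF bc] by blast
    then show ?thesis ..
  qed
qed

end

section \<open>Shortest paths\<close>

fun find_parent :: "('v \<Rightarrow> 'v \<Rightarrow> bool) \<Rightarrow> 'v \<Rightarrow> 'v list list \<Rightarrow> 'v list" where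
  "find_parent A v [] = []"
| "find_parent A v (p # ps) = (if A (hd p) v then v # p else find_parent A v ps)"

fun expand :: "('v \<Rightarrow> 'v \<Rightarrow> bool) \<Rightarrow> 'v list list \<Rightarrow> 'v list \<Rightarrow> 'v list list \<times> 'v list" where
  "expand A ps [] = ([], [])"
| "expand A ps (v # vs) =
     (let (qs, ws) = expand A ps vs; q = find_parent A v ps in if q = [] then (qs, v # ws) else (q # qs, ws))"

fun find_head :: "'v \<Rightarrow> 'v list list \<Rightarrow> 'v list" where
  "find_head y [] = []"
| "find_head y (p # ps) = (if hd p = y then p else find_head y ps)"

lemma expand_length: "length (fst (expand A ps vs)) + length (snd (expand A ps vs)) = length vs"
  by (induction A ps vs rule: expand.induct) (auto simp: Let_def split: prod.splits)

text \<open>The list \<open>ps\<close> holds one path for each vertex of the current layer, and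
  \<open>vs\<close> the vertices not yet visited. Every nonempty new layer is taken out of
  \<open>vs\<close>, which gives termination.\<close>

function bfs :: "('v \<Rightarrow> 'v \<Rightarrow> bool) \<Rightarrow> 'v \<Rightarrow> 'v list list \<Rightarrow> 'v list \<Rightarrow> 'v list" where
  "bfs A y ps vs =
     (let q = find_head y ps in if q \<noteq> [] then q else
      let qs = fst (expand A ps vs) in if qs = [] then [] else bfs A y qs (snd (expand A ps vs)))"
  by auto
termination
proof (relation "measure (\<lambda>(A, y, ps, vs). length vs)")
  fix A y ps vs q qs
  assume "(qs :: 'v list list) = fst (expand A ps vs)" "qs \<noteq> []"
  then have "length (fst (expand A ps vs)) > 0" by simp
  then show "((A, y, qs, snd (expand A ps vs)), A, y, ps, vs) \<in> measure (\<lambda>(A, y, ps, vs). length vs)"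
    using expand_length[of A ps vs] by (simp del: length_greater_0_conv)
qed simp

declare bfs.simps [simp del]

lemma find_parent_eq_Nil: "find_parent A v ps = [] \<longleftrightarrow> (\<forall>p\<in>set ps. \<not> A (hd p) v)"
  by (induction ps) auto

lemma find_parent_SomeD: "q = find_parent A v ps \<Longrightarrow> q \<noteq> [] \<Longrightarrow> \<exists>p\<in>set ps. A (hd p) v \<and> q = v # p"
  by (induction ps) (auto split: if_splits)

lemma expand_fst:
  "q \<in> set (fst (expand A ps vs)) \<Longrightarrow> \<exists>p\<in>set ps. \<exists>v\<in>set vs. A (hd p) v \<and> q = v # p"
  by (induction A ps vs rule: expand.induct)
    (auto simp: Let_def split: prod.splits if_splits dest!: find_parent_SomeD[OF refl])

lemma expand_hd:
  "v \<in> set vs \<Longrightarrow> p \<in> set ps \<Longrightarrow> A (hd p) v \<Longrightarrow> v \<in> hd ` set (fst (expand A ps vs))"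
proof (induction A ps vs rule: expand.induct)
  case (2 A ps w vs)
  obtain qs ws where e: "expand A ps vs = (qs, ws)" by fastforce
  show ?case
  proof (cases "v = w")
    case True
    then have "find_parent A w ps \<noteq> []" using 2 by (auto simp: find_parent_eq_Nil)
    with True find_parent_SomeD[OF refl this] show ?thesis by (auto simp: e Let_def)
  qed (use 2 e in \<open>auto simp: Let_def\<close>)
qed simp

lemma expand_snd: "set (snd (expand A ps vs)) = {v \<in> set vs. \<forall>p\<in>set ps. \<not> A (hd p) v}"
  by (induction A ps vs rule: expand.induct)
    (auto simp: Let_def find_parent_eq_Nil split: prod.splits if_splits)

lemma find_head_sound: "find_head y ps \<noteq> [] \<Longrightarrow> find_head y ps \<in> set ps \<and> hd (find_head y ps) = y"
  by (induction ps) auto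

lemma find_head_complete: "[] \<notin> set ps \<Longrightarrow> p \<in> set ps \<Longrightarrow> hd p = y \<Longrightarrow> find_head y ps \<noteq> []"
  by (induction ps) auto

text \<open>Paths are stored backwards, with the most recent vertex in front; the start
  \<open>x\<close> is exempt from lying in \<open>S\<close>.\<close>

definition apath :: "('v \<Rightarrow> 'v \<Rightarrow> bool) \<Rightarrow> 'v \<Rightarrow> 'v set \<Rightarrow> 'v list \<Rightarrow> bool" where
  "apath A x S p \<longleftrightarrow> p \<noteq> [] \<and> last p = x \<and> set (butlast p) \<subseteq> S \<and> (\<forall>i. Suc i < length p \<longrightarrow> A (p ! Suc i) (p ! i))"

lemma apath_Cons: "apath A x S p \<Longrightarrow> A (hd p) v \<Longrightarrow> v \<in> S \<Longrightarrow> apath A x S (v # p)"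
  unfolding apath_def by (auto simp: nth_Cons hd_conv_nth split: nat.splits)

lemma bfs_sound:
  assumes "\<forall>p\<in>set ps. apath A x S p" "set vs \<subseteq> S" "bfs A y ps vs \<noteq> []"
  shows "apath A x S (bfs A y ps vs) \<and> hd (bfs A y ps vs) = y"
  using assms
proof (induction A y ps vs rule: bfs.induct)
  case (1 A y ps vs)
  show ?case
  proof (cases "find_head y ps = []")
    case True
    let ?qs = "fst (expand A ps vs)" and ?ws = "snd (expand A ps vs)"
    have ne: "?qs \<noteq> []" and eq: "bfs A y ps vs = bfs A y ?qs ?ws"
      using 1(4) True bfs.simps[of A y ps vs] by (auto simp: Let_def split: if_splits)
    have "\<forall>p\<in>set ?qs. apath A x S p" using 1(2,3) by (auto dest!: expand_fst intro!: apath_Cons)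
    moreover have "set ?ws \<subseteq> S" using 1(3) expand_snd[of A ps vs] by blast
    ultimately show ?thesis using 1(1)[OF refl _ refl ne] True eq 1(4) by simp
  next
    case False
    with find_head_sound[OF False] 1(2) show ?thesis by (simp add: bfs.simps[of A y ps vs])
  qed
qed

text \<open>Cut the walk at its last visit to \<open>N\<close>. In the search \<open>N\<close> is
  the new layer, so the remainder of a walk uses only vertices that stay unvisited, and removing the
  layer does not increase distances.\<close>

lemma steps_last_visit:
  "(u, y) \<in> steps A S ^^ m \<Longrightarrow>
     (u, y) \<in> steps A (S - N) ^^ m \<or> (\<exists>w\<in>N. \<exists>m'<m. (w, y) \<in> steps A (S - N) ^^ m')"
proof (induction m arbitrary: y)
  case (Suc m)
  then obtain z where z: "(u, z) \<in> steps A S ^^ m" "A z y" "y \<in> S" by (auto simp: steps_def)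
  show ?case
  proof (cases "y \<in> N")
    case True
    then show ?thesis by (intro disjI2 bexI[of _ y] exI[of _ 0]) auto
  next
    case False
    then have "(z, y) \<in> steps A (S - N)" using z by (auto simp: steps_def)
    with Suc.IH[OF z(1)] show ?thesis by (meson Suc_less_eq relpow_Suc_I)
  qed
qed simp

lemma bfs_shortest:
  assumes "\<forall>p\<in>set ps. length p = n" "0 < n" "p \<in> set ps" "(hd p, y) \<in> steps A (set vs) ^^ m"
  shows "bfs A y ps vs \<noteq> [] \<and> length (bfs A y ps vs) \<le> n + m"
  using assms
proof (induction A y ps vs arbitrary: n m p rule: bfs.induct)
  case (1 A y ps vs)
  have nn: "[] \<notin> set ps" using 1(2,3) by auto
  show ?case
  proof (cases "find_head y ps = []")
    case False
    then have "bfs A y ps vs \<in> set ps" using find_head_sound[of y ps] by (simp add: bfs.simps[of A y ps vs])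
    with 1(2) nn show ?thesis by fastforce
  next
    case True
    then have "hd p \<noteq> y" using find_head_complete[OF nn 1(4)] by blast
    then obtain m0 where m: "m = Suc m0" using 1(5) by (cases m) auto
    let ?qs = "fst (expand A ps vs)" and ?ws = "snd (expand A ps vs)"
    define N where "N = hd ` set ?qs"
    from 1(5) obtain w where w: "A (hd p) w" "w \<in> set vs" "(w, y) \<in> steps A (set vs) ^^ m0"
      unfolding m by (metis (no_types, lifting) relpow_Suc_E2 steps_def case_prodD mem_Collect_eq)
    then have wN: "w \<in> N" unfolding N_def using expand_hd[OF w(2) 1(4)] by simp
    then have ne: "?qs \<noteq> []" unfolding N_def by auto
    have eq: "bfs A y ps vs = bfs A y ?qs ?ws"
      using True ne bfs.simps[of A y ps vs] by (simp add: Let_def)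
    have sub: "set vs - N \<subseteq> set ?ws" using expand_hd[of _ vs _ ps A] unfolding N_def expand_snd by blast
    have mono: "(u, z) \<in> steps A (set vs - N) ^^ k \<Longrightarrow> (u, z) \<in> steps A (set ?ws) ^^ k" for u z k
      using sub by (induction k arbitrary: z) (auto simp: steps_def)
    obtain w' k where w': "w' \<in> N" "k \<le> m0" "(w', y) \<in> steps A (set ?ws) ^^ k"
      using steps_last_visit[OF w(3), of N] wN mono by (meson less_imp_le order_refl)
    then obtain q where q: "q \<in> set ?qs" "hd q = w'" unfolding N_def by blast
    have "\<forall>p\<in>set ?qs. length p = Suc n" using 1(2) by (auto dest!: expand_fst)
    from 1(1)[OF refl _ refl ne this _ q(1), of k] True w' q(2)
    show ?thesis unfolding eq m by simp
  qed
qed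

section \<open>Branching\<close>

definition nonadj :: "('v \<Rightarrow> 'v \<Rightarrow> bool) \<Rightarrow> 'v \<Rightarrow> 'v list \<Rightarrow> 'v list" where
  "nonadj A c = filter (\<lambda>v. \<not> A c v)"

text \<open>A path alternates between the two sides, so positions 1, 3, ... hold the vertices that
  may be joined to \<open>c\<close>. The accumulator joins the candidates of the three
  paths.\<close>

fun flips :: "'v list \<Rightarrow> 'v \<Rightarrow> ('v \<times> 'v) list \<Rightarrow> ('v \<times> 'v) list" where
  "flips (y # r # p) c acc = (r, c) # flips p c acc"
| "flips p c acc = acc"

text \<open>The test \<open>drop 18 zs = []\<close> bounds the length without arithmetic, just as
  the program does with 18 projections.\<close>

definition try_triple :: "('v \<Rightarrow> 'v \<Rightarrow> bool) \<Rightarrow> ('v \<Rightarrow> bool) \<Rightarrow> 'v list \<Rightarrow> 'v \<Rightarrow> 'v \<Rightarrow> 'v \<Rightarrow> ('v \<times> 'v) list" where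
  "try_triple A side V a b c =
     (if a \<noteq> b \<and> side a = side b \<and> side b = side c then
        let p = bfs A b [[a]] (nonadj A c V); q = bfs A c [[b]] (nonadj A a V); r = bfs A a [[c]] (nonadj A b V)
        in if p \<noteq> [] \<and> q \<noteq> [] \<and> r \<noteq> [] then
             let zs = flips p c (flips q a (flips r b [])) in if drop 18 zs = [] then zs else []
           else []
      else [])"

definition try_hole :: "('v \<Rightarrow> 'v \<Rightarrow> bool) \<Rightarrow> 'v list \<Rightarrow> 'v \<Rightarrow> 'v \<Rightarrow> 'v \<Rightarrow> 'v \<Rightarrow> 'v \<Rightarrow> 'v list" where
  "try_hole A V x r c r' y =
     (if A x r \<and> A r c \<and> A c r' \<and> A r' y \<and> \<not> A x r' \<and> \<not> A r y then
        let q = bfs A y [[x]] (y # nonadj A c (nonadj A r (nonadj A r' V))) in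
        if q \<noteq> [] then r # c # r' # q else []
      else [])"

lemma flips_append: "flips p c acc = flips p c [] @ acc"
  by (induction p c acc rule: flips.induct) auto

lemma length_flips: "length (flips p c acc) = length p div 2 + length acc"
  by (induction p c acc rule: flips.induct) auto

lemma set_flips: "(v, w) \<in> set (flips p c []) \<Longrightarrow> w = c \<and> (\<exists>i. Suc i < length p \<and> odd i = False \<and> v = p ! Suc i)"
proof (induction p c "[] :: ('a \<times> 'a) list" rule: flips.induct)
  case (1 y r p c)
  then show ?case
  proof (cases "(v, w) = (r, c)")
    case False
    with 1 obtain i where "w = c" "Suc i < length p" "odd i = False" "v = p ! Suc i" by auto
    then show ?thesis by (intro conjI exI[of _ "Suc (Suc i)"]) auto
  qed (auto intro!: exI[of _ 0])
qed auto

context bipartite_graph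
begin

lemma apath_side:
  assumes "apath adj x S p" "i < length p"
  shows "side (p ! i) = (side (hd p) \<noteq> odd i)"
  using assms(2)
proof (induction i)
  case 0
  then show ?case by (simp add: hd_conv_nth)
next
  case (Suc i)
  then have "adj (p ! Suc i) (p ! i)" using assms(1) unfolding apath_def by blast
  with Suc adj_side show ?case by fastforce
qed

lemma apath_odd:
  assumes "apath adj x S p" "side x = side (hd p)"
  shows "odd (length p)"
  using apath_side[OF assms(1), of "length p - 1"] assms unfolding apath_def
  by (auto simp: last_conv_nth)

text \<open>A link is two edges. Vertices on the side of \<open>c\<close> are never adjacent to
  \<open>c\<close>, so avoiding its neighbourhood restricts only the intermediate rows.\<close>

lemma L_steps:
  assumes "(a, b) \<in> L {c} ^^ i" "side a = side c"
  shows "(a, b) \<in> steps adj {v \<in> V. \<not> adj c v} ^^ (2 * i)"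
  using assms(1)
proof (induction i arbitrary: b)
  case (Suc i)
  then obtain y where y: "(a, y) \<in> L {c} ^^ i" "(y, b) \<in> L {c}" by auto
  then obtain r where r: "adj r y" "adj r b" "\<not> adj r c" by (auto elim: L_E)
  have "side b = side c" using Ls_side[OF relpow_imp_rtrancl[OF Suc.prems]] assms(2) by simp
  then have "\<not> adj c b" using adj_side by blast
  then have "(y, r) \<in> steps adj {v \<in> V. \<not> adj c v}" "(r, b) \<in> steps adj {v \<in> V. \<not> adj c v}"
    using r adj_sym adj_in unfolding steps_def by blast+
  with Suc.IH[OF y(1)] have "(a, b) \<in> steps adj {v \<in> V. \<not> adj c v} ^^ Suc (Suc (2 * i))" by auto
  then show ?case by simp
qed simp

lemma steps_L:
  assumes "(a, b) \<in> steps adj {v \<in> V. \<not> adj c v} ^^ m" "m = 2 * i"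
  shows "(a, b) \<in> L {c} ^^ i"
  using assms
proof (induction i arbitrary: m b)
  case (Suc i)
  then have m: "m = Suc (Suc (2 * i))" by simp
  obtain y r where "(a, y) \<in> steps adj {v \<in> V. \<not> adj c v} ^^ (2 * i)"
    "(y, r) \<in> steps adj {v \<in> V. \<not> adj c v}" "(r, b) \<in> steps adj {v \<in> V. \<not> adj c v}"
    using Suc.prems(1) unfolding m by auto
  moreover have "(y, b) \<in> L {c}"
    using calculation(2,3) adj_sym unfolding steps_def by (intro L_I[of r]) blast+
  ultimately show ?case using Suc.IH[OF _ refl, of y] by auto
qed simp

end

definition chordless :: "('v \<Rightarrow> 'v \<Rightarrow> bool) \<Rightarrow> 'v list \<Rightarrow> 'v list \<Rightarrow> bool" where
  "chordless A V l \<longleftrightarrow> 4 \<le> length l \<and> even (length l) \<and> distinct l \<and> set l \<subseteq> set V \<and>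
     (\<forall>i. Suc i < length l \<longrightarrow> A (l ! i) (l ! Suc i)) \<and> A (l ! 0) (l ! (length l - 1)) \<and>
     (\<forall>i j. i < j \<longrightarrow> j < length l \<longrightarrow> A (l ! i) (l ! j) \<longrightarrow> j = Suc i \<or> i = 0 \<and> j = length l - 1)"

locale list_graph = bipartite_graph "set V" side adj
  for V :: "'v list" and side adj
begin

lemma set_nonadj: "set (nonadj adj c V) = {v \<in> set V. \<not> adj c v}"
  unfolding nonadj_def by auto

lemma bfs_nonadj:
  assumes p: "p = bfs adj b [[a]] (nonadj adj c V)" "p \<noteq> []"
  shows "apath adj a {v \<in> set V. \<not> adj c v} p" "hd p = b"
  using bfs_sound[of "[[a]]" adj a "{v \<in> set V. \<not> adj c v}" "nonadj adj c V" b] p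
  by (auto simp: set_nonadj apath_def)

lemma bfs_L:
  assumes "side a = side c" "(a, b) \<in> L {c} ^^ i"
  shows "bfs adj b [[a]] (nonadj adj c V) \<noteq> []" "length (bfs adj b [[a]] (nonadj adj c V)) \<le> 1 + 2 * i"
  using bfs_shortest[where ps = "[[a]]" and n = 1 and p = "[a]" and A = adj and vs = "nonadj adj c V"]
    L_steps[OF assms(2,1)] by (auto simp: set_nonadj)

lemma try_triple_short:
  assumes "short_triple 18 a b c"
  shows "try_triple adj side V a b c \<noteq> []"
proof -
  from assms obtain i j k where *: "a \<noteq> b" "side a = side b" "side b = side c"
    "(a, b) \<in> L {c} ^^ i" "(b, c) \<in> L {a} ^^ j" "(c, a) \<in> L {b} ^^ k" "i + j + k \<le> 18"
    unfolding short_triple_def by blast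
  define p q r where "p = bfs adj b [[a]] (nonadj adj c V)" and "q = bfs adj c [[b]] (nonadj adj a V)"
    and "r = bfs adj a [[c]] (nonadj adj b V)"
  have p: "p \<noteq> []" "length p \<le> 1 + 2 * i" using bfs_L[of a c b i] * unfolding p_def by auto
  have q: "q \<noteq> []" "length q \<le> 1 + 2 * j" using bfs_L[of b a c j] * unfolding q_def by auto
  have r: "r \<noteq> []" "length r \<le> 1 + 2 * k" using bfs_L[of c b a k] * unfolding r_def by auto
  define zs where "zs = flips p c (flips q a (flips r b []))"
  have "length zs = length p div 2 + length q div 2 + length r div 2"
    unfolding zs_def by (simp add: length_flips)
  moreover have "length p div 2 \<le> i" "length q div 2 \<le> j" "length r div 2 \<le> k" using p q r by simp_all
  ultimately have "length zs \<le> 18" using * by linarith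
  \<comment> \<open>The empty list signals failure, so at least one candidate must arise; it comes
    from the path between the distinct vertices \<open>a\<close> and \<open>b\<close>.\<close>
  moreover have "p \<noteq> [b]"
    using bfs_nonadj(1)[OF p_def p(1)] *(1) unfolding apath_def by (metis last.simps)
  then have "2 \<le> length p"
    using bfs_nonadj(2)[OF p_def p(1)] p(1) by (cases p; cases "tl p") auto
  then have "zs \<noteq> []" unfolding zs_def using length_flips[of p c] by (metis length_0_conv add_eq_0_iff_both_eq_0
        div_greater_zero_iff less_numeral_extra(3) zero_less_numeral)
  ultimately show ?thesis
    unfolding try_triple_def using * p q r by (simp add: p_def[symmetric] q_def[symmetric] r_def[symmetric] zs_def[symmetric] Let_def)
qed

text \<open>If a completion contained none of the candidates, the three paths would still avoid the
  respective third vertex in it, and the triple would survive.\<close>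

lemma try_tripleD:
  assumes ne: "try_triple adj side V a b c \<noteq> []" and V: "a \<in> set V" "b \<in> set V" "c \<in> set V"
  shows "length (try_triple adj side V a b c) \<le> 18"
    and "\<forall>(v, w)\<in>set (try_triple adj side V a b c). v \<in> set V \<and> w \<in> set V \<and> side v \<noteq> side w \<and> \<not> adj v w"
    and "list_graph V side adj' \<Longrightarrow> (\<forall>u v. adj u v \<longrightarrow> adj' u v) \<Longrightarrow> bipartite_graph.biconvex (set V) side adj' \<Longrightarrow>
      \<exists>(v, w)\<in>set (try_triple adj side V a b c). adj' v w"
proof -
  define p q r where "p = bfs adj b [[a]] (nonadj adj c V)" and "q = bfs adj c [[b]] (nonadj adj a V)"
    and "r = bfs adj a [[c]] (nonadj adj b V)"
  define zs where "zs = flips p c (flips q a (flips r b []))"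
  have cond: "a \<noteq> b" "side a = side b" "side b = side c" "p \<noteq> []" "q \<noteq> []" "r \<noteq> []" "drop 18 zs = []"
    and eq: "try_triple adj side V a b c = zs"
    using ne unfolding try_triple_def
    by (auto simp: p_def[symmetric] q_def[symmetric] r_def[symmetric] zs_def[symmetric] Let_def split: if_splits)
  note pp = bfs_nonadj[OF p_def cond(4)] and qq = bfs_nonadj[OF q_def cond(5)] and rr = bfs_nonadj[OF r_def cond(6)]
  have zs: "set zs = set (flips p c []) \<union> set (flips q a []) \<union> set (flips r b [])"
    unfolding zs_def by (subst flips_append, subst (2) flips_append) auto
  show "length (try_triple adj side V a b c) \<le> 18" using cond eq by simp
  have mem: "v \<in> set V \<and> w \<in> set V \<and> side v \<noteq> side w \<and> \<not> adj v w"
    if f: "(v, w) \<in> set (flips p' c' [])" and p': "apath adj a' {v \<in> set V. \<not> adj c' v} p'" "hd p' = b'"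
      and s: "side a' = side b'" "side b' = side c'" and c': "c' \<in> set V" for v w p' a' b' c'
  proof -
    from set_flips[OF f] obtain i where i: "w = c'" "Suc i < length p'" "even i" "v = p' ! Suc i" by blast
    \<comment> \<open>Both ends of the path are on one side, so an odd position is never the last
      one. The vertex therefore belongs to the part of the path that avoids the neighbours of
      \<open>c'\<close>.\<close>
    have "odd (length p')" using apath_odd[OF p'(1)] p'(2) s by simp
    with i(2,3) have "Suc i < length p' - 1" by presburger
    then have "v \<in> set (butlast p')" using i(4) by (metis length_butlast nth_butlast nth_mem)
    then have "v \<in> set V" "\<not> adj c' v" using p'(1) unfolding apath_def by blast+
    moreover have "side v \<noteq> side c'" using apath_side[OF p'(1) i(2)] i p'(2) s by simp
    ultimately show ?thesis using i(1) c' adj_sym by blast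
  qed
  show "\<forall>(v, w)\<in>set (try_triple adj side V a b c). v \<in> set V \<and> w \<in> set V \<and> side v \<noteq> side w \<and> \<not> adj v w"
    unfolding eq zs ball_Un
    using mem[OF _ pp cond(2,3) V(3)] mem[OF _ qq cond(3) _ V(1)] mem[OF _ rr _ cond(2) V(2)] cond(2,3) by blast
  show "\<exists>(v, w)\<in>set (try_triple adj side V a b c). adj' v w"
    if lg: "list_graph V side adj'" and sub: "\<forall>u v. adj u v \<longrightarrow> adj' u v"
      and bc: "bipartite_graph.biconvex (set V) side adj'"
  proof (rule ccontr)
    assume no: "\<not> ?thesis"
    interpret H: list_graph V side adj' by fact
    have reach: "(b', a') \<in> (H.L {c'})\<^sup>*"
      if p': "apath adj a' S p'" "hd p' = b'" and s: "side a' = side b'"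
        and none: "\<forall>(v, w)\<in>set (flips p' c' []). \<not> adj' v w" for p' a' b' c' S
    proof -
      have "odd (length p')" using apath_odd[OF p'(1)] p'(2) s by simp
      then show ?thesis using p' none
      proof (induction p' c' "[] :: ('v \<times> 'v) list" arbitrary: b' rule: flips.induct)
        case (1 y t p c)
        then have "p \<noteq> []" by auto
        then obtain z p0 where p: "p = z # p0" by (cases p) auto
        have ad: "adj t y" "adj z t"
          using 1(3) unfolding apath_def p by (auto simp: nth_Cons split: nat.splits)
        have "apath adj a' S p"
          using 1(3) \<open>p \<noteq> []\<close> unfolding apath_def by (auto split: if_splits)
        then have "(z, a') \<in> (H.L {c})\<^sup>*" using 1 p by simp
        moreover have "(y, z) \<in> H.L {c}"
          using ad sub 1(5) H.adj_sym by (intro H.L_I[of t]) auto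
        ultimately show ?case using 1(4) by (auto intro: converse_rtrancl_into_rtrancl)
      next
        case ("2_1" c)
        then show ?case by simp
      next
        case ("2_2" y c)
        then show ?case by (auto simp: apath_def)
      qed
    qed
    have no': "\<forall>(v, w)\<in>set (flips p c []). \<not> adj' v w" "\<forall>(v, w)\<in>set (flips q a []). \<not> adj' v w"
      "\<forall>(v, w)\<in>set (flips r b []). \<not> adj' v w"
      using no unfolding eq zs by blast+
    have "(b, a) \<in> (H.L {c})\<^sup>*" "(c, b) \<in> (H.L {a})\<^sup>*" "(a, c) \<in> (H.L {b})\<^sup>*"
      using reach[OF pp _ no'(1)] reach[OF qq _ no'(2)] reach[OF rr _ no'(3)] cond(2,3) by simp_all
    then show False
      using H.biconvex_no_triple[OF bc cond(2,3,1) V] H.Ls_sym by blast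
  qed
qed

lemma try_hole_complete:
  assumes "hole x r c r' y"
  shows "try_hole adj V x r c r' y \<noteq> []"
proof -
  let ?S = "y # nonadj adj c (nonadj adj r (nonadj adj r' V))"
  have "set ?S = insert y {v \<in> set V. \<not> adj c v \<and> \<not> adj r v \<and> \<not> adj r' v}"
    unfolding nonadj_def by auto
  with assms obtain m where "(x, y) \<in> steps adj (set ?S) ^^ m"
    unfolding hole_def using rtrancl_imp_relpow by metis
  then have "bfs adj y [[x]] ?S \<noteq> []"
    using bfs_shortest[where ps = "[[x]]" and n = 1 and p = "[x]" and A = adj and vs = ?S] by auto
  with assms show ?thesis unfolding try_hole_def hole_def by auto
qed

text \<open>A shortest path is induced and its inner vertices are not adjacent to \<open>r\<close>,
  \<open>c\<close> and \<open>r'\<close>, so the cycle has no chord. If the path has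
  \<open>n\<close> edges, then \<open>x\<close>, \<open>y\<close> and \<open>c\<close> form a triple
  with \<open>n div 2 + 2\<close> links. As this exceeds 18, \<open>n\<close> is at least 34, and
  the cycle has \<open>n + 4\<close> vertices.\<close>

lemma try_holeD:
  assumes ne: "try_hole adj V x r c r' y \<noteq> []" and x: "x \<in> set V" "y \<in> set V"
    and none: "\<And>a b c. \<not> short_triple 18 a b c"
  shows "chordless adj V (try_hole adj V x r c r' y)" "38 \<le> length (try_hole adj V x r c r' y)"
proof -
  define vs where "vs = y # nonadj adj c (nonadj adj r (nonadj adj r' V))"
  define S where "S = {v \<in> set V. \<not> adj c v \<and> \<not> adj r v \<and> \<not> adj r' v}"
  define q where "q = bfs adj y [[x]] vs"
  have vs: "set vs = insert y S" unfolding vs_def S_def nonadj_def by auto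
  have ad: "adj x r" "adj r c" "adj c r'" "adj r' y" "\<not> adj x r'" "\<not> adj r y" "q \<noteq> []"
    and eq: "try_hole adj V x r c r' y = r # c # r' # q"
    using ne unfolding try_hole_def vs_def[symmetric] q_def[symmetric] by (auto simp: Let_def split: if_splits)
  have q: "apath adj x (insert y S) q" "hd q = y"
    using bfs_sound[of "[[x]]" adj x "insert y S" vs y] ad(7) unfolding q_def by (auto simp: vs apath_def)
  have shortest: "length q \<le> 1 + m" if "(x, y) \<in> steps adj (insert y S) ^^ m" for m
    using bfs_shortest[where ps = "[[x]]" and n = 1 and p = "[x]" and A = adj and vs = vs] that vs
    unfolding q_def by auto
  define n where "n = length q - 1"
  have n: "length q = Suc n" unfolding n_def using ad(7) by (cases q) auto
  have q0: "q ! 0 = y" and qn: "q ! n = x"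
    using q n ad(7) unfolding apath_def by (auto simp: hd_conv_nth last_conv_nth)
  have qs: "q ! i \<in> insert y S" if "i < n" for i
    using q(1) that n unfolding apath_def by (metis diff_Suc_1 length_butlast nth_butlast nth_mem subset_code(1))
  have qa: "adj (q ! Suc i) (q ! i)" if "i < n" for i using q(1) that n unfolding apath_def by simp
  have seg: "(q ! j, q ! i) \<in> steps adj (insert y S) ^^ (j - i)" if "i \<le> j" "j \<le> n" for i j
    using that
  proof (induction j rule: dec_induct)
    case (step j)
    have "(q ! Suc j, q ! j) \<in> steps adj (insert y S)" using step qa qs unfolding steps_def by simp
    then have "(q ! Suc j, q ! i) \<in> steps adj (insert y S) ^^ Suc (j - i)"
      by (rule relpow_Suc_I2) (use step in simp)
    with step show ?case by (simp add: Suc_diff_le)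
  qed simp
  have dist: "q ! i \<noteq> q ! j" if "i < j" "j \<le> n" for i j
  proof
    assume "q ! i = q ! j"
    then have "(x, y) \<in> steps adj (insert y S) ^^ (n - j + (i - 0))"
      using relpow_trans[OF seg[of j n] , of "q ! 0" "i - 0"] seg[of 0 i] that q0 qn by simp
    from shortest[OF this] show False using that n by simp
  qed
  have induced: "j = Suc i" if "i < j" "j \<le> n" "adj (q ! j) (q ! i)" for i j
  proof -
    have "(q ! j, q ! i) \<in> steps adj (insert y S)" using qs[of i] that unfolding steps_def by simp
    then have "(q ! j, y) \<in> steps adj (insert y S) ^^ Suc i"
      by (rule relpow_Suc_I2) (use seg[of 0 i] that q0 in simp)
    then have "(x, y) \<in> steps adj (insert y S) ^^ (n - j + Suc i)"
      using relpow_trans[OF seg[of j n, unfolded qn]] that by blast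
    from shortest[OF this] show ?thesis using that n by simp
  qed
  have sides: "side x \<noteq> side r" "side r \<noteq> side c" "side c \<noteq> side r'" "side r' \<noteq> side y" "side x = side y" "side x = side c"
    using ad adj_side by blast+
  have "x \<noteq> y" using ad adj_sym by blast
  have "odd (length q)" using apath_odd[OF q(1)] q(2) sides by simp
  then have "even n" using n by simp
  have "n \<noteq> 0" using \<open>x \<noteq> y\<close> q0 qn by metis
  have inS: "q ! i \<in> S" if "0 < i" "i < n" for i using qs[of i] dist[of 0 i] q0 that by auto
  have qV: "q ! i \<in> set V" if "i \<le> n" for i
    using inS[of i] q0 qn x that unfolding S_def by (metis (mono_tags, lifting) le_neq_implies_less mem_Collect_eq neq0_conv)
  have q_r: "\<not> adj r (q ! i)" if "i < n" for i using inS[of i] ad q0 that unfolding S_def by (cases i) auto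
  have q_r': "\<not> adj r' (q ! i)" if "0 < i" "i \<le> n" for i
    using inS[of i] ad qn that adj_sym unfolding S_def by (cases "i = n") auto
  have q_c: "\<not> adj c (q ! i)" if "i \<le> n" for i
  proof -
    from that have "i = 0 \<or> i = n \<or> 0 < i \<and> i < n" by linarith
    then consider "i = 0" | "i = n" | "0 < i" "i < n" by blast
    then show ?thesis
    proof cases
      case 3
      then show ?thesis using inS unfolding S_def by blast
    qed (use q0 qn sides adj_side[of c] in auto)
  qed
  have r_q: "q ! i \<noteq> r" "q ! i \<noteq> c" "q ! i \<noteq> r'" if "i \<le> n" for i
  proof -
    show "q ! i \<noteq> r" using q_c[OF that] ad adj_sym by metis
    show "q ! i \<noteq> r'" using q_c[OF that] ad adj_sym by metis
    show "q ! i \<noteq> c"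
    proof
      assume c: "q ! i = c"
      then have "i = n" using q_r[of i] ad(2) that by (metis le_neq_implies_less)
      then have "q ! i = x" using qn by simp
      with c ad(3,5) show False by simp
    qed
  qed
  let ?l = "r # c # r' # q"
  have len: "length ?l = n + 4" using n by simp
  have nth: "?l ! 0 = r" "?l ! 1 = c" "?l ! 2 = r'" "\<And>i. ?l ! (i + 3) = q ! i"
    by (auto simp: numeral_eq_Suc)
  show ch: "chordless adj V (try_hole adj V x r c r' y)"
    unfolding eq chordless_def
  proof (intro conjI allI impI)
    show "4 \<le> length ?l" "even (length ?l)" using len \<open>even n\<close> by auto
    have "distinct q" using dist n by (auto simp: distinct_conv_nth nat_neq_iff less_Suc_eq_le; metis)
    moreover have "r \<notin> set q" "c \<notin> set q" "r' \<notin> set q" using r_q n by (auto simp: in_set_conv_nth less_Suc_eq_le)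
    ultimately show "distinct ?l" using ad sides by auto
    show "set ?l \<subseteq> set V" using ad adj_in adj_sym qV n by (auto simp: in_set_conv_nth less_Suc_eq_le; blast)
    show "adj (?l ! 0) (?l ! (length ?l - 1))" using ad(1) adj_sym nth(4)[of n] len qn by simp
  next
    fix i assume i: "Suc i < length ?l"
    consider "i = 0" | "i = 1" | "i = 2" | j where "i = j + 3" by (metis less_2_cases le_Suc_ex not_less_eq_eq
          numeral_3_eq_3 add.commute not_less less_Suc_eq numeral_2_eq_2 One_nat_def)
    then show "adj (?l ! i) (?l ! Suc i)"
    proof cases
      case 4
      then show ?thesis using i len nth(4)[of j] nth(4)[of "Suc j"] qa[of j] adj_sym by simp
    qed (use ad q0 in \<open>auto simp: numeral_2_eq_2\<close>)
  next
    fix i j assume ij: "i < j" "j < length ?l" "adj (?l ! i) (?l ! j)"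
    show "j = Suc i \<or> i = 0 \<and> j = length ?l - 1"
    proof (cases "j < 3")
      case True
      then have "j = Suc i \<or> i = 0 \<and> j = 2" using ij by auto
      then show ?thesis using ij(3) nth sides adj_side by (metis nth(3))
    next
      case False
      then obtain k where k: "j = k + 3" by (metis le_Suc_ex add.commute not_less)
      then have kn: "k \<le> n" and aj: "adj (?l ! i) (q ! k)" using ij len nth(4)[of k] by auto
      consider "i = 0" | "i = 1" | "i = 2" | m where "i = m + 3" by (metis less_2_cases le_Suc_ex not_less_eq_eq
          numeral_3_eq_3 add.commute not_less less_Suc_eq numeral_2_eq_2 One_nat_def)
      then show ?thesis
      proof cases
        case 1
        then have "k = n" using q_r[of k] aj kn by (metis nth(1) le_neq_implies_less)
        with 1 k len show ?thesis by simp
      next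
        case 2
        then show ?thesis using q_c[OF kn] aj nth(2) by simp
      next
        case 3
        then have "k = 0" using q_r'[of k] aj kn nth(3) by auto
        with 3 k show ?thesis by simp
      next
        case 4
        then show ?thesis using induced[of m k] aj nth(4)[of m] adj_sym ij k kn by auto
      qed
    qed
  qed
  obtain k where k: "n = 2 * k" using \<open>even n\<close> by auto
  have "(x, y) \<in> steps adj {v \<in> set V. \<not> adj c v} ^^ n"
  proof -
    have "(u, v) \<in> steps adj (insert y S) ^^ m \<Longrightarrow> (u, v) \<in> steps adj {v \<in> set V. \<not> adj c v} ^^ m" for u v m
      using x q_c[of 0] q0 unfolding S_def by (induction m arbitrary: v) (auto simp: steps_def)
    with seg[of 0 n] q0 qn show ?thesis by simp
  qed
  then have "(x, y) \<in> L {c} ^^ k" using steps_L k by blast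
  moreover have "(y, c) \<in> L {x} ^^ 1" using L_I[of r' y c "{x}"] ad adj_sym by auto
  moreover have "(c, x) \<in> L {y} ^^ 1" using L_I[of r c x "{y}"] ad adj_sym by auto
  ultimately have "\<not> k + 1 + 1 \<le> 18"
    using none[of x y c] \<open>x \<noteq> y\<close> sides unfolding short_triple_def by metis
  then show "38 \<le> length (try_hole adj V x r c r' y)" unfolding eq len k by simp
qed

end

section \<open>Branching rules\<close>

definition adj_of :: "('v \<times> 'v) list \<Rightarrow> 'v \<Rightarrow> 'v \<Rightarrow> bool" where
  "adj_of E u v \<longleftrightarrow> (u, v) \<in> set E \<or> (v, u) \<in> set E"

definition valid :: "'v list \<Rightarrow> ('v \<Rightarrow> bool) \<Rightarrow> ('v \<times> 'v) list \<Rightarrow> bool" where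
  "valid V side E \<longleftrightarrow> (\<forall>(u, v)\<in>set E. u \<in> set V \<and> v \<in> set V \<and> side u \<noteq> side v)"

text \<open>Excluding repeated edges in either orientation bounds the edge list, and with it the
  cost of an adjacency test, throughout the recursion.\<close>

fun simple :: "('v \<times> 'v) list \<Rightarrow> bool" where
  "simple [] \<longleftrightarrow> True"
| "simple ((u, v) # E) \<longleftrightarrow> \<not> adj_of E u v \<and> simple E"

definition biconvex_edges :: "'v list \<Rightarrow> ('v \<Rightarrow> bool) \<Rightarrow> ('v \<times> 'v) list \<Rightarrow> bool" where
  "biconvex_edges V side E \<longleftrightarrow> valid V side E \<and> (\<forall>s. \<exists>lt. arrangement (adj_of E) {v \<in> set V. side v = s} lt)"

text \<open>Edges are added as a list, not as a set. Repetitions or edges already present merely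
  waste budget, so the answer is the same.\<close>

definition completable :: "'v list \<Rightarrow> ('v \<Rightarrow> bool) \<Rightarrow> ('v \<times> 'v) list \<Rightarrow> nat \<Rightarrow> bool" where
  "completable V side E d \<longleftrightarrow> (\<exists>F. length F \<le> d \<and> biconvex_edges V side (F @ E))"

lemma list_graph_adj_of: "valid V side E \<Longrightarrow> list_graph V side (adj_of E)"
  unfolding valid_def adj_of_def by unfold_locales auto

lemma valid_Cons: "valid V side ((u, v) # E) \<longleftrightarrow> u \<in> set V \<and> v \<in> set V \<and> side u \<noteq> side v \<and> valid V side E"
  unfolding valid_def by auto

lemma valid_append: "valid V side (F @ E) \<longleftrightarrow> valid V side F \<and> valid V side E"
  unfolding valid_def by auto

lemma simple_length:
  assumes "simple E" "valid V side E"
  shows "length E \<le> length V * length V"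
proof -
  have "distinct E" using assms(1) by (induction E rule: simple.induct) (auto simp: adj_of_def)
  moreover have "set E \<subseteq> set V \<times> set V" using assms(2) unfolding valid_def by auto
  ultimately have "length E \<le> card (set V \<times> set V)"
    by (metis distinct_card card_mono finite_SigmaI finite_set)
  also have "\<dots> \<le> length V * length V"
    by (simp add: card_cartesian_product card_length mult_le_mono)
  finally show ?thesis .
qed

lemma biconvex_edges_iff:
  "biconvex_edges V side E \<longleftrightarrow> valid V side E \<and> bipartite_graph.biconvex (set V) side (adj_of E)"
proof (cases "valid V side E")
  case True
  then interpret list_graph V side "adj_of E" by (rule list_graph_adj_of)
  show ?thesis unfolding biconvex_edges_def biconvex_def using True by blast
qed (simp add: biconvex_edges_def)

text \<open>The list \<open>F\<close> may hold the edge in the opposite orientation; it is replaced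
  by the candidate pair, which leaves the adjacency unchanged.\<close>

lemma move_edge:
  assumes "biconvex_edges V side (F @ E)" "adj_of (F @ E) v w" "\<not> adj_of E v w"
  obtains F' where "length F = Suc (length F')" "biconvex_edges V side (F' @ (v, w) # E)"
    "adj_of (F' @ (v, w) # E) = adj_of (F @ E)"
proof -
  obtain e where e: "e \<in> set F" "e = (v, w) \<or> e = (w, v)"
    using assms(2,3) unfolding adj_of_def by auto
  define F' where "F' = remove1 e F"
  have s: "set (F' @ e # E) = set (F @ E)"
    using e(1) set_remove1_subset[of e F] unfolding F'_def by (auto simp: in_set_remove1)
  have "adj_of (F' @ (v, w) # E) = adj_of (F' @ e # E)"
    using e(2) unfolding adj_of_def fun_eq_iff by auto
  also have "\<dots> = adj_of (F @ E)" using s unfolding adj_of_def by simp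
  finally have a: "adj_of (F' @ (v, w) # E) = adj_of (F @ E)" .
  have "valid V side (F @ E)" using assms(1) unfolding biconvex_edges_def by blast
  then have "valid V side (F' @ e # E)" unfolding valid_def s .
  then have "valid V side (F' @ (v, w) # E)" using e(2) unfolding valid_def by auto
  with a assms(1) have "biconvex_edges V side (F' @ (v, w) # E)" unfolding biconvex_edges_def by simp
  moreover have "length F = Suc (length F')"
    using e(1) length_remove1[of e F] length_pos_if_in_set[of e F] unfolding F'_def by simp
  ultimately show ?thesis using a that by blast
qed

fun first_nonempty :: "('a \<Rightarrow> 'b list) \<Rightarrow> 'a list \<Rightarrow> 'b list" where
  "first_nonempty f [] = []"
| "first_nonempty f (x # xs) = (if f x \<noteq> [] then f x else first_nonempty f xs)"

lemma first_nonempty_eq_Nil: "first_nonempty f xs = [] \<longleftrightarrow> (\<forall>x\<in>set xs. f x = [])"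
  by (induction xs) auto

lemma first_nonemptyD: "first_nonempty f xs \<noteq> [] \<Longrightarrow> \<exists>x\<in>set xs. f x \<noteq> [] \<and> first_nonempty f xs = f x"
  by (induction xs) auto

fun tuples :: "nat \<Rightarrow> 'v list \<Rightarrow> 'v list list" where
  "tuples 0 V = [[]]"
| "tuples (Suc n) V = concat (map (\<lambda>v. map ((#) v) (tuples n V)) V)"

lemma set_tuples: "set (tuples n V) = {t. length t = n \<and> set t \<subseteq> set V}"
proof (induction n)
  case (Suc n)
  then show ?case by (auto simp: length_Suc_conv)
qed auto

lemma length_tuples: "length (tuples n V) = length V ^ n"
  by (induction n) (auto simp: length_concat comp_def sum_list_triv)

definition find_triple :: "('v \<Rightarrow> 'v \<Rightarrow> bool) \<Rightarrow> ('v \<Rightarrow> bool) \<Rightarrow> 'v list \<Rightarrow> ('v \<times> 'v) list" where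
  "find_triple A side V = first_nonempty (\<lambda>t. try_triple A side V (t ! 0) (t ! 1) (t ! 2)) (tuples 3 V)"

definition find_hole :: "('v \<Rightarrow> 'v \<Rightarrow> bool) \<Rightarrow> 'v list \<Rightarrow> 'v list" where
  "find_hole A V = first_nonempty (\<lambda>t. try_hole A V (t ! 0) (t ! 1) (t ! 2) (t ! 3) (t ! 4)) (tuples 5 V)"

lemma triple_branch:
  assumes E: "valid V side E" and ne: "find_triple (adj_of E) side V \<noteq> []"
  shows "length (find_triple (adj_of E) side V) \<le> 18"
    and "(v, w) \<in> set (find_triple (adj_of E) side V) \<Longrightarrow> valid V side ((v, w) # E) \<and> \<not> adj_of E v w"
    and "completable V side E d \<longleftrightarrow>
      0 < d \<and> (\<exists>e\<in>set (find_triple (adj_of E) side V). completable V side (e # E) (d - 1))"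
proof -
  interpret list_graph V side "adj_of E" using E by (rule list_graph_adj_of)
  obtain t where t: "t \<in> set (tuples 3 V)" "try_triple (adj_of E) side V (t ! 0) (t ! 1) (t ! 2) \<noteq> []"
    and eq: "find_triple (adj_of E) side V = try_triple (adj_of E) side V (t ! 0) (t ! 1) (t ! 2)"
    using first_nonemptyD ne unfolding find_triple_def by blast
  have tV: "t ! 0 \<in> set V" "t ! 1 \<in> set V" "t ! 2 \<in> set V"
    using t(1) unfolding set_tuples by (auto simp: subset_iff)
  note tt = try_tripleD[OF t(2) tV]
  show "length (find_triple (adj_of E) side V) \<le> 18" unfolding eq by (rule tt(1))
  show ok: "valid V side ((v, w) # E) \<and> \<not> adj_of E v w" if "(v, w) \<in> set (find_triple (adj_of E) side V)" for v w
    using tt(2) that E unfolding eq valid_Cons by blast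
  show "completable V side E d \<longleftrightarrow>
      0 < d \<and> (\<exists>e\<in>set (find_triple (adj_of E) side V). completable V side (e # E) (d - 1))"
  proof
    assume "completable V side E d"
    then obtain F where F: "length F \<le> d" "biconvex_edges V side (F @ E)" unfolding completable_def by blast
    have "\<forall>u v. adj_of E u v \<longrightarrow> adj_of (F @ E) u v" unfolding adj_of_def by auto
    moreover have "valid V side (F @ E)" "bipartite_graph.biconvex (set V) side (adj_of (F @ E))"
      using F(2) unfolding biconvex_edges_iff by blast+
    ultimately obtain v w where vw: "(v, w) \<in> set (find_triple (adj_of E) side V)" "adj_of (F @ E) v w"
      using tt(3)[OF list_graph_adj_of, of "F @ E"] unfolding eq by blast
    obtain F' where "length F = Suc (length F')" "biconvex_edges V side (F' @ (v, w) # E)"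
      using move_edge[OF F(2) vw(2)] ok[OF vw(1)] by blast
    with F(1) vw(1) show "0 < d \<and> (\<exists>e\<in>set (find_triple (adj_of E) side V). completable V side (e # E) (d - 1))"
      unfolding completable_def by (intro conjI bexI[of _ "(v, w)"] exI[of _ F']) auto
  next
    assume "0 < d \<and> (\<exists>e\<in>set (find_triple (adj_of E) side V). completable V side (e # E) (d - 1))"
    then obtain e F where "0 < d" "length F \<le> d - 1" "biconvex_edges V side (F @ e # E)"
      unfolding completable_def by blast
    then show "completable V side E d"
      unfolding completable_def by (intro exI[of _ "F @ [e]"]) auto
  qed
qed

section \<open>Dividing a chordless cycle into quadrangles\<close>

text \<open>A chordless cycle is filled in by repeatedly cutting off three consecutive edges. The first
  argument holds the vertices that have been passed, in reverse order.\<close>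

fun leaves :: "'v list \<Rightarrow> 'v list \<Rightarrow> ('v \<times> 'v) list \<Rightarrow> ('v \<times> 'v) list list" where
  "leaves [w, z, y, x] [] E = [E]"
| "leaves (w # z # y # x # s # S) [] E = leaves (w # x # s # S) [] ((x, w) # E)"
| "leaves (w # z # y # x # S) (v # R) E =
     leaves (w # x # S) (v # R) ((x, w) # E) @ leaves (v # w # z # y # x # S) R E"
| "leaves S (v # R) E = leaves (v # S) R E"
| "leaves S [] E = []"

text \<open>Each decision lowers the exponent by one: a cut shortens the stack by two, and a push
  moves one vertex from \<open>R\<close> to \<open>S\<close>. For a cycle with
  \<open>2 * f + 4\<close> vertices and an empty stack the exponent is
  \<open>3 * f + 6\<close>.\<close>

lemma length_leaves: "length (leaves S R E) \<le> 2 ^ (length R + (length S + length R) div 2)"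
proof (induction S R E rule: leaves.induct)
  case (3 w z y x S v R E)
  let ?n = "length R + (length (v # w # z # y # x # S) + length R) div 2"
  have "length (v # R) + (length (w # x # S) + length (v # R)) div 2 = ?n" by simp
  then have "length (leaves (w # z # y # x # S) (v # R) E) \<le> 2 ^ ?n + 2 ^ ?n"
    using 3 by simp
  also have "\<dots> = 2 ^ (length (v # R) + (length (w # z # y # x # S) + length (v # R)) div 2)" by simp
  finally show ?case .
qed (auto intro: order_trans)

text \<open>The new edge replaces three consecutive ones, and a chord of the shorter cycle would be
  a chord of the longer one. The condition on \<open>p\<close> and \<open>q\<close> excludes the
  quadrangle, where \<open>x\<close> and \<open>w\<close> are already adjacent.\<close>

lemma chordless_reduce:
  assumes ch: "chordless A V (p @ x # y # z # w # q)" and l: "p \<noteq> [] \<or> q \<noteq> []"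
    and A': "\<And>u v. A' u v \<longleftrightarrow> A u v \<or> u = x \<and> v = w \<or> u = w \<and> v = x"
  shows "chordless A' V (p @ x # w # q)" and "\<not> A x w"
proof -
  define l where "l = p @ x # y # z # w # q"
  define a where "a = length p"
  define f where "f k = (if k \<le> a then k else k + 2)" for k
  define l' where "l' = p @ x # w # q"
  have len: "length l = length l' + 2" "a + 2 \<le> length l'" unfolding l_def l'_def a_def by auto
  have nth: "l' ! k = l ! f k" for k
  proof (cases "k \<le> a")
    case True
    then show ?thesis unfolding l_def l'_def f_def a_def by (auto simp: nth_append nth_Cons split: nat.splits)
  next
    case False
    then obtain m where "k = a + Suc m" by (metis add_Suc_right less_imp_Suc_add not_le)
    then show ?thesis unfolding l_def l'_def f_def a_def by (simp add: nth_append)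
  qed
  have c: "4 \<le> length l" "even (length l)" "distinct l" "set l \<subseteq> set V"
    "\<And>i. Suc i < length l \<Longrightarrow> A (l ! i) (l ! Suc i)" "A (l ! 0) (l ! (length l - 1))"
    "\<And>i j. i < j \<Longrightarrow> j < length l \<Longrightarrow> A (l ! i) (l ! j) \<Longrightarrow> j = Suc i \<or> i = 0 \<and> j = length l - 1"
    using ch unfolding chordless_def l_def[symmetric] by blast+
  have x: "l ! a = x" "l ! (a + 3) = w" unfolding l_def a_def by (auto simp: nth_append)
  have "a + 3 < length l" unfolding l_def a_def by simp
  moreover have "length l \<noteq> 4" using l unfolding l_def by auto
  ultimately show nA: "\<not> A x w"
    using c(7)[of a "a + 3"] x len by (auto simp: l_def a_def)
  have "5 \<le> length l" using c(1) \<open>length l \<noteq> 4\<close> by simp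
  with c(2) have "6 \<le> length l" by presburger
  have flt: "f i < length l" "i < j \<Longrightarrow> f i < f j" if "i < length l'" for i j
    using that len unfolding f_def by auto
  have dist: "distinct l'" using c(3) unfolding l_def l'_def by auto
  show "chordless A' V (p @ x # w # q)"
    unfolding chordless_def l'_def[symmetric]
  proof (intro conjI allI impI)
    show "4 \<le> length l'" "even (length l')" using \<open>6 \<le> length l\<close> c(2) len by auto
    show "distinct l'" by (rule dist)
    show "set l' \<subseteq> set V" using c(4) unfolding l_def l'_def by auto
    have "f (length l' - 1) = length l - 1" "f 0 = 0" using len unfolding f_def by auto
    then show "A' (l' ! 0) (l' ! (length l' - 1))" using c(6) unfolding nth A' by simp
  next
    fix i assume i: "Suc i < length l'"
    show "A' (l' ! i) (l' ! Suc i)"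
    proof (cases "i = a")
      case True
      then show ?thesis using x unfolding nth A' f_def by (auto simp: numeral_3_eq_3)
    next
      case False
      then have "f (Suc i) = Suc (f i)" unfolding f_def by auto
      then show ?thesis using c(5)[of "f i"] flt(1)[OF i] unfolding nth A' by simp
    qed
  next
    fix i j assume ij: "i < j" "j < length l'" "A' (l' ! i) (l' ! j)"
    show "j = Suc i \<or> i = 0 \<and> j = length l' - 1"
    proof (cases "A (l' ! i) (l' ! j)")
      case True
      then have "f j = Suc (f i) \<or> f i = 0 \<and> f j = length l - 1"
        using c(7)[of "f i" "f j"] flt ij unfolding nth by auto
      then show ?thesis using ij len unfolding f_def by (auto split: if_splits)
    next
      case False
      have "l' ! a = x" "l' ! Suc a = w" unfolding nth f_def using x by (auto simp: numeral_3_eq_3)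
      moreover have "Suc a < length l'" "a < length l'" "i < length l'" using ij len by auto
      ultimately have "i = a \<and> j = Suc a \<or> i = Suc a \<and> j = a"
        using False ij A' dist nth_eq_iff_index_eq[OF dist] by metis
      with ij show ?thesis by auto
    qed
  qed
qed

lemma adj_of_Cons: "adj_of ((x, w) # E) u v \<longleftrightarrow> adj_of E u v \<or> u = x \<and> v = w \<or> u = w \<and> v = x"
  unfolding adj_of_def by auto

lemma chordless_valid:
  assumes ch: "chordless (adj_of E) V (p @ x # y # z # w # q)" and E: "valid V side E"
  shows "valid V side ((x, w) # E)"
proof -
  let ?l = "p @ x # y # z # w # q" and ?n = "length p"
  have "\<And>i. Suc i < length ?l \<Longrightarrow> adj_of E (?l ! i) (?l ! Suc i)" "set ?l \<subseteq> set V"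
    using ch unfolding chordless_def by blast+
  from this(1)[of ?n] this(1)[of "Suc ?n"] this(1)[of "Suc (Suc ?n)"] this(2)
  have "adj_of E x y" "adj_of E y z" "adj_of E z w" "x \<in> set V" "w \<in> set V"
    by (auto simp: nth_append nth_Cons split: nat.splits)
  with E show ?thesis
    using bipartite_graph.adj_side[OF list_graph.axioms[OF list_graph_adj_of[OF E]]] unfolding valid_Cons by blast
qed

text \<open>Each cut removes two vertices until a quadrangle is left, so a cycle with
  \<open>l\<close> vertices receives exactly \<open>l div 2 - 2\<close> chords. This number is what
  the parameter loses.\<close>

lemma leaves_sound:
  assumes "E' \<in> set (leaves S R E)" "chordless (adj_of E) V (rev S @ R)" "valid V side E" "simple E"
  shows "valid V side E' \<and> simple E' \<and> (\<exists>G. E' = G @ E \<and> length G + 2 = (length S + length R) div 2)"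
  using assms
proof (induction S R E rule: leaves.induct)
  case (2 w z y x s S E)
  have "chordless (adj_of E) V ((rev S @ [s]) @ x # y # z # w # [])" using 2(3) by simp
  note red = chordless_reduce[OF this _ adj_of_Cons[of x w E]] chordless_valid[OF this 2(4)]
  from 2(1)[OF 2(2)[simplified]] red 2(5) obtain G where
    "valid V side E'" "simple E'" "E' = G @ (x, w) # E" "length G + 2 = (length (w # x # s # S) + length []) div 2"
    by auto
  then show ?case by (intro conjI exI[of _ "G @ [(x, w)]"]) auto
next
  case (3 w z y x S v R E)
  have "chordless (adj_of E) V (rev S @ x # y # z # w # v # R)" using 3(4) by simp
  note red = chordless_reduce[OF this _ adj_of_Cons[of x w E]] chordless_valid[OF this 3(5)]
  from 3(3) consider "E' \<in> set (leaves (w # x # S) (v # R) ((x, w) # E))"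
    | "E' \<in> set (leaves (v # w # z # y # x # S) R E)" by auto
  then show ?case
  proof cases
    case 1
    from 3(1)[OF 1] red 3(6) obtain G where
      "valid V side E'" "simple E'" "E' = G @ (x, w) # E"
      "length G + 2 = (length (w # x # S) + length (v # R)) div 2" by auto
    then show ?thesis by (intro conjI exI[of _ "G @ [(x, w)]"]) auto
  next
    case 2
    from 3(2)[OF this] 3(4-6) show ?thesis by simp
  qed
qed auto

text \<open>Follow the solution and cut exactly when it contains the chord across the top of the
  stack. The third assumption is the invariant that no such chord remains below the top. When the
  input is exhausted, \<open>ear_exists\<close> yields a chord of the solution, which the invariant
  places at the top.\<close>

lemma leaves_complete:
  assumes "chordless (adj_of E) V (rev S @ R)" "biconvex_edges V side (F @ E)"
    "\<And>i. Suc (i + 3) < length S \<Longrightarrow> \<not> adj_of (F @ E) (rev S ! i) (rev S ! (i + 3))"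
  shows "\<exists>E'\<in>set (leaves S R E). \<exists>F'. length F' + (length S + length R) div 2 \<le> length F + 2 \<and>
    biconvex_edges V side (F' @ E')"
  using assms
proof (induction S R E arbitrary: F rule: leaves.induct)
  case (1 w z y x E)
  then show ?case by auto
next
  case (2 w z y x s S E)
  let ?l = "rev S @ s # x # y # z # w # []"
  have ch: "chordless (adj_of E) V ((rev S @ [s]) @ x # y # z # w # [])" using 2(2) by simp
  have chl: "chordless (adj_of E) V ?l" using 2(2) by simp
  have sub: "adj_of E u v \<Longrightarrow> adj_of (F @ E) u v" for u v unfolding adj_of_def by auto
  have F: "valid V side (F @ E)" "bipartite_graph.biconvex (set V) side (adj_of (F @ E))"
    using 2(3) unfolding biconvex_edges_iff by blast+
  interpret H: list_graph V side "adj_of (F @ E)" using F(1) by (rule list_graph_adj_of)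
  have "5 \<le> length ?l" "even (length ?l)" using chl unfolding chordless_def by auto
  then have "6 \<le> length ?l" by presburger
  then obtain i where i: "i + 3 < length ?l" "adj_of (F @ E) (?l ! i) (?l ! (i + 3))"
    using H.ear_exists[OF F(2), of ?l] chl sub unfolding chordless_def by metis
  have "rev (w # z # y # x # s # S) = ?l" by simp
  with 2(4)[of i] i(2) have "\<not> i < Suc (length S)" by auto
  with i(1) have "i = Suc (length S)" by simp
  with i(2) have xw: "adj_of (F @ E) x w" by (simp add: nth_append numeral_3_eq_3)
  note red = chordless_reduce[OF ch _ adj_of_Cons[of x w E]]
  obtain F' where F': "length F = Suc (length F')" "biconvex_edges V side (F' @ (x, w) # E)"
    "adj_of (F' @ (x, w) # E) = adj_of (F @ E)"
    using move_edge[OF 2(3) xw] red(2) by auto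
  have "\<not> adj_of (F' @ (x, w) # E) (rev (w # x # s # S) ! i) (rev (w # x # s # S) ! (i + 3))"
    if "Suc (i + 3) < length (w # x # s # S)" for i
    using 2(4)[of i] that unfolding F'(3) by (auto simp: nth_append nth_Cons split: nat.splits if_splits)
  from 2(1)[OF _ F'(2) this] red(1) F'(1) show ?case by auto
next
  case (3 w z y x S v R E)
  have ch: "chordless (adj_of E) V (rev S @ x # y # z # w # v # R)" using 3(3) by simp
  note red = chordless_reduce[OF ch _ adj_of_Cons[of x w E]]
  show ?case
  proof (cases "adj_of (F @ E) x w")
    case True
    obtain F' where F': "length F = Suc (length F')" "biconvex_edges V side (F' @ (x, w) # E)"
      "adj_of (F' @ (x, w) # E) = adj_of (F @ E)"
      using move_edge[OF 3(4) True] red(2) by auto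
    have "\<not> adj_of (F' @ (x, w) # E) (rev (w # x # S) ! i) (rev (w # x # S) ! (i + 3))"
      if "Suc (i + 3) < length (w # x # S)" for i
      using 3(5)[of i] that unfolding F'(3) by (auto simp: nth_append nth_Cons split: nat.splits if_splits)
    from 3(1)[OF _ F'(2) this] red(1) obtain E' F'' where
      "E' \<in> set (leaves (w # x # S) (v # R) ((x, w) # E))" "biconvex_edges V side (F'' @ E')"
      "length F'' + (length (w # x # S) + length (v # R)) div 2 \<le> length F' + 2" by auto
    with F'(1) show ?thesis by (intro bexI[of _ E'] exI[of _ F'']) auto
  next
    case False
    have "\<not> adj_of (F @ E) (rev (v # w # z # y # x # S) ! i) (rev (v # w # z # y # x # S) ! (i + 3))"
      if "Suc (i + 3) < length (v # w # z # y # x # S)" for i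
    proof (cases "i = length S")
      case True
      with False show ?thesis by (simp add: nth_append numeral_3_eq_3)
    next
      case False
      with that have "Suc (i + 3) < length (w # z # y # x # S)" by simp
      from 3(5)[OF this] that False show ?thesis
        by (auto simp: nth_append nth_Cons split: nat.splits if_splits)
    qed
    from 3(2)[OF _ 3(4) this] 3(3) obtain E' F'' where
      "E' \<in> set (leaves (v # w # z # y # x # S) R E)" "biconvex_edges V side (F'' @ E')"
      "length F'' + (length (v # w # z # y # x # S) + length R) div 2 \<le> length F + 2" by auto
    then show ?thesis by (intro bexI[of _ E'] exI[of _ F'']) auto
  qed
qed (auto simp: chordless_def)

lemma no_short_triple:
  assumes E: "valid V side E" and none: "find_triple (adj_of E) side V = []"
  shows "\<not> bipartite_graph.short_triple (set V) side (adj_of E) 18 a b c"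
proof -
  interpret list_graph V side "adj_of E" using E(1) by (rule list_graph_adj_of)
  show ?thesis
  proof
    assume st: "short_triple 18 a b c"
    then obtain i j where *: "a \<noteq> b" "(a, b) \<in> L {c} ^^ i" "(b, c) \<in> L {a} ^^ j" unfolding short_triple_def by blast
    have LV: "u \<in> set V \<and> v \<in> set V" if "(u, v) \<in> L Z" for u v Z using that unfolding L_def link_def by blast
    have "a \<in> set V" "b \<in> set V"
      using * LV by (metis relpow_0_E relpow_E2, metis relpow_0_E relpow_E)
    moreover have "c \<in> set V" using *(3) LV \<open>b \<in> set V\<close> by (metis relpow_E)
    ultimately have "[a, b, c] \<in> set (tuples 3 V)" unfolding set_tuples by simp
    with none have "try_triple (adj_of E) side V a b c = []"
      unfolding find_triple_def first_nonempty_eq_Nil by fastforce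
    with try_triple_short[OF st] show False by blast
  qed
qed

lemma hole_branch:
  assumes E: "valid V side E" "simple E" and none: "find_triple (adj_of E) side V = []"
    and ne: "find_hole (adj_of E) V \<noteq> []"
  obtains f where "17 \<le> f" "length (find_hole (adj_of E) V) = 2 * f + 4"
    "set (find_hole (adj_of E) V) \<subseteq> set V" "length (find_hole (adj_of E) V) \<le> length V"
    "\<And>E'. E' \<in> set (leaves [] (find_hole (adj_of E) V) E) \<Longrightarrow> valid V side E' \<and> simple E'"
    "\<And>d. completable V side E d \<longleftrightarrow>
       f \<le> d \<and> (\<exists>E'\<in>set (leaves [] (find_hole (adj_of E) V) E). completable V side E' (d - f))"
proof -
  interpret list_graph V side "adj_of E" using E(1) by (rule list_graph_adj_of)
  define C where "C = find_hole (adj_of E) V"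
  obtain t where t: "t \<in> set (tuples 5 V)"
    "try_hole (adj_of E) V (t ! 0) (t ! 1) (t ! 2) (t ! 3) (t ! 4) \<noteq> []"
    and eq: "C = try_hole (adj_of E) V (t ! 0) (t ! 1) (t ! 2) (t ! 3) (t ! 4)"
    using first_nonemptyD ne unfolding find_hole_def C_def by blast
  have tV: "t ! 0 \<in> set V" "t ! 4 \<in> set V" using t(1) unfolding set_tuples by (auto simp: subset_iff)
  have C: "chordless (adj_of E) V C" "38 \<le> length C" using try_holeD[OF t(2) tV no_short_triple[OF E(1) none]] unfolding eq by auto
  define f where "f = length C div 2 - 2"
  have "even (length C)" "distinct C" "set C \<subseteq> set V" using C(1) unfolding chordless_def by blast+
  then have f: "17 \<le> f" "length C = 2 * f + 4" using C(2) unfolding f_def by auto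
  have "length C \<le> length V"
    using \<open>distinct C\<close> \<open>set C \<subseteq> set V\<close> by (metis card_length card_mono distinct_card finite_set le_trans)
  moreover have "valid V side E' \<and> simple E'" if "E' \<in> set (leaves [] C E)" for E'
    using leaves_sound[OF that _ E] C(1) by simp
  moreover have "completable V side E d \<longleftrightarrow> f \<le> d \<and> (\<exists>E'\<in>set (leaves [] C E). completable V side E' (d - f))" for d
  proof
    assume "completable V side E d"
    then obtain F where F: "length F \<le> d" "biconvex_edges V side (F @ E)" unfolding completable_def by blast
    obtain E' F' where "E' \<in> set (leaves [] C E)" "length F' + length C div 2 \<le> length F + 2"
      "biconvex_edges V side (F' @ E')"
      using leaves_complete[OF _ F(2), of "[]" C] C(1) by auto
    moreover from this have "f \<le> d" "length F' \<le> d - f" using F(1) f by auto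
    ultimately show "f \<le> d \<and> (\<exists>E'\<in>set (leaves [] C E). completable V side E' (d - f))"
      unfolding completable_def by blast
  next
    assume "f \<le> d \<and> (\<exists>E'\<in>set (leaves [] C E). completable V side E' (d - f))"
    then obtain E' F where *: "f \<le> d" "E' \<in> set (leaves [] C E)" "length F \<le> d - f" "biconvex_edges V side (F @ E')"
      unfolding completable_def by blast
    then obtain G where "E' = G @ E" "length G + 2 = length C div 2"
      using leaves_sound[OF *(2) _ E] C(1) by auto
    with * f show "completable V side E d"
      unfolding completable_def by (intro exI[of _ "F @ G"]) auto
  qed
  ultimately show ?thesis using that[of f] f \<open>set C \<subseteq> set V\<close> unfolding C_def by blast
qed

text \<open>Both searches are complete, so the graph is tame and its sides can be arranged without
  any insertion.\<close>

lemma no_branch: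
  assumes E: "valid V side E" and none: "find_triple (adj_of E) side V = []" "find_hole (adj_of E) V = []"
  shows "completable V side E d"
proof -
  interpret list_graph V side "adj_of E" using E(1) by (rule list_graph_adj_of)
  have none2: "\<not> hole x r c r' y" for x r c r' y
  proof
    assume h: "hole x r c r' y"
    then have "[x, r, c, r', y] \<in> set (tuples 5 V)"
      unfolding set_tuples hole_def using adj_in adj_sym by auto
    with none have "try_hole (adj_of E) V x r c r' y = []"
      unfolding find_hole_def first_nonempty_eq_Nil by (force simp: eval_nat_numeral)
    with try_hole_complete[OF h] show False by blast
  qed
  interpret tame_graph "set V" side "adj_of E" by unfold_locales (rule no_short_triple[OF E none(1)], rule none2)
  have "biconvex_edges V side E" unfolding biconvex_edges_def using E arrangement_exists by blast
  then show ?thesis unfolding completable_def by (intro exI[of _ "[]"]) auto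
qed

section \<open>The program\<close>

abbreviation "T \<equiv> Pair Atom Atom"

fun seconds :: "nat \<Rightarrow> expr \<Rightarrow> expr" where
  "seconds 0 e = e"
| "seconds (Suc n) e = Second (seconds n e)"

definition "EQ = (1 :: nat)"
definition "MEM = (2 :: nat)"
definition "ADJ = (3 :: nat)"
definition "NONADJ = (4 :: nat)"
definition "PARENT = (5 :: nat)"
definition "EXPAND = (6 :: nat)"
definition "HEAD = (7 :: nat)"
definition "BFS = (8 :: nat)"
definition "FLIPS = (9 :: nat)"
definition "CONSALL = (10 :: nat)"
definition "EXTEND = (11 :: nat)"
definition "TRIPLE = (12 :: nat)"
definition "FINDTRIPLE = (13 :: nat)"
definition "HOLE = (14 :: nat)"
definition "FINDHOLE = (15 :: nat)"
definition "LEAVES = (16 :: nat)"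
definition "DEC = (17 :: nat)"
definition "DECS = (18 :: nat)"
definition "SOLVE = (19 :: nat)"
definition "ANY = (20 :: nat)"
definition "EACH = (21 :: nat)"
definition "ROWEDGES = (22 :: nat)"
definition "EDGES = (23 :: nat)"
definition "VERTS = (24 :: nat)"

lemmas index_defs =
  EQ_def MEM_def ADJ_def NONADJ_def PARENT_def EXPAND_def HEAD_def BFS_def FLIPS_def CONSALL_def
  EXTEND_def TRIPLE_def FINDTRIPLE_def HOLE_def FINDHOLE_def LEAVES_def DEC_def DECS_def SOLVE_def
  ANY_def EACH_def ROWEDGES_def EDGES_def VERTS_def

text \<open>What the bodies do, and in which order they take their arguments, is stated by the lemmas
  whose names end in \<open>_computes\<close>. Tuples, paths and edge lists are lists of vertices or of pairs of
  vertices; a path begins with the vertex reached last. In a vertex, the first child is the tag that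
  distinguishes columns from rows. The empty list means failure.\<close>

definition "main_body =
  Call SOLVE
    [Call EDGES [First (Var 0), Atom, Atom],
     Call VERTS [First (Var 0), Atom, Atom, Call VERTS [First (First (Var 0)), T, Atom, Atom]],
     Second (Var 0)]"

definition "eq_body =
  Cond (Var 0)
    (Cond (Var 1)
      (Cond (Call EQ [First (Var 0), First (Var 1)]) (Call EQ [Second (Var 0), Second (Var 1)]) Atom) Atom)
    (Cond (Var 1) Atom T)"

definition "mem_body =
  Cond (Var 1) (Cond (Call EQ [Var 0, First (Var 1)]) T (Call MEM [Var 0, Second (Var 1)])) Atom"

definition "adj_body =
  Cond (Call MEM [Pair (Var 1) (Var 2), Var 0]) T (Call MEM [Pair (Var 2) (Var 1), Var 0])"

definition "nonadj_body =
  Cond (Var 2)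
    (Cond (Call ADJ [Var 0, Var 1, First (Var 2)])
      (Call NONADJ [Var 0, Var 1, Second (Var 2)])
      (Pair (First (Var 2)) (Call NONADJ [Var 0, Var 1, Second (Var 2)])))
    Atom"

definition "parent_body =
  Cond (Var 2)
    (Cond (Call ADJ [Var 0, First (First (Var 2)), Var 1])
      (Pair (Var 1) (First (Var 2)))
      (Call PARENT [Var 0, Var 1, Second (Var 2)]))
    Atom"

definition "expand_body =
  Cond (Var 2)
    (Bind (Call EXPAND [Var 0, Var 1, Second (Var 2)])
      (Bind (Call PARENT [Var 1, First (Var 3), Var 2])
        (Cond (Var 0)
          (Pair (Pair (Var 0) (First (Var 1))) (Second (Var 1)))
          (Pair (First (Var 1)) (Pair (First (Var 4)) (Second (Var 1)))))))
    (Pair Atom Atom)"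

definition "head_body =
  Cond (Var 1)
    (Cond (Call EQ [First (First (Var 1)), Var 0]) (First (Var 1)) (Call HEAD [Var 0, Second (Var 1)]))
    Atom"

definition "bfs_body =
  Bind (Call HEAD [Var 1, Var 2])
    (Cond (Var 0) (Var 0)
      (Bind (Call EXPAND [Var 1, Var 3, Var 4])
        (Cond (First (Var 0)) (Call BFS [Var 2, Var 3, First (Var 0), Second (Var 0)]) Atom)))"

definition "flips_body =
  Cond (Second (Var 0))
    (Pair (Pair (First (Second (Var 0))) (Var 1)) (Call FLIPS [Second (Second (Var 0)), Var 1, Var 2]))
    (Var 2)"

definition "consall_body =
  Cond (Var 1) (Pair (Pair (Var 0) (First (Var 1))) (Call CONSALL [Var 0, Second (Var 1), Var 2])) (Var 2)"

definition "extend_body =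
  Cond (Var 0) (Call CONSALL [First (Var 0), Var 1, Call EXTEND [Second (Var 0), Var 1]]) Atom"

definition "triple_body =
  Bind (First (Var 2)) (Bind (First (Second (Var 3))) (Bind (First (Second (Second (Var 4))))
    (Cond (Call EQ [Var 2, Var 1]) Atom
      (Cond (Cond (First (Var 2)) (Cond (First (Var 1)) (First (Var 0)) Atom)
                (Cond (First (Var 1)) Atom (Cond (First (Var 0)) Atom T)))
        (Bind (Call BFS [Var 3, Var 1, Pair (Pair (Var 2) Atom) Atom, Call NONADJ [Var 3, Var 0, Var 4]])
          (Bind (Call BFS [Var 4, Var 1, Pair (Pair (Var 2) Atom) Atom, Call NONADJ [Var 4, Var 3, Var 5]])
            (Bind (Call BFS [Var 5, Var 4, Pair (Pair (Var 2) Atom) Atom, Call NONADJ [Var 5, Var 3, Var 6]])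
              (Cond (Cond (Var 2) (Cond (Var 1) (Var 0) Atom) Atom)
                (Bind (Call FLIPS [Var 2, Var 3, Call FLIPS [Var 1, Var 5, Call FLIPS [Var 0, Var 4, Atom]]])
                  (Cond (seconds 18 (Var 0)) Atom (Var 0)))
                Atom))))
        Atom))))"

definition "findtriple_body =
  Cond (Var 2)
    (Bind (Call TRIPLE [Var 0, Var 1, First (Var 2)])
      (Cond (Var 0) (Var 0) (Call FINDTRIPLE [Var 1, Var 2, Second (Var 3)])))
    Atom"

definition "hole_body =
  Bind (First (Var 2)) (Bind (First (Second (Var 3))) (Bind (First (Second (Second (Var 4))))
  (Bind (First (Second (Second (Second (Var 5))))) (Bind (First (Second (Second (Second (Second (Var 6))))))
    (Cond (Call ADJ [Var 5, Var 4, Var 3])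
    (Cond (Call ADJ [Var 5, Var 3, Var 2])
    (Cond (Call ADJ [Var 5, Var 2, Var 1])
    (Cond (Call ADJ [Var 5, Var 1, Var 0])
    (Cond (Call ADJ [Var 5, Var 4, Var 1]) Atom
    (Cond (Call ADJ [Var 5, Var 3, Var 0]) Atom
      (Bind (Call BFS [Var 5, Var 0, Pair (Pair (Var 4) Atom) Atom,
               Pair (Var 0) (Call NONADJ [Var 5, Var 2, Call NONADJ [Var 5, Var 3, Call NONADJ [Var 5, Var 1, Var 6]]])])
        (Cond (Var 0) (Pair (Var 4) (Pair (Var 3) (Pair (Var 2) (Var 0)))) Atom)))) Atom) Atom) Atom) Atom)))))"

definition "findhole_body =
  Cond (Var 2)
    (Bind (Call HOLE [Var 0, Var 1, First (Var 2)])
      (Cond (Var 0) (Var 0) (Call FINDHOLE [Var 1, Var 2, Second (Var 3)])))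
    Atom"

text \<open>The last argument accumulates the results, so that concatenating the lists of the two
  branches causes no extra cost.\<close>

definition "leaves_body =
  Cond (seconds 3 (Var 0))
    (Bind (Pair (First (Var 0)) (seconds 3 (Var 0)))
      (Bind (Pair (Pair (First (Second (Var 0))) (First (Var 0))) (Var 3))
        (Cond (Var 3)
          (Call LEAVES [Var 1, Var 3, Var 0,
             Call LEAVES [Pair (First (Var 3)) (Var 2), Second (Var 3), Var 4, Var 5]])
          (Cond (seconds 4 (Var 2)) (Call LEAVES [Var 1, Atom, Var 0, Var 5]) (Pair (Var 4) (Var 5))))))
    (Cond (Var 1) (Call LEAVES [Pair (First (Var 1)) (Var 0), Second (Var 1), Var 2, Var 3]) (Var 3))"

definition "dec_body =
  Cond (Var 0)
    (Cond (First (Var 0)) (Pair Atom (Pair Atom (Second (Var 0))))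
      (Bind (Call DEC [Second (Var 0)]) (Cond (Var 0) (Pair Atom (Pair T (Second (Var 0)))) Atom)))
    Atom"

text \<open>The cycle itself serves as the counter: two of its vertices are dropped per decrement
  until four are left, which subtracts \<open>f\<close> for a cycle with \<open>2 * f + 4\<close>
  vertices.\<close>

definition "decs_body =
  Cond (seconds 4 (Var 0))
    (Bind (Call DEC [Var 1]) (Cond (Var 0) (Call DECS [seconds 2 (Var 1), Second (Var 0)]) Atom))
    (Pair Atom (Var 1))"

definition "solve_body =
  Bind (Call FINDTRIPLE [Var 0, Var 1, Call EXTEND [Var 1, Call EXTEND [Var 1, Call EXTEND [Var 1, Pair Atom Atom]]]])
    (Cond (Var 0)
      (Bind (Call DEC [Var 3])
        (Cond (Var 0) (Call ANY [Call EACH [Var 1, Var 2], Var 3, Second (Var 0)]) Atom))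
      (Bind (Call FINDHOLE [Var 1, Var 2, Call EXTEND [Var 2, Call EXTEND [Var 2, Call EXTEND [Var 2,
                 Call EXTEND [Var 2, Call EXTEND [Var 2, Pair Atom Atom]]]]]])
        (Cond (Var 0)
          (Bind (Call DECS [Var 0, Var 4])
            (Cond (Var 0) (Call ANY [Call LEAVES [Atom, Var 1, Var 3, Atom], Var 4, Second (Var 0)]) Atom))
          T)))"

definition "any_body =
  Cond (Var 0)
    (Cond (Call SOLVE [First (Var 0), Var 1, Var 2]) T (Call ANY [Second (Var 0), Var 1, Var 2]))
    Atom"

definition "each_body =
  Cond (Var 0) (Pair (Pair (First (Var 0)) (Var 1)) (Call EACH [Second (Var 0), Var 1])) Atom"

definition "rowedges_body =
  Cond (Var 0)
    (Bind (Call ROWEDGES [Second (Var 0), Var 1, Pair Atom (Var 2), Var 3])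
      (Cond (First (Var 1)) (Pair (Pair (Pair Atom (Var 2)) (Pair T (Var 3))) (Var 0)) (Var 0)))
    (Var 3)"

definition "edges_body =
  Cond (Var 0)
    (Call ROWEDGES [First (Var 0), Var 1, Atom, Call EDGES [Second (Var 0), Pair Atom (Var 1), Var 2]])
    (Var 2)"

definition "verts_body =
  Cond (Var 0)
    (Pair (Pair (Var 1) (Var 2)) (Call VERTS [Second (Var 0), Var 1, Pair Atom (Var 2), Var 3]))
    (Var 3)"

definition "prog =
  [main_body, eq_body, mem_body, adj_body, nonadj_body, parent_body, expand_body, head_body, bfs_body,
   flips_body, consall_body, extend_body, triple_body, findtriple_body, hole_body, findhole_body,
   leaves_body, dec_body, decs_body, solve_body, any_body, each_body, rowedges_body, edges_body, verts_body]"

lemma prog_nth: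
  "prog ! 0 = main_body" "prog ! EQ = eq_body" "prog ! MEM = mem_body" "prog ! ADJ = adj_body"
  "prog ! NONADJ = nonadj_body" "prog ! PARENT = parent_body" "prog ! EXPAND = expand_body"
  "prog ! HEAD = head_body" "prog ! BFS = bfs_body" "prog ! FLIPS = flips_body"
  "prog ! CONSALL = consall_body" "prog ! EXTEND = extend_body" "prog ! TRIPLE = triple_body"
  "prog ! FINDTRIPLE = findtriple_body" "prog ! HOLE = hole_body" "prog ! FINDHOLE = findhole_body"
  "prog ! LEAVES = leaves_body" "prog ! DEC = dec_body" "prog ! DECS = decs_body"
  "prog ! SOLVE = solve_body" "prog ! ANY = any_body" "prog ! EACH = each_body"
  "prog ! ROWEDGES = rowedges_body" "prog ! EDGES = edges_body" "prog ! VERTS = verts_body"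
  "length prog = 25"
  by (simp_all add: prog_def index_defs)

section \<open>Symbolic execution\<close>

text \<open>A weakest precondition for total correctness whose postcondition also sees the running
  time. With the equations below, the simplifier executes a body symbolically.\<close>

definition wp :: "program \<Rightarrow> tree list \<Rightarrow> expr \<Rightarrow> (tree \<Rightarrow> nat \<Rightarrow> bool) \<Rightarrow> bool" where
  "wp P env e Q \<longleftrightarrow> (\<exists>v t. evaluates P env e v t \<and> Q v t)"

definition wps :: "program \<Rightarrow> tree list \<Rightarrow> expr list \<Rightarrow> (tree list \<Rightarrow> nat \<Rightarrow> bool) \<Rightarrow> bool" where
  "wps P env es Q \<longleftrightarrow> (\<exists>vs t. evaluates_list P env es vs t \<and> Q vs t)"

definition run :: "program \<Rightarrow> nat \<Rightarrow> tree list \<Rightarrow> (tree \<Rightarrow> nat \<Rightarrow> bool) \<Rightarrow> bool" where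
  "run P f vs Q \<longleftrightarrow> f < length P \<and> wp P vs (P ! f) Q"

definition time :: "program \<Rightarrow> nat \<Rightarrow> tree list \<Rightarrow> nat" where
  "time P f vs = (THE t. \<exists>v. evaluates P vs (P ! f) v t)"

definition computes :: "program \<Rightarrow> nat \<Rightarrow> tree list \<Rightarrow> tree \<Rightarrow> nat \<Rightarrow> bool" where
  "computes P f vs v b \<longleftrightarrow> run P f vs (\<lambda>v' t. v' = v \<and> t \<le> b)"

lemmas intros = evaluates_evaluates_list.intros[simplified]

lemma wp_Var [simp]: "wp P env (Var i) Q \<longleftrightarrow> i < length env \<and> Q (env ! i) (Suc 0)"
  unfolding wp_def by (blast elim: evaluates_elims(1) intro: intros)

lemma wp_Atom [simp]: "wp P env Atom Q \<longleftrightarrow> Q Leaf (Suc 0)"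
  unfolding wp_def by (blast elim: evaluates_elims(2) intro: intros)

lemma wp_Pair [simp]:
  "wp P env (Pair e1 e2) Q \<longleftrightarrow> wp P env e1 (\<lambda>v1 t1. wp P env e2 (\<lambda>v2 t2. Q (Branch v1 v2) (Suc (t1 + t2))))"
  unfolding wp_def by (blast elim: evaluates_elims(3) intro: intros)

lemma wp_First [simp]: "wp P env (First e) Q \<longleftrightarrow> wp P env e (\<lambda>v t. Q (first_child v) (Suc t))"
  unfolding wp_def by (blast elim: evaluates_elims(4) intro: intros)

lemma wp_Second [simp]: "wp P env (Second e) Q \<longleftrightarrow> wp P env e (\<lambda>v t. Q (second_child v) (Suc t))"
  unfolding wp_def by (blast elim: evaluates_elims(5) intro: intros)

lemma wp_Cond [simp]:
  "wp P env (Cond e e1 e2) Q \<longleftrightarrow> wp P env e (\<lambda>v t.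
     if v = Leaf then wp P env e2 (\<lambda>v' t'. Q v' (Suc (t + t'))) else wp P env e1 (\<lambda>v' t'. Q v' (Suc (t + t'))))"
proof
  assume "wp P env (Cond e e1 e2) Q"
  then obtain v t where "evaluates P env (Cond e e1 e2) v t" "Q v t" unfolding wp_def by blast
  then show "wp P env e (\<lambda>v t.
     if v = Leaf then wp P env e2 (\<lambda>v' t'. Q v' (Suc (t + t'))) else wp P env e1 (\<lambda>v' t'. Q v' (Suc (t + t'))))"
    by (elim evaluates_elims(6)) (auto simp: wp_def; metis tree.distinct(1))+
next
  assume "wp P env e (\<lambda>v t.
     if v = Leaf then wp P env e2 (\<lambda>v' t'. Q v' (Suc (t + t'))) else wp P env e1 (\<lambda>v' t'. Q v' (Suc (t + t'))))"
  then obtain v t where v: "evaluates P env e v t"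
    "if v = Leaf then wp P env e2 (\<lambda>v' t'. Q v' (Suc (t + t'))) else wp P env e1 (\<lambda>v' t'. Q v' (Suc (t + t')))"
    unfolding wp_def[of _ _ e] by blast
  then show "wp P env (Cond e e1 e2) Q"
    unfolding wp_def by (cases v) (auto intro: intros)
qed

lemma wp_Bind [simp]:
  "wp P env (Bind e1 e2) Q \<longleftrightarrow> wp P env e1 (\<lambda>v1 t1. wp P (v1 # env) e2 (\<lambda>v2 t2. Q v2 (Suc (t1 + t2))))"
  unfolding wp_def by (blast elim: evaluates_elims(7) intro: intros)

lemma wp_Call [simp]: "wp P env (Call f es) Q \<longleftrightarrow> wps P env es (\<lambda>vs t. run P f vs (\<lambda>v t'. Q v (Suc (t + t'))))"
  unfolding wp_def wps_def run_def by (blast elim: evaluates_elims(8) intro: intros)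

lemma wps_Nil [simp]: "wps P env [] R \<longleftrightarrow> R [] 0"
  unfolding wps_def by (blast elim: evaluates_list_elims(1) intro: intros)

lemma wps_Cons [simp]:
  "wps P env (e # es) R \<longleftrightarrow> wp P env e (\<lambda>v t. wps P env es (\<lambda>vs t'. R (v # vs) (t + t')))"
  unfolding wp_def wps_def by (blast elim: evaluates_list_elims(2) intro: intros)

lemma wp_seconds [simp]: "wp P env (seconds n e) Q \<longleftrightarrow> wp P env e (\<lambda>v t. Q ((second_child ^^ n) v) (t + n))"
  by (induction n arbitrary: Q) auto

text \<open>Determinism turns a verified call into a rewrite rule: the call returns its value after
  a fixed but unknown number of steps, \<open>time P f vs\<close>. The bound on that number enters
  separately, as a linear inequality.\<close>

lemma computes_run:
  assumes "computes P f vs v b"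
  shows "run P f vs Q \<longleftrightarrow> Q v (time P f vs)" and "time P f vs \<le> b"
proof -
  from assms obtain t where t: "f < length P" "evaluates P vs (P ! f) v t" "t \<le> b"
    unfolding computes_def run_def wp_def by blast
  have *: "evaluates P vs (P ! f) v' t' \<longleftrightarrow> v' = v \<and> t' = t" for v' t'
    using t(2) evaluates_deterministic(1)[OF t(2)] by blast
  then have "time P f vs = t" unfolding time_def by simp
  with * t show "run P f vs Q \<longleftrightarrow> Q v (time P f vs)" and "time P f vs \<le> b"
    unfolding run_def wp_def by auto
qed

lemma computesI: "wp P vs (P ! f) (\<lambda>v' t. v' = v \<and> t \<le> b) \<Longrightarrow> f < length P \<Longrightarrow> computes P f vs v b"
  unfolding computes_def run_def by simp

lemma index_less:
  "EQ < 25" "MEM < 25" "ADJ < 25" "NONADJ < 25" "PARENT < 25" "EXPAND < 25" "HEAD < 25" "BFS < 25"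
  "FLIPS < 25" "CONSALL < 25" "EXTEND < 25" "TRIPLE < 25" "FINDTRIPLE < 25" "HOLE < 25"
  "FINDHOLE < 25" "LEAVES < 25" "DEC < 25" "DECS < 25" "SOLVE < 25" "ANY < 25" "EACH < 25"
  "ROWEDGES < 25" "EDGES < 25" "VERTS < 25"
  by (simp_all add: index_defs)

lemma computes_mono: "computes P f vs v b \<Longrightarrow> b \<le> b' \<Longrightarrow> computes P f vs v b'"
  using computes_run[of P f vs v b] unfolding computes_def by auto

lemma tree_of_list_eq_Leaf [simp]: "tree_of_list enc xs = Leaf \<longleftrightarrow> xs = []"
  by (cases xs) auto

lemma tree_of_bool_eq_Leaf [simp]: "tree_of_bool b = Leaf \<longleftrightarrow> \<not> b"
  by (cases b) auto

lemma second_child_list [simp]: "second_child (tree_of_list enc xs) = tree_of_list enc (tl xs)"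
  by (cases xs) auto

lemma seconds_list [simp]: "(second_child ^^ n) (tree_of_list enc xs) = tree_of_list enc (drop n xs)"
  by (induction n arbitrary: xs) (auto simp: drop_Suc tl_drop)

text \<open>Programs produce the node, specifications speak of truth values; the folded form is made
  the normal form. The opposite equation would cause a loop.\<close>

lemma Branch_Leaf_Leaf [simp]: "Branch Leaf Leaf = tree_of_bool True"
  by simp

declare tree_of_bool.simps(2) [simp del]

abbreviation "vlist \<equiv> tree_of_list (\<lambda>v :: tree. v)"

fun edge :: "tree \<times> tree \<Rightarrow> tree" where
  "edge (u, v) = Branch u v"

abbreviation "elist \<equiv> tree_of_list edge"
abbreviation "bits \<equiv> tree_of_list tree_of_bool"

subsection \<open>Adjacency\<close>

text \<open>The comparison ends as soon as either tree does, so the size of the first one bounds the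
  work.\<close>

lemma eq_computes: "computes prog EQ [u, v] (tree_of_bool (u = v)) (25 * size u + 10)"
proof (induction u arbitrary: v)
  case Leaf
  show ?case by (rule computesI; cases v) (simp_all add: prog_nth eq_body_def index_less)
next
  case (Branch a b)
  note 1 = computes_run[OF Branch.IH(1)] and 2 = computes_run[OF Branch.IH(2)]
  show ?case
  proof (rule computesI)
    show "wp prog [Branch a b, v] (prog ! EQ) (\<lambda>v' t. v' = tree_of_bool (Branch a b = v) \<and> t \<le> 25 * size (Branch a b) + 10)"
      using 1(2)[of "first_child v"] 2(2)[of "second_child v"]
      by (cases v) (auto simp: prog_nth eq_body_def 1(1) 2(1))
  qed (simp add: prog_nth index_less)
qed

lemma mem_computes:
  "computes prog MEM [u, tree_of_list enc xs] (tree_of_bool (u \<in> enc ` set xs)) ((length xs + 1) * (25 * size u + 30))"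
proof (induction xs)
  case Nil
  show ?case by (rule computesI) (simp_all add: prog_nth mem_body_def index_less)
next
  case (Cons x xs)
  note 1 = computes_run[OF Cons.IH] and 2 = computes_run[OF eq_computes]
  show ?case
    using 1(2) 2(2)[of u "enc x"]
    by (intro computesI) (auto simp: prog_nth mem_body_def 1(1) 2(1) index_less algebra_simps)
qed

lemma edge_image: "Branch u v \<in> edge ` set E \<longleftrightarrow> (u, v) \<in> set E"
  by force

lemma adj_computes:
  "computes prog ADJ [elist E, u, v] (tree_of_bool (adj_of E u v))
     (2 * ((length E + 1) * (25 * (size u + size v + 1) + 30)) + 20)"
proof -
  note 1 = computes_run[OF mem_computes[of _ edge E]]
  have "time prog MEM [Branch u v, elist E] \<le> (length E + 1) * (25 * (size u + size v + 1) + 30)"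
    "time prog MEM [Branch v u, elist E] \<le> (length E + 1) * (25 * (size u + size v + 1) + 30)"
    using 1(2)[of "Branch u v"] 1(2)[of "Branch v u"] by (simp_all add: add.commute)
  then show ?thesis
    by (intro computesI) (auto simp: prog_nth adj_body_def 1(1) index_less edge_image adj_of_def)
qed

lemma flips_computes:
  "computes prog FLIPS [vlist p, c, elist acc] (elist (flips p c acc)) ((length p + 1) * 30)"
proof (induction p c acc rule: flips.induct)
  case (1 y r p c acc)
  note 1 = computes_run[OF 1]
  show ?case using 1(2) by (intro computesI) (simp_all add: prog_nth flips_body_def 1(1) index_less)
next
  case ("2_1" c acc)
  show ?case by (intro computesI) (simp_all add: prog_nth flips_body_def index_less)
next
  case ("2_2" y c acc)
  show ?case by (intro computesI) (simp_all add: prog_nth flips_body_def index_less)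
qed

abbreviation "plist \<equiv> tree_of_list vlist"

lemma consall_computes:
  "computes prog CONSALL [v, plist ts, plist acc] (plist (map ((#) v) ts @ acc)) ((length ts + 1) * 30)"
proof (induction ts)
  case Nil
  show ?case by (intro computesI) (simp_all add: prog_nth consall_body_def index_less)
next
  case (Cons t ts)
  note 1 = computes_run[OF Cons.IH]
  show ?case using 1(2) by (intro computesI) (simp_all add: prog_nth consall_body_def 1(1) index_less)
qed

lemma extend_computes:
  "computes prog EXTEND [vlist V, plist ts] (plist (concat (map (\<lambda>v. map ((#) v) ts) V)))
     ((length V + 1) * ((length ts + 1) * 30 + 30))"
proof (induction V)
  case Nil
  show ?case by (intro computesI) (simp_all add: prog_nth extend_body_def index_less)
next
  case (Cons v V)
  note 1 = computes_run[OF Cons.IH] and 2 = computes_run[OF consall_computes]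
  show ?case
    using 1(2) 2(2)[of v ts "concat (map (\<lambda>v. map ((#) v) ts) V)"]
    by (intro computesI) (simp_all add: prog_nth extend_body_def 1(1) 2(1) index_less algebra_simps)
qed

lemma each_computes:
  "computes prog EACH [elist zs, elist E] (tree_of_list elist (map (\<lambda>z. z # E) zs)) ((length zs + 1) * 20)"
proof (induction zs)
  case Nil
  show ?case by (intro computesI) (simp_all add: prog_nth each_body_def index_less)
next
  case (Cons z zs)
  note 1 = computes_run[OF Cons.IH]
  show ?case using 1(2) by (intro computesI) (simp_all add: prog_nth each_body_def 1(1) index_less)
qed

subsection \<open>Shortest paths and the search for obstructions\<close>

text \<open>Cost bounds in terms of the number \<open>n\<close> of vertices and the cost
  \<open>a\<close> of a single test of adjacency or equality.\<close>

definition "c_parent n a = (n + 1) * (a + 40 :: nat)"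
definition "c_expand n a = (n + 1) * (c_parent n a + 60)"
definition "c_bfs n a = (n + 2) * (c_parent (n + 1) a + c_expand (n + 1) a + 60)"
definition "c_triple n a = 3 * ((n + 1) * (a + 30)) + 3 * c_bfs n a + 90 * (n + 4) + a + 300"
definition "c_hole n a = 3 * ((n + 1) * (a + 30)) + c_bfs n a + 6 * a + 300"

lemma first_child_list [simp]: "xs \<noteq> [] \<Longrightarrow> first_child (tree_of_list enc xs) = enc (hd xs)"
  by (cases xs) auto

lemma nonadj_Cons: "nonadj A c (v # vs) = (if A c v then nonadj A c vs else v # nonadj A c vs)"
  unfolding nonadj_def by simp

text \<open>A new layer lengthens the paths by one and consumes at least one vertex. The bound
  limits the cost of reading off candidates.\<close>

lemma bfs_length:
  "\<forall>p\<in>set ps. length p \<le> k \<Longrightarrow> length (bfs A y ps vs) \<le> k + length vs"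
proof (induction A y ps vs arbitrary: k rule: bfs.induct)
  case (1 A y ps vs)
  let ?qs = "fst (expand A ps vs)" and ?ws = "snd (expand A ps vs)"
  show ?case
  proof (cases "find_head y ps = [] \<and> ?qs \<noteq> []")
    case True
    have "\<forall>p\<in>set ?qs. length p \<le> Suc k" using 1(2) by (auto dest!: expand_fst)
    then have "length (bfs A y ?qs ?ws) \<le> Suc k + length ?ws" using True by (intro 1(1)) auto
    moreover have "length ?qs + length ?ws = length vs" "length ?qs > 0" using expand_length True by auto
    moreover have eq: "bfs A y ps vs = bfs A y ?qs ?ws" using True bfs.simps[of A y ps vs] by (simp add: Let_def)
    ultimately show ?thesis unfolding eq by linarith
  next
    case False
    then have "bfs A y ps vs = find_head y ps"
      using bfs.simps[of A y ps vs] by (auto simp: Let_def)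
    then show ?thesis using find_head_sound[of y ps] 1(2) by (cases "find_head y ps = []") auto
  qed
qed

text \<open>An adjacency test scans an edge list that grows along the recursion; a uniform bound
  \<open>a\<close> on its cost separates this from the analysis of the search.\<close>

locale timed_graph =
  fixes E :: "(tree \<times> tree) list" and V :: "tree list" and n a :: nat
  assumes adj_time: "u \<in> set V \<Longrightarrow> v \<in> set V \<Longrightarrow> computes prog ADJ [elist E, u, v] (tree_of_bool (adj_of E u v)) a"
    and eq_time: "u \<in> set V \<Longrightarrow> v \<in> set V \<Longrightarrow> computes prog EQ [u, v] (tree_of_bool (u = v)) a"
    and length_V: "length V \<le> n"
begin

lemma nonadj_computes:
  assumes "c \<in> set V" "set vs \<subseteq> set V"
  shows "computes prog NONADJ [elist E, c, vlist vs] (vlist (nonadj (adj_of E) c vs)) ((length vs + 1) * (a + 30))"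
  using assms(2)
proof (induction vs)
  case Nil
  show ?case by (intro computesI) (simp_all add: prog_nth nonadj_body_def nonadj_def index_less)
next
  case (Cons v vs)
  then have "computes prog NONADJ [elist E, c, vlist vs] (vlist (nonadj (adj_of E) c vs)) ((length vs + 1) * (a + 30))"
    and v: "v \<in> set V" by simp_all
  note 1 = computes_run[OF this(1)] and 2 = computes_run[OF adj_time[OF assms(1) v]]
  show ?case
    using 1(2) 2(2)
    by (intro computesI) (auto simp: prog_nth nonadj_body_def nonadj_Cons 1(1) 2(1) index_less algebra_simps)
qed

definition paths :: "tree list list \<Rightarrow> bool" where
  "paths ps \<longleftrightarrow> (\<forall>p\<in>set ps. p \<noteq> [] \<and> hd p \<in> set V)"

lemma parent_computes:
  assumes "v \<in> set V" "paths ps"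
  shows "computes prog PARENT [elist E, v, plist ps] (vlist (find_parent (adj_of E) v ps)) ((length ps + 1) * (a + 40))"
  using assms(2)
proof (induction ps)
  case Nil
  show ?case by (intro computesI) (simp_all add: prog_nth parent_body_def index_less)
next
  case (Cons p ps)
  then have "computes prog PARENT [elist E, v, plist ps] (vlist (find_parent (adj_of E) v ps)) ((length ps + 1) * (a + 40))"
    and p: "hd p \<in> set V" "p \<noteq> []" unfolding paths_def by simp_all
  note 1 = computes_run[OF this(1)] and 2 = computes_run[OF adj_time[OF p(1) assms(1)]]
  show ?case
    using 1(2) 2(2) p(2)
    by (intro computesI) (auto simp: prog_nth parent_body_def 1(1) 2(1) index_less algebra_simps)
qed

lemma head_computes:
  assumes "y \<in> set V" "paths ps"
  shows "computes prog HEAD [y, plist ps] (vlist (find_head y ps)) ((length ps + 1) * (a + 40))"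
  using assms(2)
proof (induction ps)
  case Nil
  show ?case by (intro computesI) (simp_all add: prog_nth head_body_def index_less)
next
  case (Cons p ps)
  then have "computes prog HEAD [y, plist ps] (vlist (find_head y ps)) ((length ps + 1) * (a + 40))"
    and p: "hd p \<in> set V" "p \<noteq> []" unfolding paths_def by simp_all
  note 1 = computes_run[OF this(1)] and 2 = computes_run[OF eq_time[OF p(1) assms(1)]]
  show ?case
    using 1(2) 2(2) p(2)
    by (intro computesI) (auto simp: prog_nth head_body_def 1(1) 2(1) index_less algebra_simps)
qed

lemma expand_computes:
  assumes "set vs \<subseteq> set V" "paths ps" "length ps \<le> n"
  shows "computes prog EXPAND [elist E, plist ps, vlist vs]
    (Branch (plist (fst (expand (adj_of E) ps vs))) (vlist (snd (expand (adj_of E) ps vs))))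
    ((length vs + 1) * (c_parent n a + 60))"
  using assms(1)
proof (induction vs)
  case Nil
  show ?case by (intro computesI) (simp_all add: prog_nth expand_body_def index_less)
next
  case (Cons v vs)
  then have "computes prog EXPAND [elist E, plist ps, vlist vs]
    (Branch (plist (fst (expand (adj_of E) ps vs))) (vlist (snd (expand (adj_of E) ps vs))))
    ((length vs + 1) * (c_parent n a + 60))"
    and v: "v \<in> set V" by simp_all
  note 1 = computes_run[OF this(1)] and 2 = computes_run[OF parent_computes[OF v assms(2)]]
  have "(length ps + 1) * (a + 40) \<le> c_parent n a"
    unfolding c_parent_def using assms(3) by (intro mult_le_mono) auto
  then have 3: "time prog PARENT [elist E, v, plist ps] \<le> c_parent n a" using 2(2) by simp
  show ?case
    using 1(2) 3
    by (intro computesI) (auto simp: prog_nth expand_body_def 1(1) 2(1) index_less Let_def split: prod.splits)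
qed

text \<open>A round consists of one search among the heads and one expansion, and a round that is
  followed by another has removed a vertex from \<open>vs\<close>.\<close>

lemma bfs_computes:
  assumes "set vs \<subseteq> set V" "paths ps" "length ps \<le> n" "length vs \<le> n" "y \<in> set V"
  shows "computes prog BFS [elist E, y, plist ps, vlist vs] (vlist (bfs (adj_of E) y ps vs))
    ((length vs + 1) * (c_parent n a + c_expand n a + 60))"
  using assms
proof (induction "adj_of E" y ps vs rule: bfs.induct)
  case (1 y ps vs)
  note 2 = computes_run[OF head_computes[OF 1(6,3)]]
  note 3 = computes_run[OF expand_computes[OF 1(2,3,4)]]
  let ?qs = "fst (expand (adj_of E) ps vs)" and ?ws = "snd (expand (adj_of E) ps vs)"
  have "(length ps + 1) * (a + 40) \<le> c_parent n a"
    unfolding c_parent_def using 1(4) by (intro mult_le_mono) auto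
  then have t2: "time prog HEAD [y, plist ps] \<le> c_parent n a" using 2(2) by simp
  have "(length vs + 1) * (c_parent n a + 60) \<le> c_expand n a"
    unfolding c_expand_def using 1(5) by (intro mult_le_mono) auto
  then have t3: "time prog EXPAND [elist E, plist ps, vlist vs] \<le> c_expand n a" using 3(2) by simp
  show ?case
  proof (cases "find_head y ps = [] \<and> ?qs \<noteq> []")
    case True
    have "set ?ws \<subseteq> set V" using expand_snd[of "adj_of E" ps vs] 1(2) by blast
    moreover have "paths ?qs" using 1(2) unfolding paths_def by (auto dest!: expand_fst)
    moreover have l: "length ?qs + length ?ws = length vs" by (rule expand_length)
    ultimately have "computes prog BFS [elist E, y, plist ?qs, vlist ?ws] (vlist (bfs (adj_of E) y ?qs ?ws))
      ((length ?ws + 1) * (c_parent n a + c_expand n a + 60))"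
      using True 1(5,6) by (intro 1(1)) auto
    note 4 = computes_run[OF this]
    have "length ?ws + 1 \<le> length vs" using l True by (cases ?qs) auto
    then have "(length ?ws + 1) * (c_parent n a + c_expand n a + 60) \<le> length vs * (c_parent n a + c_expand n a + 60)"
      by (rule mult_le_mono1)
    then have t4: "time prog BFS [elist E, y, plist ?qs, vlist ?ws] \<le> length vs * (c_parent n a + c_expand n a + 60)"
      using 4(2) by linarith
    have eq: "bfs (adj_of E) y ps vs = bfs (adj_of E) y ?qs ?ws"
      using True bfs.simps[of "adj_of E" y ps vs] by (simp add: Let_def)
    show ?thesis
      using t2 t3 t4 True unfolding eq
      by (intro computesI) (simp_all add: prog_nth bfs_body_def 2(1) 3(1) 4(1) index_less)
  next
    case False
    then have eq: "bfs (adj_of E) y ps vs = find_head y ps"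
      using bfs.simps[of "adj_of E" y ps vs] by (auto simp: Let_def)
    have "c_parent n a + c_expand n a + 60 \<le> (length vs + 1) * (c_parent n a + c_expand n a + 60)" by simp
    then show ?thesis
      using t2 t3 False unfolding eq
      by (intro computesI) (auto simp: prog_nth bfs_body_def 2(1) 3(1) index_less)
  qed
qed

lemma bfs_start_computes:
  assumes "set vs \<subseteq> set V" "length vs \<le> n + 1" "x \<in> set V" "y \<in> set V"
  shows "computes prog BFS [elist E, y, Branch (Branch x Leaf) Leaf, vlist vs] (vlist (bfs (adj_of E) y [[x]] vs)) (c_bfs n a)"
proof -
  \<comment> \<open>The search for a hole adds the target \<open>y\<close> to the admissible
    vertices, so these lists may have \<open>n + 1\<close> elements.\<close>
  interpret m: timed_graph E V "n + 1" a
    by unfold_locales (use adj_time eq_time length_V in auto)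
  have "computes prog BFS [elist E, y, plist [[x]], vlist vs] (vlist (bfs (adj_of E) y [[x]] vs))
     ((length vs + 1) * (c_parent (n + 1) a + c_expand (n + 1) a + 60))"
    using assms by (intro m.bfs_computes) (auto simp: m.paths_def)
  moreover have "(length vs + 1) * (c_parent (n + 1) a + c_expand (n + 1) a + 60) \<le> c_bfs n a"
    unfolding c_bfs_def using assms(2) by (intro mult_le_mono1) simp
  ultimately show ?thesis using computes_mono by simp
qed

lemma nonadj_subset: "set (nonadj A c vs) \<subseteq> set vs" "length (nonadj A c vs) \<le> length vs"
  unfolding nonadj_def by auto

lemma triple_computes:
  assumes V: "x \<in> set V" "y \<in> set V" "z \<in> set V"
  shows "computes prog TRIPLE [elist E, vlist V, vlist [x, y, z]]
    (elist (try_triple (adj_of E) (\<lambda>v. first_child v \<noteq> Leaf) V x y z)) (c_triple n a)"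
proof -
  note nonadj = nonadj_subset[of "adj_of E" _ V]
  have na: "time prog NONADJ [elist E, c, vlist V] \<le> (n + 1) * (a + 30)" if "c \<in> set V" for c
  proof -
    have "(length V + 1) * (a + 30) \<le> (n + 1) * (a + 30)" using length_V by (intro mult_le_mono1) simp
    with computes_run(2)[OF nonadj_computes[OF that subset_refl]] show ?thesis by (rule order_trans)
  qed
  have bf: "computes prog BFS [elist E, v, Branch (Branch u Leaf) Leaf, vlist (nonadj (adj_of E) c V)]
      (vlist (bfs (adj_of E) v [[u]] (nonadj (adj_of E) c V))) (c_bfs n a)" if "u \<in> set V" "v \<in> set V" for u v c
    using nonadj[of c] that length_V by (intro bfs_start_computes) auto
  define p q r where "p = bfs (adj_of E) y [[x]] (nonadj (adj_of E) z V)" and "q = bfs (adj_of E) z [[y]] (nonadj (adj_of E) x V)"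
    and "r = bfs (adj_of E) x [[z]] (nonadj (adj_of E) y V)"
  have len: "length p \<le> n + 1" "length q \<le> n + 1" "length r \<le> n + 1"
    using bfs_length[of "[[_]]" 1 "adj_of E"] nonadj(2) length_V
    unfolding p_def q_def r_def by (fastforce intro: order_trans)+
  note e = computes_run[OF eq_time[OF V(1,2)]]
  note n1 = computes_run[OF nonadj_computes[OF V(1) subset_refl]] and n2 = computes_run[OF nonadj_computes[OF V(2) subset_refl]]
    and n3 = computes_run[OF nonadj_computes[OF V(3) subset_refl]]
  note b1 = computes_run[OF bf[OF V(1,2)], of z, folded p_def] and b2 = computes_run[OF bf[OF V(2,3)], of x, folded q_def]
    and b3 = computes_run[OF bf[OF V(3,1)], of y, folded r_def]
  note f3 = computes_run[OF flips_computes[of r y "[]", unfolded tree_of_list.simps]] and f2 = computes_run[OF flips_computes[of q x "flips r y []"]]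
    and f1 = computes_run[OF flips_computes[of p z "flips q x (flips r y [])"]]
  show ?thesis
    using e(2) na[OF V(1)] na[OF V(2)] na[OF V(3)] b1(2) b2(2) b3(2) f1(2) f2(2) f3(2) len
    by (intro computesI) (auto simp: prog_nth triple_body_def e(1) n1(1) n2(1) n3(1) b1(1) b2(1) b3(1) f1(1) f2(1) f3(1)
        index_less try_triple_def p_def[symmetric] q_def[symmetric] r_def[symmetric] Let_def c_triple_def)
qed

lemma hole_computes:
  assumes V: "x \<in> set V" "r \<in> set V" "c \<in> set V" "r' \<in> set V" "y \<in> set V"
  shows "computes prog HOLE [elist E, vlist V, vlist [x, r, c, r', y]]
    (vlist (try_hole (adj_of E) V x r c r' y)) (c_hole n a)"
proof -
  have nonadj: "computes prog NONADJ [elist E, u, vlist vs] (vlist (nonadj (adj_of E) u vs)) ((n + 1) * (a + 30))"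
    if "u \<in> set V" "set vs \<subseteq> set V" "length vs \<le> n" for u vs
  proof -
    have "(length vs + 1) * (a + 30) \<le> (n + 1) * (a + 30)" using that by (intro mult_le_mono1) simp
    with nonadj_computes[OF that(1,2)] show ?thesis by (rule computes_mono)
  qed
  define v1 v2 v3 where "v1 = nonadj (adj_of E) r' V" and "v2 = nonadj (adj_of E) r v1" and "v3 = nonadj (adj_of E) c v2"
  have s1: "set v1 \<subseteq> set V" "length v1 \<le> n" using nonadj_subset[of "adj_of E" r' V] length_V unfolding v1_def by auto
  have s2: "set v2 \<subseteq> set V" "length v2 \<le> n" using nonadj_subset[of "adj_of E" r v1] s1 unfolding v2_def by auto
  have s3: "set v3 \<subseteq> set V" "length v3 \<le> n" using nonadj_subset[of "adj_of E" c v2] s2 unfolding v3_def by auto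
  note n1 = computes_run[OF nonadj[OF V(4) subset_refl length_V], folded v1_def]
    and n2 = computes_run[OF nonadj[OF V(2) s1], folded v2_def] and n3 = computes_run[OF nonadj[OF V(3) s2], folded v3_def]
  define q where "q = bfs (adj_of E) y [[x]] (y # v3)"
  have "computes prog BFS [elist E, y, Branch (Branch x Leaf) Leaf, vlist (y # v3)] (vlist q) (c_bfs n a)"
    unfolding q_def using s3 V by (intro bfs_start_computes) auto
  note b = computes_run[OF this, unfolded tree_of_list.simps]
  note a1 = computes_run[OF adj_time[OF V(1,2)]] and a2 = computes_run[OF adj_time[OF V(2,3)]]
    and a3 = computes_run[OF adj_time[OF V(3,4)]] and a4 = computes_run[OF adj_time[OF V(4,5)]]
    and a5 = computes_run[OF adj_time[OF V(1,4)]] and a6 = computes_run[OF adj_time[OF V(2,5)]]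
  show ?thesis
    using a1(2) a2(2) a3(2) a4(2) a5(2) a6(2) n1(2) n2(2) n3(2) b(2)
    by (intro computesI) (auto simp: prog_nth hole_body_def a1(1) a2(1) a3(1) a4(1) a5(1) a6(1) n1(1) n2(1) n3(1) b(1)
        index_less try_hole_def v1_def[symmetric] v2_def[symmetric] v3_def[symmetric] q_def[symmetric] Let_def c_hole_def)
qed

lemma find_triple_computes:
  assumes "\<forall>t\<in>set ts. length t = 3 \<and> set t \<subseteq> set V"
  shows "computes prog FINDTRIPLE [elist E, vlist V, plist ts]
    (elist (first_nonempty (\<lambda>t. try_triple (adj_of E) (\<lambda>v. first_child v \<noteq> Leaf) V (t ! 0) (t ! 1) (t ! 2)) ts))
    ((length ts + 1) * (c_triple n a + 30))"
  using assms
proof (induction ts)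
  case Nil
  show ?case by (intro computesI) (simp_all add: prog_nth findtriple_body_def index_less)
next
  case (Cons t ts)
  then obtain x y z where t: "t = [x, y, z]" "x \<in> set V" "y \<in> set V" "z \<in> set V"
    by (auto simp: length_Suc_conv eval_nat_numeral)
  note 1 = computes_run[OF Cons.IH] and 2 = computes_run[OF triple_computes[OF t(2-4), unfolded tree_of_list.simps]]
  show ?case
    using 1(2) 2(2) Cons.prems t(1)
    by (intro computesI) (auto simp: prog_nth findtriple_body_def 1(1) 2(1) index_less)
qed

lemma find_hole_computes:
  assumes "\<forall>t\<in>set ts. length t = 5 \<and> set t \<subseteq> set V"
  shows "computes prog FINDHOLE [elist E, vlist V, plist ts]
    (vlist (first_nonempty (\<lambda>t. try_hole (adj_of E) V (t ! 0) (t ! 1) (t ! 2) (t ! 3) (t ! 4)) ts))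
    ((length ts + 1) * (c_hole n a + 30))"
  using assms
proof (induction ts)
  case Nil
  show ?case by (intro computesI) (simp_all add: prog_nth findhole_body_def index_less)
next
  case (Cons t ts)
  then obtain x r c r' y where t: "t = [x, r, c, r', y]" "x \<in> set V" "r \<in> set V" "c \<in> set V" "r' \<in> set V" "y \<in> set V"
    by (auto simp: length_Suc_conv eval_nat_numeral)
  note 1 = computes_run[OF Cons.IH] and 2 = computes_run[OF hole_computes[OF t(2-6), unfolded tree_of_list.simps]]
  show ?case
    using 1(2) 2(2) Cons.prems t(1)
    by (intro computesI) (auto simp: prog_nth findhole_body_def 1(1) 2(1) index_less)
qed

end

subsection \<open>Candidates\<close>

lemma seconds_numeral:
  "(second_child ^^ 2) t = second_child (second_child t)"
  "(second_child ^^ 3) t = second_child (second_child (second_child t))"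
  "(second_child ^^ 4) t = second_child (second_child (second_child (second_child t)))"
  by (simp_all add: eval_nat_numeral)

text \<open>Writing the power as a successor makes the truncated subtraction in the bounds below
  accessible to linear arithmetic.\<close>

lemma power_two_Suc: obtains m :: nat where "2 ^ k = Suc m"
  using not0_implies_Suc[of "2 ^ k"] by auto

lemma leaves_stop_computes:
  assumes "length S < 4"
  shows "computes prog LEAVES [vlist S, vlist [], elist E, tree_of_list elist acc] (tree_of_list elist acc) (60 * (2 * 2 ^ j - 1))"
proof -
  obtain m :: nat where m: "2 ^ j = Suc m" by (rule power_two_Suc)
  show ?thesis using assms
    by (intro computesI) (simp_all add: prog_nth leaves_body_def index_less m)
qed

lemma leaves_shift_computes:
  assumes IH: "\<And>j acc. length R + (length (v # S) + length R) div 2 \<le> j \<Longrightarrow>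
      computes prog LEAVES [vlist (v # S), vlist R, elist E, tree_of_list elist acc]
        (tree_of_list elist (leaves (v # S) R E @ acc)) (60 * (2 * 2 ^ j - 1))"
    and j: "length (v # R) + (length S + length (v # R)) div 2 \<le> j" and S: "length S < 4"
  shows "computes prog LEAVES [vlist S, vlist (v # R), elist E, tree_of_list elist acc]
      (tree_of_list elist (leaves (v # S) R E @ acc)) (60 * (2 * 2 ^ j - 1))"
proof -
  from j obtain k where k: "j = Suc k" by (cases j) auto
  note 1 = computes_run[OF IH[of k acc], unfolded tree_of_list.simps]
  obtain m :: nat where m: "2 ^ k = Suc m" by (rule power_two_Suc)
  show ?thesis using 1(2) j S
    by (intro computesI) (simp_all add: prog_nth leaves_body_def 1(1) index_less k m)
qed

text \<open>The factor \<open>2 * 2 ^ j - 1\<close> counts the nodes of a binary tree of depth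
  \<open>j\<close>: it is twice its value at \<open>j - 1\<close> plus one, which matches two calls
  and one unit of work. The exponent is that of \<open>length_leaves\<close>.\<close>

lemma leaves_computes:
  "length R + (length S + length R) div 2 \<le> j \<Longrightarrow>
     computes prog LEAVES [vlist S, vlist R, elist E, tree_of_list elist acc] (tree_of_list elist (leaves S R E @ acc))
       (60 * (2 * 2 ^ j - 1))"
proof (induction S R E arbitrary: j acc rule: leaves.induct)
  case (1 w z y x E)
  obtain m :: nat where m: "2 ^ j = Suc m" by (rule power_two_Suc)
  show ?case
    by (intro computesI) (simp_all add: prog_nth leaves_body_def index_less seconds_numeral m)
next
  case (2 w z y x s S E)
  then obtain k where j: "j = Suc k" by (cases j) auto
  have "computes prog LEAVES [vlist (w # x # s # S), vlist [], elist ((x, w) # E), tree_of_list elist acc]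
      (tree_of_list elist (leaves (w # x # s # S) [] ((x, w) # E) @ acc)) (60 * (2 * 2 ^ k - 1))"
    using 2(2) j by (intro 2(1)) auto
  note 1 = computes_run[OF this, unfolded tree_of_list.simps edge.simps]
  obtain m :: nat where m: "2 ^ k = Suc m" by (rule power_two_Suc)
  show ?case using 1(2)
    by (intro computesI) (simp_all add: prog_nth leaves_body_def 1(1) index_less seconds_numeral j m)
next
  case (3 w z y x S v R E)
  then obtain k where j: "j = Suc k" by (cases j) auto
  have "computes prog LEAVES [vlist (w # x # S), vlist (v # R), elist ((x, w) # E),
        tree_of_list elist (leaves (v # w # z # y # x # S) R E @ acc)]
      (tree_of_list elist (leaves (w # x # S) (v # R) ((x, w) # E) @ leaves (v # w # z # y # x # S) R E @ acc))
      (60 * (2 * 2 ^ k - 1))"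
    using 3(3) j by (intro 3(1)) auto
  note 1 = computes_run[OF this, unfolded tree_of_list.simps edge.simps]
  have "computes prog LEAVES [vlist (v # w # z # y # x # S), vlist R, elist E, tree_of_list elist acc]
      (tree_of_list elist (leaves (v # w # z # y # x # S) R E @ acc)) (60 * (2 * 2 ^ k - 1))"
    using 3(3) j by (intro 3(2)) auto
  note 2 = computes_run[OF this, unfolded tree_of_list.simps]
  obtain m :: nat where m: "2 ^ k = Suc m" by (rule power_two_Suc)
  show ?case using 1(2) 2(2)
    by (intro computesI) (simp_all add: prog_nth leaves_body_def 1(1) 2(1) index_less seconds_numeral j m)
next
  case ("4_1" v R E)
  from leaves_shift_computes[OF "4_1"(1) "4_1"(2)] show ?case by simp
next
  case ("4_2" a v R E)
  from leaves_shift_computes[OF "4_2"(1) "4_2"(2)] show ?case by simp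
next
  case ("4_3" a b v R E)
  from leaves_shift_computes[OF "4_3"(1) "4_3"(2)] show ?case by simp
next
  case ("4_4" a b c v R E)
  from leaves_shift_computes[OF "4_4"(1) "4_4"(2)] show ?case by simp
next
  case ("5_1" E)
  show ?case using leaves_stop_computes[of "[]" E acc j] by simp
next
  case ("5_2" a E)
  show ?case using leaves_stop_computes[of "[a]" E acc j] by simp
next
  case ("5_3" a b E)
  show ?case using leaves_stop_computes[of "[a, b]" E acc j] by simp
next
  case ("5_4" a b c E)
  show ?case using leaves_stop_computes[of "[a, b, c]" E acc j] by simp
qed

subsection \<open>Counting down\<close>

fun bits_value :: "bool list \<Rightarrow> nat" where
  "bits_value [] = 0"
| "bits_value (b # bs) = of_bool b + 2 * bits_value bs"

text \<open>Leading zeros are kept, so the number of digits and hence the cost of a decrement stay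
  the same along the recursion.\<close>

fun dec :: "bool list \<Rightarrow> bool list option" where
  "dec [] = None"
| "dec (True # bs) = Some (False # bs)"
| "dec (False # bs) = map_option ((#) True) (dec bs)"

fun decs :: "nat \<Rightarrow> bool list \<Rightarrow> bool list option" where
  "decs 0 bs = Some bs"
| "decs (Suc k) bs = (case dec bs of None \<Rightarrow> None | Some cs \<Rightarrow> decs k cs)"

lemma bits_value_binary: "bits_value (binary n) = n"
proof (induction n rule: binary.induct)
  case (1 n)
  then show ?case by (subst binary.simps) (auto simp: Let_def)
qed

lemma dec_None: "dec bs = None \<longleftrightarrow> bits_value bs = 0"
  by (induction bs rule: dec.induct) auto

lemma dec_Some: "dec bs = Some cs \<Longrightarrow> bits_value bs = Suc (bits_value cs) \<and> length cs = length bs"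
  by (induction bs arbitrary: cs rule: dec.induct) auto

lemma decs_None: "decs k bs = None \<longleftrightarrow> bits_value bs < k"
proof (induction k arbitrary: bs)
  case (Suc k)
  show ?case
  proof (cases "dec bs")
    case None
    then show ?thesis using dec_None[of bs] by simp
  next
    case (Some cs)
    then show ?thesis using Suc[of cs] dec_Some[OF Some] by simp
  qed
qed simp

lemma decs_Some: "decs k bs = Some cs \<Longrightarrow> bits_value bs = k + bits_value cs \<and> length cs = length bs"
proof (induction k arbitrary: bs)
  case (Suc k)
  then obtain ds where "dec bs = Some ds" "decs k ds = Some cs" by (auto split: option.splits)
  then show ?case using Suc.IH[of ds] dec_Some[of bs ds] by simp
qed simp

text \<open>The additional node distinguishes failure from a number without digits.\<close>

fun bits_option :: "bool list option \<Rightarrow> tree" where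
  "bits_option None = Leaf"
| "bits_option (Some bs) = Branch Leaf (bits bs)"

lemma dec_computes: "computes prog DEC [bits bs] (bits_option (dec bs)) ((length bs + 1) * 30)"
proof (induction bs rule: dec.induct)
  case 1
  show ?case by (intro computesI) (simp_all add: prog_nth dec_body_def index_less)
next
  case (2 bs)
  show ?case by (intro computesI) (simp_all add: prog_nth dec_body_def index_less)
next
  case (3 bs)
  note 1 = computes_run[OF 3]
  show ?case using 1(2)
    by (intro computesI; cases "dec bs") (simp_all add: prog_nth dec_body_def 1(1) index_less)
qed

lemma decs_computes:
  "length C = 2 * k + 4 \<Longrightarrow>
     computes prog DECS [vlist C, bits bs] (bits_option (decs k bs)) ((k + 1) * ((length bs + 1) * 30 + 30))"
proof (induction k arbitrary: C bs)
  case 0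
  then show ?case by (intro computesI) (simp_all add: prog_nth decs_body_def index_less)
next
  case (Suc k)
  note 1 = computes_run[OF dec_computes[of bs]]
  show ?case
  proof (cases "dec bs")
    case None
    with Suc.prems 1(2) show ?thesis
      by (intro computesI) (simp_all add: prog_nth decs_body_def 1(1) index_less)
  next
    case (Some cs)
    have "computes prog DECS [vlist (drop 2 C), bits cs] (bits_option (decs k cs)) ((k + 1) * ((length cs + 1) * 30 + 30))"
      using Suc.prems by (intro Suc.IH) simp
    note 2 = computes_run[OF this]
    show ?thesis
      using Suc.prems 1(2) 2(2) Some dec_Some[OF Some]
      by (intro computesI) (simp_all add: prog_nth decs_body_def 1(1) 2(1) index_less)
  qed
qed

section \<open>The search tree\<close>

abbreviation column :: "tree \<Rightarrow> bool" where
  "column \<equiv> \<lambda>v. first_child v \<noteq> Leaf"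

declare tuples.simps [simp del]

lemma any_computes:
  assumes "\<And>E. E \<in> set Es \<Longrightarrow> computes prog SOLVE [elist E, V, d] (tree_of_bool (P E)) t"
  shows "computes prog ANY [tree_of_list elist Es, V, d] (tree_of_bool (\<exists>E\<in>set Es. P E)) (length Es * (t + 30) + 10)"
  using assms
proof (induction Es)
  case Nil
  show ?case by (intro computesI) (simp_all add: prog_nth any_body_def index_less)
next
  case (Cons E Es)
  note 1 = computes_run[OF Cons.IH[OF Cons.prems]] and 2 = computes_run[OF Cons.prems[of E]]
  show ?case
    using 1(2) 2(2) by (intro computesI) (auto simp: prog_nth any_body_def 1(1) 2(1) index_less)
qed

definition "c_adj n s = 2 * ((n * n + 1) * (25 * (2 * s + 1) + 30)) + (20 :: nat)"
definition "c_extend n = (n + 1) * (((n + 1) ^ 4 + 1) * 30 + (30 :: nat))"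
definition "c_search n a = 8 * c_extend n + ((n + 1) ^ 5 + 1) * (c_triple n a + 30) + ((n + 1) ^ 5 + 1) * (c_hole n a + 30)"
definition "c_solve n s b = c_search n (c_adj n s) + (n + 1) * ((b + 1) * 30 + 30) + 2000"

text \<open>Equivalently, \<open>(9 / 4) ^ f\<close> is at least 512. This fails for short cycles,
  which are therefore left to the branching on triples. The factor 8 is slack for the handling of
  the candidates.\<close>

lemma leaves_vs_flips: "17 \<le> f \<Longrightarrow> 8 * 2 ^ (3 * f + 6) \<le> (18 :: nat) ^ f"
proof (induction f rule: dec_induct)
  case (step f)
  then have "8 * 2 ^ (3 * Suc f + 6) \<le> 8 * (18 :: nat) ^ f" by (simp add: power_add)
  then show ?case by simp
qed simp

locale solver =
  fixes V :: "tree list" and n s b :: nat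
  assumes length_V: "length V \<le> n" and size_V: "v \<in> set V \<Longrightarrow> size v \<le> s"
begin

lemma timed_graph:
  assumes "valid V column E" "simple E"
  shows "timed_graph E V n (c_adj n s)"
proof
  have l: "length E \<le> n * n"
    using simple_length[OF assms(2,1)] length_V by (meson le_trans mult_le_mono)
  fix u v assume uv: "u \<in> set V" "v \<in> set V"
  have "(length E + 1) * (25 * (size u + size v + 1) + 30) \<le> (n * n + 1) * (25 * (2 * s + 1) + 30)"
    using l size_V[OF uv(1)] size_V[OF uv(2)] by (intro mult_le_mono) auto
  then have "2 * ((length E + 1) * (25 * (size u + size v + 1) + 30)) + 20 \<le> c_adj n s"
    unfolding c_adj_def by (intro add_mono mult_le_mono2) auto
  then show "computes prog ADJ [elist E, u, v] (tree_of_bool (adj_of E u v)) (c_adj n s)"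
    by (rule computes_mono[OF adj_computes])
  have "25 * size u + 10 \<le> 2 * (1 * (25 * (2 * s + 1) + 30)) + 20" using size_V[OF uv(1)] by simp
  also have "\<dots> \<le> c_adj n s" unfolding c_adj_def by (intro add_mono mult_le_mono) auto
  finally show "computes prog EQ [u, v] (tree_of_bool (u = v)) (c_adj n s)"
    using eq_computes computes_mono by blast
qed (rule length_V)

lemma tuples_computes:
  assumes "k \<le> 4"
  shows "computes prog EXTEND [vlist V, plist (tuples k V)] (plist (tuples (Suc k) V)) (c_extend n)"
proof -
  have "length V ^ k \<le> (n + 1) ^ k" using length_V by (intro power_mono) auto
  also have "\<dots> \<le> (n + 1) ^ 4" using assms by (intro power_increasing) auto
  finally have "(length V + 1) * ((length V ^ k + 1) * 30 + 30) \<le> c_extend n"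
    unfolding c_extend_def using length_V by (intro mult_le_mono add_mono) auto
  then show ?thesis
    using extend_computes[of V "tuples k V"] by (auto simp: length_tuples tuples.simps elim: computes_mono)
qed

lemma length_tuples_le: "k \<le> 5 \<Longrightarrow> length (tuples k V) \<le> (n + 1) ^ 5"
proof -
  assume "k \<le> 5"
  have "length V ^ k \<le> (n + 1) ^ k" using length_V by (intro power_mono) auto
  also have "\<dots> \<le> (n + 1) ^ 5" using \<open>k \<le> 5\<close> by (intro power_increasing) auto
  finally show ?thesis by (simp add: length_tuples)
qed

text \<open>The subtracted term makes the recursion close. With \<open>Q = c_solve n s b\<close> and
  \<open>X = Q * 18 ^ (d - 1)\<close>, where \<open>d = bits_value bs\<close> is positive, the calls
  in 18 branches cost at most \<open>36 * X - 18 * Q\<close>, so \<open>17 * Q\<close> remain for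
  the node itself. Branching on a cycle is covered by \<open>leaves_vs_flips\<close>.\<close>

theorem solve_computes:
  assumes "valid V column E" "simple E" "length bs = b"
  shows "computes prog SOLVE [elist E, vlist V, bits bs] (tree_of_bool (completable V column E (bits_value bs)))
    (2 * (c_solve n s b * 18 ^ bits_value bs) - c_solve n s b)"
  using assms
proof (induction "bits_value bs" arbitrary: E bs rule: less_induct)
  case less
  define Q where "Q = c_solve n s b"
  define a where "a = c_adj n s"
  interpret timed_graph E V n a unfolding a_def by (rule timed_graph[OF less.prems(1,2)])
  define d where "d = bits_value bs"
  have IH: "computes prog SOLVE [elist E', vlist V, bits cs] (tree_of_bool (completable V column E' (bits_value cs)))
      (2 * (Q * 18 ^ bits_value cs) - Q)"
    if "bits_value cs < d" "valid V column E'" "simple E'" "length cs = b" for E' cs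
    using less.hyps[of cs E'] that unfolding d_def Q_def by blast
  define tp where "tp k = plist (tuples k V)" for k
  have tp0: "tp 0 = tree_of_bool True" unfolding tp_def by (simp add: tuples.simps)
  note ext = computes_run[OF tuples_computes, folded tp_def]
  have ext_run: "run prog EXTEND [vlist V, tp k] R \<longleftrightarrow> R (tp (Suc k)) (time prog EXTEND [vlist V, tp k])" if "k \<le> 4" for k R
    using ext(1)[OF that] .
  define t1 t2 t3 t4 t5 where "t1 = tp 1" and "t2 = tp 2" and "t3 = tp 3" and "t4 = tp 4" and "t5 = tp 5"
  have sucs: "Suc 0 = 1" "Suc 1 = 2" "Suc 2 = 3" "Suc 3 = 4" "Suc 4 = 5" by simp_all
  note x = ext_run[of 0, unfolded tp0 sucs, folded t1_def, simplified] ext_run[of 1, unfolded sucs, folded t1_def t2_def, simplified]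
    ext_run[of 2, unfolded sucs, folded t2_def t3_def, simplified] ext_run[of 3, unfolded sucs, folded t3_def t4_def, simplified]
    ext_run[of 4, unfolded sucs, folded t4_def t5_def, simplified]
  have xt: "time prog EXTEND [vlist V, tree_of_bool True] \<le> c_extend n" "time prog EXTEND [vlist V, t1] \<le> c_extend n"
    "time prog EXTEND [vlist V, t2] \<le> c_extend n" "time prog EXTEND [vlist V, t3] \<le> c_extend n"
    "time prog EXTEND [vlist V, t4] \<le> c_extend n"
    using ext(2)[of 0] ext(2)[of 1] ext(2)[of 2] ext(2)[of 3] ext(2)[of 4]
    unfolding tp0 t1_def t2_def t3_def t4_def by simp_all
  define Z where "Z = find_triple (adj_of E) column V"
  define C where "C = find_hole (adj_of E) V"
  have ft: "computes prog FINDTRIPLE [elist E, vlist V, t3] (elist Z) (((n + 1) ^ 5 + 1) * (c_triple n a + 30))"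
    unfolding t3_def tp_def Z_def find_triple_def
    using length_tuples_le[of 3]
    by (intro computes_mono[OF find_triple_computes] mult_le_mono1) (auto simp: set_tuples)
  have fh: "computes prog FINDHOLE [elist E, vlist V, t5] (vlist C) (((n + 1) ^ 5 + 1) * (c_hole n a + 30))"
    unfolding t5_def tp_def C_def find_hole_def
    using length_tuples_le[of 5]
    by (intro computes_mono[OF find_hole_computes] mult_le_mono1) (auto simp: set_tuples)
  note ft = computes_run[OF ft] and fh = computes_run[OF fh]
  \<comment> \<open>One bound serves all cases: a node that branches on a triple is charged for the
    search for a hole as well.\<close>
  have search: "time prog EXTEND [vlist V, tree_of_bool True] + time prog EXTEND [vlist V, t1] + time prog EXTEND [vlist V, t2]
     + time prog EXTEND [vlist V, tree_of_bool True] + time prog EXTEND [vlist V, t1] + time prog EXTEND [vlist V, t2]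
     + time prog EXTEND [vlist V, t3] + time prog EXTEND [vlist V, t4]
     + time prog FINDTRIPLE [elist E, vlist V, t3] + time prog FINDHOLE [elist E, vlist V, t5] \<le> c_search n a"
    unfolding c_search_def using xt ft(2) fh(2) by linarith
  define w where "w = (n + 1) * ((b + 1) * 30 + 30)"
  have Q: "Q = c_search n a + w + 2000" unfolding Q_def c_solve_def a_def w_def ..
  define w' where "w' = (b + 1) * 30"
  have b30: "w' \<le> w" unfolding w_def w'_def by simp
  have Qd: "Q \<le> Q * 18 ^ d" by simp
  define t where "t = 2 * (Q * 18 ^ d) - Q"
  have t: "Q \<le> t" unfolding t_def using Qd by linarith
  have bound: "c_search n a + w + 1000 \<le> t" "c_search n a + w' + 1000 \<le> t"
    using t Q b30 by linarith+
  have "computes prog SOLVE [elist E, vlist V, bits bs] (tree_of_bool (completable V column E d)) t"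
  proof (cases "Z = []")
    case False
    note br = triple_branch[OF less.prems(1) False[unfolded Z_def], folded Z_def]
    note dc = computes_run[OF dec_computes[of bs], unfolded less.prems(3), folded w'_def]
    show ?thesis
    proof (cases "dec bs")
      case None
      then have "\<not> completable V column E d" using br(3) dec_None unfolding d_def by auto
      then show ?thesis
        using search dc(2) bound(2) None False
        by (intro computesI) (auto simp: prog_nth solve_body_def x ft(1) dc(1) index_less)
    next
      case (Some cs)
      have d: "d = Suc (bits_value cs)" "length cs = b" using dec_Some[OF Some] less.prems(3) unfolding d_def by auto
      define B where "B = 2 * (Q * 18 ^ bits_value cs) - Q"
      have "computes prog SOLVE [elist E', vlist V, bits cs] (tree_of_bool (completable V column E' (bits_value cs))) B"
        if "E' \<in> set (map (\<lambda>z. z # E) Z)" for E'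
      proof -
        from that obtain u v where "(u, v) \<in> set Z" "E' = (u, v) # E" by auto
        with br(2) d less.prems(2) show ?thesis unfolding B_def by (intro IH) auto
      qed
      note any = computes_run[OF any_computes[where Es = "map (\<lambda>z. z # E) Z", OF this]]
      note each = computes_run[OF each_computes[of Z E]]
      have comp: "(\<exists>E'\<in>set (map (\<lambda>z. z # E) Z). completable V column E' (bits_value cs)) \<longleftrightarrow> completable V column E d"
        using br(3)[of d] d by auto
      have "length (map (\<lambda>z. z # E) Z) * (B + 30) \<le> 18 * (B + 30)" using br(1) by (intro mult_le_mono1) simp
      then have any_time: "time prog ANY [tree_of_list elist (map (\<lambda>z. z # E) Z), vlist V, bits cs] \<le> 18 * (B + 30) + 10"
        using any(2) by linarith
      have "(length Z + 1) * 20 \<le> 380" using br(1) by simp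
      with each(2) have each_time: "time prog EACH [elist Z, elist E] \<le> 380" by (rule order_trans)
      define X where "X = Q * 18 ^ bits_value cs"
      have X: "Q \<le> X" "B = 2 * X - Q" "t = 36 * X - Q" unfolding X_def B_def t_def d(1) by simp_all
      then have "t = 18 * B + 17 * Q" by simp
      then have final: "c_search n a + w' + 380 + (18 * (B + 30) + 10) + 60 \<le> t"
        using b30 Q by simp
      show ?thesis
        using search dc(2) any_time each_time final Some False
        by (intro computesI)
          (auto simp: prog_nth solve_body_def x ft(1) dc(1) any(1) comp each(1) index_less simp del: bex_simps set_map)
    qed
  next
    case True
    note Z = True[unfolded Z_def]
    show ?thesis
    proof (cases "C = []")
      case C: True
      have "completable V column E d" using no_branch[OF less.prems(1) Z] C unfolding C_def by blast
      then show ?thesis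
        using search bound(2) True C
        by (intro computesI) (auto simp: prog_nth solve_body_def x ft(1) fh(1) index_less)
    next
      case False
      obtain f where f: "17 \<le> f" "length C = 2 * f + 4" "length C \<le> length V"
        and lv: "\<And>E'. E' \<in> set (leaves [] C E) \<Longrightarrow> valid V column E' \<and> simple E'"
        and comp: "\<And>d. completable V column E d \<longleftrightarrow> f \<le> d \<and> (\<exists>E'\<in>set (leaves [] C E). completable V column E' (d - f))"
        using hole_branch[OF less.prems(1,2) Z False[unfolded C_def]] unfolding C_def by metis
      note dc = computes_run[OF decs_computes[OF f(2), of bs], unfolded less.prems(3)]
      have "(f + 1) * ((b + 1) * 30 + 30) \<le> w"
        unfolding w_def using f length_V by (intro mult_le_mono1) simp
      with dc(2) have dc_time: "time prog DECS [vlist C, bits bs] \<le> w" by (rule order_trans)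
      show ?thesis
      proof (cases "decs f bs")
        case None
        then have "\<not> completable V column E d" using comp decs_None unfolding d_def by auto
        then show ?thesis
          using search dc_time bound(1) None True False
          by (intro computesI) (auto simp: prog_nth solve_body_def x ft(1) fh(1) dc(1) index_less)
      next
        case (Some cs)
        have d: "d = f + bits_value cs" "length cs = b" using decs_Some[OF Some] less.prems(3) unfolding d_def by auto
        define X where "X = Q * 18 ^ bits_value cs"
        define B where "B = 2 * X - Q"
        have "computes prog SOLVE [elist E', vlist V, bits cs] (tree_of_bool (completable V column E' (bits_value cs))) B"
          if "E' \<in> set (leaves [] C E)" for E'
          using lv[OF that] d f unfolding B_def X_def by (intro IH) auto
        note any = computes_run[OF any_computes[where Es = "leaves [] C E", OF this]]
        have comp': "(\<exists>E'\<in>set (leaves [] C E). completable V column E' (bits_value cs)) \<longleftrightarrow> completable V column E d"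
          using comp[of d] d by auto
        have j: "length C + (length ([] :: tree list) + length C) div 2 = 3 * f + 6" using f(2) by simp
        note ls = computes_run[OF leaves_computes[OF eq_refl[OF j], of E "[]"], unfolded tree_of_list.simps append_Nil2]
        define m where "m = (2 :: nat) ^ (3 * f + 6)"
        have "length (leaves [] C E) \<le> m" using length_leaves[of "[]" C E] unfolding j m_def .
        then have "length (leaves [] C E) * (B + 30) \<le> m * (B + 30)" by (rule mult_le_mono1)
        then have any_time: "time prog ANY [tree_of_list elist (leaves [] C E), vlist V, bits cs] \<le> m * (B + 30) + 10"
          using any(2) by linarith
        have leaves_time: "time prog LEAVES [Leaf, vlist C, elist E, Leaf] \<le> 120 * m"
          using ls(2) unfolding m_def by simp
        \<comment> \<open>The unit is \<open>m * X\<close>. The node itself, the handling of the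
          candidates and the recursive calls take at most four units together, while
          \<open>t\<close> provides at least fifteen.\<close>
        have "8 * m * X \<le> 18 ^ f * X" using leaves_vs_flips[OF f(1)] unfolding m_def by (rule mult_le_mono1)
        then have mX: "8 * (m * X) \<le> Q * 18 ^ d" unfolding X_def d(1) by (simp add: power_add algebra_simps)
        have "150 * m \<le> Q * m" using Q by (intro mult_le_mono1) simp
        also have "\<dots> \<le> m * X" unfolding X_def by simp
        finally have m150: "150 * m \<le> m * X" .
        have "Q * 1 \<le> Q * (m * 18 ^ bits_value cs)" unfolding m_def by (intro mult_le_mono2) simp
        then have mQ: "Q \<le> m * X" unfolding X_def by (simp add: ac_simps)
        have "m * (B + 30) \<le> m * (2 * X + 30)" unfolding B_def by (intro mult_le_mono2) simp
        also have "\<dots> = 2 * (m * X) + 30 * m" by (simp add: algebra_simps)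
        finally have final: "c_search n a + w + 120 * m + (m * (B + 30) + 10) + 60 \<le> t"
          using mX m150 mQ Q unfolding t_def by linarith
        show ?thesis
          using search dc_time any_time leaves_time final Some True False
          by (intro computesI)
            (auto simp: prog_nth solve_body_def x ft(1) fh(1) dc(1) any(1) comp' ls(1) index_less simp del: bex_simps)
      qed
    qed
  qed
  then show ?case unfolding t_def Q_def d_def .
qed

end

section \<open>Reading the input\<close>

text \<open>Unary indices are affordable, since the numbers of rows and columns in use are bounded
  by the size of the input, and the program generates them by counting.\<close>

definition rowv :: "nat \<Rightarrow> tree" where
  "rowv i = Branch Leaf (unary i)"

definition colv :: "nat \<Rightarrow> tree" where
  "colv j = Branch (tree_of_bool True) (unary j)"

fun row_edges :: "bool list \<Rightarrow> nat \<Rightarrow> nat \<Rightarrow> (tree \<times> tree) list" where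
  "row_edges [] i j = []"
| "row_edges (b # bs) i j = (if b then (rowv i, colv j) # row_edges bs i (Suc j) else row_edges bs i (Suc j))"

fun matrix_edges :: "bool list list \<Rightarrow> nat \<Rightarrow> (tree \<times> tree) list" where
  "matrix_edges [] i = []"
| "matrix_edges (r # rs) i = row_edges r i 0 @ matrix_edges rs (Suc i)"

lemma inj_unary: "unary i = unary j \<longleftrightarrow> i = j"
proof (induction i arbitrary: j)
  case 0
  show ?case by (cases j) auto
next
  case (Suc i)
  then show ?case by (cases j) auto
qed

lemma size_unary: "size (unary i) = i"
  by (induction i) auto

lemma vertex_eq [simp]: "rowv i = rowv i' \<longleftrightarrow> i = i'" "colv j = colv j' \<longleftrightarrow> j = j'" "rowv i \<noteq> colv j" "colv j \<noteq> rowv i"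
  by (auto simp: rowv_def colv_def inj_unary dest: tree_of_bool_eq_Leaf[THEN iffD1, OF sym])

lemma column_vertex [simp]: "first_child (rowv i) = Leaf" "first_child (colv j) \<noteq> Leaf"
  by (simp_all add: rowv_def colv_def)

lemma row_edges_computes:
  "computes prog ROWEDGES [bits bs, unary i, unary j, elist acc] (elist (row_edges bs i j @ acc)) ((length bs + 1) * 40)"
proof (induction bs arbitrary: j)
  case Nil
  show ?case by (intro computesI) (simp_all add: prog_nth rowedges_body_def index_less)
next
  case (Cons b bs)
  note 1 = computes_run[OF Cons.IH[of "Suc j", unfolded unary.simps]]
  show ?case
    using 1(2) by (intro computesI) (auto simp: prog_nth rowedges_body_def 1(1) index_less rowv_def colv_def)
qed

lemma matrix_edges_computes:
  assumes "\<forall>r\<in>set rs. length r \<le> k"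
  shows "computes prog EDGES [tree_of_list bits rs, unary i, Leaf] (elist (matrix_edges rs i)) ((length rs + 1) * ((k + 1) * 40 + 40))"
  using assms
proof (induction rs arbitrary: i)
  case Nil
  show ?case by (intro computesI) (simp_all add: prog_nth edges_body_def index_less)
next
  case (Cons r rs)
  note 1 = computes_run[OF Cons.IH[of "Suc i", unfolded unary.simps]]
  note 2 = computes_run[OF row_edges_computes[of r i 0, unfolded unary.simps]]
  have "(length r + 1) * 40 \<le> (k + 1) * 40" using Cons.prems by simp
  with 2(2)[of "matrix_edges rs (Suc i)"]
  have "time prog ROWEDGES [bits r, unary i, Leaf, elist (matrix_edges rs (Suc i))] \<le> (k + 1) * 40"
    by (rule order_trans)
  then show ?case
    using 1(2) Cons.prems by (intro computesI) (simp_all add: prog_nth edges_body_def 1(1) 2(1) index_less)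
qed

lemma vertices_computes:
  "computes prog VERTS [tree_of_list enc xs, tag, unary j, vlist acc]
     (vlist (map (\<lambda>k. Branch tag (unary k)) [j..<j + length xs] @ acc)) ((length xs + 1) * 20)"
proof (induction xs arbitrary: j)
  case Nil
  show ?case by (intro computesI) (simp_all add: prog_nth verts_body_def index_less)
next
  case (Cons x xs)
  note 1 = computes_run[OF Cons.IH[of "Suc j", unfolded unary.simps]]
  have "[j..<j + length (x # xs)] = j # [Suc j..<Suc j + length xs]" using upt_conv_Cons[of j "j + Suc (length xs)"] by (simp del: upt_Suc)
  then show ?case
    using 1(2) by (intro computesI) (simp_all add: prog_nth verts_body_def 1(1) index_less del: upt_Suc)
qed

text \<open>The number of columns is read off the first row, so an input without rows produces no
  vertices at all.\<close>

definition first_row :: "bool list list \<Rightarrow> bool list" where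
  "first_row rs = (case rs of [] \<Rightarrow> [] | r # _ \<Rightarrow> r)"

definition vertices :: "nat \<Rightarrow> nat \<Rightarrow> tree list" where
  "vertices m n = map rowv [0..<m] @ map colv [0..<n]"

lemma main_computes:
  assumes "\<forall>r\<in>set rs. length r \<le> k"
    and "computes prog SOLVE [elist (matrix_edges rs 0), vlist (vertices (length rs) (length (first_row rs))), bits bs] v t"
  shows "computes prog 0 [Branch (tree_of_list bits rs) (bits bs)] v
    (t + (length rs + 1) * ((k + 1) * 40 + 40) + (length rs + 1) * 20 + (k + 1) * 20 + 60)"
proof -
  note 1 = computes_run[OF matrix_edges_computes[OF assms(1), of 0, unfolded unary.simps]]
  have fr: "first_child (tree_of_list bits rs) = bits (first_row rs)" "length (first_row rs) \<le> k"
    unfolding first_row_def using assms(1) by (auto split: list.split)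
  note 2 = computes_run[OF vertices_computes[of _ _ _ 0 "[]", unfolded unary.simps tree_of_list.simps append_Nil2 add_0]]
  note 3 = computes_run[OF vertices_computes[of _ _ _ 0, unfolded unary.simps add_0]]
    and 4 = computes_run[OF assms(2), unfolded vertices_def]
  have "(length (first_row rs) + 1) * 20 \<le> (k + 1) * 20" using fr(2) by simp
  with 2(2)[of tree_of_bool "first_row rs"] have
    "time prog VERTS [bits (first_row rs), tree_of_bool True, Leaf, Leaf] \<le> (k + 1) * 20"
    by (rule order_trans)
  then show ?thesis
    using 1(2) 3(2)[of bits rs Leaf "map colv [0..<length (first_row rs)]"] 4(2)
    by (intro computesI)
      (simp_all add: prog_nth main_body_def 1(1) 2(1) 3(1) 4(1) fr(1) index_less flip: rowv_def colv_def)
qed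

lemma set_row_edges: "set (row_edges bs i j) = {(rowv i, colv (j + k)) | k. k < length bs \<and> bs ! k}"
proof (induction bs arbitrary: j)
  case (Cons b bs)
  have "{(rowv i, colv (j + k)) | k. k < length (b # bs) \<and> (b # bs) ! k} =
    (if b then {(rowv i, colv j)} else {}) \<union> {(rowv i, colv (Suc j + k)) | k. k < length bs \<and> bs ! k}"
    by (auto simp: less_Suc_eq_0_disj)
  then show ?case using Cons by auto
qed simp

lemma set_matrix_edges:
  "set (matrix_edges rs i) = {(rowv (i + k), colv j) | k j. k < length rs \<and> j < length (rs ! k) \<and> rs ! k ! j}"
proof (induction rs arbitrary: i)
  case (Cons r rs)
  have "{(rowv (i + k), colv j) | k j. k < length (r # rs) \<and> j < length ((r # rs) ! k) \<and> (r # rs) ! k ! j} =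
    {(rowv i, colv (0 + j)) | j. j < length r \<and> r ! j} \<union>
    {(rowv (Suc i + k), colv j) | k j. k < length rs \<and> j < length (rs ! k) \<and> rs ! k ! j}"
    by (auto simp: less_Suc_eq_0_disj)
  then show ?case using Cons by (simp add: set_row_edges)
qed simp

lemma distinct_row_edges: "distinct (row_edges bs i j)"
  by (induction bs arbitrary: j) (auto simp: set_row_edges)

lemma distinct_matrix_edges: "distinct (matrix_edges rs i)"
  by (induction rs arbitrary: i) (auto simp: distinct_row_edges set_row_edges set_matrix_edges)

lemma simple_distinct:
  "distinct E \<Longrightarrow> (\<forall>(u, v)\<in>set E. \<not> side u \<and> side v) \<Longrightarrow> simple E"
  by (induction E rule: simple.induct) (auto simp: adj_of_def)

lemma simple_matrix_edges: "simple (matrix_edges rs i)"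
  by (rule simple_distinct[OF distinct_matrix_edges, of _ _ column]) (auto simp: set_matrix_edges)

section \<open>Matrices as bipartite graphs\<close>

lemma consecutiveI:
  assumes "\<And>i j k. i \<in> S \<Longrightarrow> k \<in> S \<Longrightarrow> i < j \<Longrightarrow> j < k \<Longrightarrow> j \<in> S" and "finite S"
  shows "consecutive S"
proof (cases "S = {}")
  case True
  then show ?thesis unfolding consecutive_def by (intro exI[of _ 0]) simp
next
  case False
  have "S = {Min S..<Suc (Max S)}"
  proof (intro equalityI subsetI)
    fix x assume "x \<in> {Min S..<Suc (Max S)}"
    then have "x = Min S \<or> x = Max S \<or> Min S < x \<and> x < Max S" by auto
    then show "x \<in> S" using assms(1)[of "Min S" "Max S" x] Min_in[OF assms(2) False] Max_in[OF assms(2) False] by blast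
  qed (use assms(2) in \<open>auto simp: less_Suc_eq_le\<close>)
  then show ?thesis unfolding consecutive_def by blast
qed

text \<open>Ranking the elements by the number of smaller ones sends an old index to its new
  position. The required permutation is the inverse, because \<open>p j\<close> is the old index at
  position \<open>j\<close>.\<close>

lemma arrangement_iff_permutation:
  fixes f :: "nat \<Rightarrow> 'a"
  assumes "inj f"
  shows "(\<exists>lt. arrangement I (f ` {..<n}) lt) \<longleftrightarrow>
    (\<exists>p. p permutes {..<n} \<and> (\<forall>r. consecutive {j. j < n \<and> I r (f (p j))}))"
proof
  assume "\<exists>lt. arrangement I (f ` {..<n}) lt"
  then obtain lt where lt: "arrangement I (f ` {..<n}) lt" by blast
  define rank where "rank x = card {y \<in> f ` {..<n}. lt y x}" for x
  have mono: "rank x < rank y" if "lt x y" "x \<in> f ` {..<n}" "y \<in> f ` {..<n}" for x y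
    unfolding rank_def
  proof (rule psubset_card_mono)
    have "{z \<in> f ` {..<n}. lt z x} \<subseteq> {z \<in> f ` {..<n}. lt z y}" using arrangementD(2)[OF lt] that by blast
    moreover have "x \<in> {z \<in> f ` {..<n}. lt z y}" "x \<notin> {z \<in> f ` {..<n}. lt z x}"
      using that arrangementD(1)[OF lt] by blast+
    ultimately show "{z \<in> f ` {..<n}. lt z x} \<subset> {z \<in> f ` {..<n}. lt z y}" by blast
  qed simp
  define q where "q k = (if k < n then rank (f k) else k)" for k
  have "inj_on q {..<n}"
  proof (rule inj_onI)
    fix x y assume xy: "x \<in> {..<n}" "y \<in> {..<n}" "q x = q y"
    show "x = y"
    proof (rule ccontr)
      assume "x \<noteq> y"
      then have "lt (f x) (f y) \<or> lt (f y) (f x)"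
        using arrangementD(3)[OF lt] xy inj_eq[OF assms] by blast
      then show False using mono xy unfolding q_def by fastforce
    qed
  qed
  moreover have "q k < n" if "k < n" for k
  proof -
    have "rank (f k) < card (f ` {..<n})"
      unfolding rank_def using that arrangementD(1)[OF lt] by (intro psubset_card_mono) auto
    also have "\<dots> = n" using inj_on_subset[OF assms] by (simp add: card_image)
    finally show ?thesis unfolding q_def using that by simp
  qed
  then have "q ` {..<n} \<subseteq> {..<n}" by blast
  ultimately have "bij_betw q {..<n} {..<n}"
    unfolding bij_betw_def using endo_inj_surj[of "{..<n}" q] by simp
  then have q: "q permutes {..<n}" by (rule bij_imp_permutes) (simp add: q_def)
  define p where "p = Hilbert_Choice.inv q"
  have p: "p permutes {..<n}" unfolding p_def by (rule permutes_inv[OF q])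
  have qp: "q (p j) = j" for j unfolding p_def using permutes_inverses[OF q] by simp
  have pn: "p j < n \<longleftrightarrow> j < n" for j using permutes_in_image[OF p] by simp
  have ord: "lt (f (p i)) (f (p j))" if "i < j" "j < n" for i j
  proof -
    have "f (p i) \<noteq> f (p j)" using that qp inj_eq[OF assms] by (metis less_irrefl)
    then have "lt (f (p i)) (f (p j)) \<or> lt (f (p j)) (f (p i))"
      using arrangementD(3)[OF lt] that pn by auto
    moreover have "rank (f (p i)) = i" "rank (f (p j)) = j"
      using qp[of i] qp[of j] pn[of i] pn[of j] that unfolding q_def by auto
    ultimately show ?thesis using mono[of "f (p j)" "f (p i)"] that pn by fastforce
  qed
  have "consecutive {j. j < n \<and> I r (f (p j))}" for r
  proof (rule consecutiveI)
    fix i j k assume "i \<in> {j. j < n \<and> I r (f (p j))}" "k \<in> {j. j < n \<and> I r (f (p j))}" "i < j" "j < k"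
    then show "j \<in> {j. j < n \<and> I r (f (p j))}"
      using arrangementD(4)[OF lt, of "f (p i)" "f (p j)" "f (p k)" r] ord pn by auto
  qed simp
  with p show "\<exists>p. p permutes {..<n} \<and> (\<forall>r. consecutive {j. j < n \<and> I r (f (p j))})" by blast
next
  assume "\<exists>p. p permutes {..<n} \<and> (\<forall>r. consecutive {j. j < n \<and> I r (f (p j))})"
  then obtain p where p: "p permutes {..<n}" "\<And>r. consecutive {j. j < n \<and> I r (f (p j))}" by blast
  define g where "g = f \<circ> p"
  have g: "inj g" unfolding g_def using assms permutes_inj[OF p(1)] by (rule inj_compose)
  have X: "f ` {..<n} = g ` {..<n}" unfolding g_def image_comp[symmetric] permutes_image[OF p(1)] ..
  define lt where "lt x y \<longleftrightarrow> (\<exists>i j. x = g i \<and> y = g j \<and> i < j)" for x y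
  have lt: "lt (g i) (g j) \<longleftrightarrow> i < j" for i j unfolding lt_def inj_eq[OF g] by blast
  have "arrangement I (g ` {..<n}) lt"
  proof (rule arrangementI)
    fix r x y z assume "x \<in> g ` {..<n}" "y \<in> g ` {..<n}" "z \<in> g ` {..<n}" "lt x y" "lt y z" "I r x" "I r z"
    then obtain i j k where ijk: "i < j" "j < k" "k < n" "y = g j" "I r (g i)" "I r (g k)" by (auto simp: lt)
    obtain a b where ab: "{j. j < n \<and> I r (g j)} = {a..<b}"
      using p(2)[of r] unfolding consecutive_def g_def by auto
    from ijk have "i \<in> {j. j < n \<and> I r (g j)}" "k \<in> {j. j < n \<and> I r (g j)}" by auto
    then have "j \<in> {j. j < n \<and> I r (g j)}" unfolding ab using ijk by auto
    then show "I r y" using ijk by simp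
  qed (auto simp: lt inj_eq[OF g])
  then show "\<exists>lt. arrangement I (f ` {..<n}) lt" unfolding X by blast
qed

lemma consecutive_empty: "consecutive {}"
  unfolding consecutive_def by (intro exI[of _ 0]) simp

text \<open>The sides are crossed: an order of the row vertices witnesses \<open>c1p_cols\<close>,
  and an order of the column vertices witnesses \<open>c1p_rows\<close>.\<close>

lemma biconvex_edges_iff_sc1p:
  assumes G: "valid (vertices m n) column G"
    and N: "dim_row N = m" "dim_col N = n" "\<And>i j. i < m \<Longrightarrow> j < n \<Longrightarrow> N $$ (i, j) \<longleftrightarrow> adj_of G (rowv i) (colv j)"
  shows "biconvex_edges (vertices m n) column G \<longleftrightarrow> sc1p N"
proof -
  have inj: "inj rowv" "inj colv" by (auto intro: injI)
  have sides: "{v \<in> set (vertices m n). column v = False} = rowv ` {..<m}"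
    "{v \<in> set (vertices m n). column v = True} = colv ` {..<n}"
    unfolding vertices_def by auto
  have sym: "adj_of G u v \<longleftrightarrow> adj_of G v u" for u v unfolding adj_of_def by blast
  have adj: "adj_of G r (rowv i) \<Longrightarrow> \<exists>j<n. r = colv j" "adj_of G r (colv j) \<Longrightarrow> \<exists>i<m. r = rowv i" for r i j
    using G unfolding valid_def adj_of_def vertices_def by auto
  have "(\<forall>r. consecutive {i. i < m \<and> adj_of G r (rowv (p i))}) \<longleftrightarrow>
      (\<forall>j<dim_col N. consecutive {i. i < dim_row N \<and> N $$ (p i, j)})"
    (is "(\<forall>r. consecutive (?S r)) \<longleftrightarrow> (\<forall>j<_. consecutive (?T j))")
    if "p permutes {..<m}" for p
  proof -
    have pm: "p i < m \<longleftrightarrow> i < m" for i using permutes_in_image[OF that] by simp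
    have eq: "{i. i < m \<and> adj_of G (colv j) (rowv (p i))} = {i. i < dim_row N \<and> N $$ (p i, j)}" if "j < n" for j
      using that N pm sym by auto
    \<comment> \<open>A tree that is not a column vertex of the matrix has no neighbours among the
      rows; ranging over all trees \<open>r\<close> adds only empty sets.\<close>
    have "consecutive {i. i < m \<and> adj_of G r (rowv (p i))}" if "\<not> (\<exists>j<n. r = colv j)" for r
    proof -
      have "{i. i < m \<and> adj_of G r (rowv (p i))} = {}" using adj(1) that by auto
      then show ?thesis by (simp only: consecutive_empty)
    qed
    then have "(\<forall>r. consecutive (?S r)) \<longleftrightarrow> (\<forall>r. (\<exists>j<n. r = colv j) \<longrightarrow> consecutive (?S r))" by meson
    also have "\<dots> \<longleftrightarrow> (\<forall>j<n. consecutive (?S (colv j)))" by blast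
    also have "\<dots> \<longleftrightarrow> (\<forall>j<n. consecutive (?T j))" using eq by simp
    finally show ?thesis unfolding N(2) .
  qed
  then have rows: "(\<exists>lt. arrangement (adj_of G) (rowv ` {..<m}) lt) \<longleftrightarrow> c1p_cols N"
    unfolding arrangement_iff_permutation[OF inj(1)] c1p_cols_def N(1) by blast
  have "(\<forall>r. consecutive {j. j < n \<and> adj_of G r (colv (p j))}) \<longleftrightarrow>
      (\<forall>i<dim_row N. consecutive {j. j < dim_col N \<and> N $$ (i, p j)})"
    (is "(\<forall>r. consecutive (?S r)) \<longleftrightarrow> (\<forall>i<_. consecutive (?T i))")
    if "p permutes {..<n}" for p
  proof -
    have pn: "p j < n \<longleftrightarrow> j < n" for j using permutes_in_image[OF that] by simp
    have eq: "{j. j < n \<and> adj_of G (rowv i) (colv (p j))} = {j. j < dim_col N \<and> N $$ (i, p j)}" if "i < m" for i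
      using that N pn by auto
    have "consecutive {j. j < n \<and> adj_of G r (colv (p j))}" if "\<not> (\<exists>i<m. r = rowv i)" for r
    proof -
      have "{j. j < n \<and> adj_of G r (colv (p j))} = {}" using adj(2) that by auto
      then show ?thesis by (simp only: consecutive_empty)
    qed
    then have "(\<forall>r. consecutive (?S r)) \<longleftrightarrow> (\<forall>r. (\<exists>i<m. r = rowv i) \<longrightarrow> consecutive (?S r))" by meson
    also have "\<dots> \<longleftrightarrow> (\<forall>i<m. consecutive (?S (rowv i)))" by blast
    also have "\<dots> \<longleftrightarrow> (\<forall>i<m. consecutive (?T i))" using eq by simp
    finally show ?thesis unfolding N(1) .
  qed
  then have cols: "(\<exists>lt. arrangement (adj_of G) (colv ` {..<n}) lt) \<longleftrightarrow> c1p_rows N"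
    unfolding arrangement_iff_permutation[OF inj(2)] c1p_rows_def N(2) by blast
  have "biconvex_edges (vertices m n) column G \<longleftrightarrow>
    (\<exists>lt. arrangement (adj_of G) (rowv ` {..<m}) lt) \<and> (\<exists>lt. arrangement (adj_of G) (colv ` {..<n}) lt)"
    unfolding biconvex_edges_def all_bool_eq sides using G by blast
  then show ?thesis unfolding rows cols sc1p_def by blast
qed

context
  fixes M :: "bool mat" and m n :: nat
  assumes dim: "dim_row M = m" "dim_col M = n"
begin

lemma mat_to_list: "length (mat_to_list M) = m" "i < m \<Longrightarrow> length (mat_to_list M ! i) = n"
  "i < m \<Longrightarrow> j < n \<Longrightarrow> mat_to_list M ! i ! j = M $$ (i, j)"
  unfolding mat_to_list_def dim by simp_all

lemma mat_edges: "set (matrix_edges (mat_to_list M) 0) = {(rowv i, colv j) | i j. i < m \<and> j < n \<and> M $$ (i, j)}"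
  unfolding set_matrix_edges mat_to_list(1) by (auto simp: mat_to_list)

lemma valid_mat_edges: "valid (vertices m n) column (matrix_edges (mat_to_list M) 0)"
  unfolding valid_def mat_edges vertices_def by auto

text \<open>An added list may contain repetitions, reversed pairs and edges already present. Only
  the 0-entries it covers are flipped, and decoding the list shows that there are no more of them
  than its length. Conversely, a set of entries is listed without repetition.\<close>

lemma completable_iff: "completable (vertices m n) column (matrix_edges (mat_to_list M) 0) d \<longleftrightarrow> d_sc1p_0e (M, d)"
proof
  let ?E = "matrix_edges (mat_to_list M) 0"
  assume "completable (vertices m n) column ?E d"
  then obtain F where F: "length F \<le> d" "biconvex_edges (vertices m n) column (F @ ?E)"
    unfolding completable_def by blast
  define S where "S = {(i, j) \<in> zero_entries M. adj_of F (rowv i) (colv j)}"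
  define index where "index v = (THE i. v = rowv i \<or> v = colv i)" for v
  have index: "index (rowv i) = i" "index (colv j) = j" for i j unfolding index_def by auto
  have "S \<subseteq> (\<lambda>(u, v). if column v then (index u, index v) else (index v, index u)) ` set F"
    unfolding S_def adj_of_def by (force simp: index)
  then have "card S \<le> card (set F)" by (rule surj_card_le[OF finite_set])
  also have "\<dots> \<le> d" using card_length[of F] F(1) by simp
  finally have "card S \<le> d" .
  moreover have "S \<subseteq> zero_entries M" unfolding S_def by blast
  moreover have "valid (vertices m n) column (F @ ?E)" using F(2) unfolding biconvex_edges_def by blast
  then have "biconvex_edges (vertices m n) column (F @ ?E) \<longleftrightarrow> sc1p (flip M S)"
    by (rule biconvex_edges_iff_sc1p) (auto simp: flip_def dim adj_of_def mat_edges S_def zero_entries_def)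
  ultimately show "d_sc1p_0e (M, d)" unfolding d_sc1p_0e_def using F(2) by auto
next
  let ?E = "matrix_edges (mat_to_list M) 0"
  assume "d_sc1p_0e (M, d)"
  then obtain S where S: "S \<subseteq> zero_entries M" "card S \<le> d" "sc1p (flip M S)" unfolding d_sc1p_0e_def by auto
  have "zero_entries M \<subseteq> {..<m} \<times> {..<n}" unfolding zero_entries_def dim by auto
  then have "finite S" using S(1) by (meson finite_SigmaI finite_lessThan finite_subset)
  then obtain l where l: "set l = S" "length l = card S" using finite_distinct_list distinct_card by metis
  define F where "F = map (\<lambda>(i, j). (rowv i, colv j)) l"
  have F: "set F = {(rowv i, colv j) | i j. (i, j) \<in> S}" unfolding F_def using l(1) by auto
  have "valid (vertices m n) column F"
    unfolding valid_def F vertices_def using S(1) by (auto simp: zero_entries_def dim)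
  then have "valid (vertices m n) column (F @ ?E)" unfolding valid_append using valid_mat_edges by blast
  then have "biconvex_edges (vertices m n) column (F @ ?E) \<longleftrightarrow> sc1p (flip M S)"
    using S(1) by (intro biconvex_edges_iff_sc1p) (auto simp: flip_def dim adj_of_def mat_edges F zero_entries_def)
  moreover have "length F \<le> d" unfolding F_def using l(2) S(2) by simp
  ultimately show "completable (vertices m n) column ?E d" unfolding completable_def using S(3) by blast
qed

end

section \<open>The running time\<close>

lemma first_row_mat_to_list: "length (first_row (mat_to_list M)) = (if dim_row M = 0 then 0 else dim_col M)"
  unfolding first_row_def using mat_to_list(1)[OF refl refl, of M] mat_to_list(2)[OF refl refl, of 0 M]
  by (cases "mat_to_list M") auto

lemma valid_instance:
  "valid (vertices (dim_row M) (length (first_row (mat_to_list M)))) column (matrix_edges (mat_to_list M) 0)"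
proof (cases "dim_row M = 0")
  case True
  then have "mat_to_list M = []" using mat_to_list(1)[OF refl refl, of M] by simp
  then show ?thesis by (simp add: valid_def)
next
  case False
  then show ?thesis unfolding first_row_mat_to_list using valid_mat_edges[OF refl refl] by simp
qed

text \<open>The encoding forgets the number of columns of a matrix without rows. Such a matrix has
  the property already, so both sides are true.\<close>

lemma completable_instance:
  "completable (vertices (dim_row M) (length (first_row (mat_to_list M)))) column (matrix_edges (mat_to_list M) 0) d
     \<longleftrightarrow> d_sc1p_0e (M, d)"
proof (cases "dim_row M = 0")
  case True
  then have "mat_to_list M = []" using mat_to_list(1)[OF refl refl, of M] by simp
  moreover have "biconvex_edges [] column []"
    unfolding biconvex_edges_def valid_def arrangement_def by simp
  moreover have "sc1p (flip M {})"
    unfolding sc1p_def c1p_rows_def c1p_cols_def flip_def using True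
    by (auto simp: consecutive_empty permutes_id intro!: exI[of _ id])
  ultimately show ?thesis
    unfolding completable_def d_sc1p_0e_def first_row_mat_to_list using True
    by (auto simp: vertices_def intro: exI[of _ "[]"] exI[of _ "{}"])
next
  case False
  then show ?thesis unfolding first_row_mat_to_list using completable_iff[OF refl refl] by simp
qed

lemma size_tree_of_list: "size (tree_of_list enc xs) = length xs + (\<Sum>x\<leftarrow>xs. size (enc x))"
  by (induction xs) auto

definition "c_main N = 2 * c_solve (2 * N) (N + 2) N + (N + 1) * ((N + 1) * 40 + 40) + 40 * (N + 1) + (62 :: nat)"

text \<open>Rows and columns are each bounded by the size \<open>N\<close>, which gives
  \<open>2 * N\<close> vertices; besides its unary index a vertex has at most two nodes. The
  subtracted 2 is reserved for the initial call.\<close>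

lemma instance_computes:
  "computes prog 0 [encode_instance (M, d)] (tree_of_bool (d_sc1p_0e (M, d)))
     (18 ^ d * c_main (size (encode_instance (M, d))) - 2)"
proof -
  define rs where "rs = mat_to_list M"
  define N where "N = size (encode_instance (M, d))"
  have N: "N = length rs + (\<Sum>r\<leftarrow>rs. size (bits r)) + size (bits (binary d)) + 1"
    unfolding N_def rs_def by (simp add: size_tree_of_list)
  then have lrs: "length rs \<le> N" by simp
  have row: "length r \<le> N" if "r \<in> set rs" for r
  proof -
    have "length r \<le> size (bits r)" by (simp add: size_tree_of_list)
    also have "\<dots> \<le> (\<Sum>r\<leftarrow>rs. size (bits r))" using that by (intro member_le_sum_list) auto
    finally show ?thesis using N by simp
  qed
  have fr: "length (first_row rs) \<le> N"
    unfolding first_row_def using row by (cases rs) auto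
  have lb: "length (binary d) \<le> N" using N by (simp add: size_tree_of_list)
  define V where "V = vertices (length rs) (length (first_row rs))"
  interpret solver V "2 * N" "N + 2" "length (binary d)"
  proof
    show "length V \<le> 2 * N" unfolding V_def vertices_def using lrs fr by simp
    show "size v \<le> N + 2" if "v \<in> set V" for v
      using that lrs fr unfolding V_def vertices_def
      by (auto simp: rowv_def colv_def size_unary tree_of_bool.simps(2) simp del: Branch_Leaf_Leaf)
  qed
  have rows: "length rs = dim_row M" unfolding rs_def by (rule mat_to_list(1)[OF refl refl])
  define Q where "Q = c_solve (2 * N) (N + 2) (length (binary d))"
  have QN: "Q \<le> c_solve (2 * N) (N + 2) N"
    unfolding Q_def c_solve_def using lb by (intro add_mono mult_le_mono order_refl) auto
  have "computes prog SOLVE [elist (matrix_edges rs 0), vlist V, bits (binary d)] (tree_of_bool (d_sc1p_0e (M, d)))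
      (2 * (Q * 18 ^ d) - Q)"
    using solve_computes[of "matrix_edges rs 0" "binary d"] valid_instance[of M] completable_instance[of M d]
    unfolding Q_def V_def rows bits_value_binary by (simp add: simple_matrix_edges rs_def)
  then have main: "computes prog 0 [encode_instance (M, d)] (tree_of_bool (d_sc1p_0e (M, d)))
    (2 * (Q * 18 ^ d) - Q + (length rs + 1) * ((N + 1) * 40 + 40) + (length rs + 1) * 20 + (N + 1) * 20 + 60)"
    unfolding V_def encode_instance.simps rs_def[symmetric] using row by (intro main_computes) auto
  define W where "W = (N + 1) * ((N + 1) * 40 + 40)"
  define R where "R = W + 40 * (N + 1) + 62"
  have "(length rs + 1) * ((N + 1) * 40 + 40) \<le> W"
    unfolding W_def using lrs by (intro mult_le_mono1) simp
  with lrs have "2 * (Q * 18 ^ d) - Q + (length rs + 1) * ((N + 1) * 40 + 40) + (length rs + 1) * 20 + (N + 1) * 20 + 60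
      \<le> 2 * (Q * 18 ^ d) + (R - 2)"
    unfolding R_def using diff_le_self[of "2 * (Q * 18 ^ d)" Q] by simp
  also have "\<dots> \<le> 18 ^ d * (2 * Q + R) - 2"
  proof -
    have "R \<le> 18 ^ d * R" "2 \<le> R" unfolding R_def by simp_all
    moreover have "18 ^ d * (2 * Q + R) = 2 * (Q * 18 ^ d) + 18 ^ d * R" by (simp add: algebra_simps)
    ultimately show ?thesis by linarith
  qed
  also have "\<dots> \<le> 18 ^ d * c_main N - 2"
    unfolding c_main_def R_def W_def using QN by (intro diff_le_mono mult_le_mono2) simp
  finally show ?thesis using main unfolding N_def by (rule computes_mono[rotated])
qed

text \<open>The total cost is built from sums, products and fixed powers without subtraction, so
  natural coefficients suffice.\<close>

definition is_poly :: "(nat \<Rightarrow> nat) \<Rightarrow> bool" where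
  "is_poly f \<longleftrightarrow> (\<exists>q. \<forall>x. f x = poly q x)"

lemma is_poly_const: "is_poly (\<lambda>x. c)"
  unfolding is_poly_def by (rule exI[of _ "[:c:]"]) simp

lemma is_poly_id: "is_poly (\<lambda>x. x)"
  unfolding is_poly_def by (rule exI[of _ "[:0, 1:]"]) simp

lemma is_poly_add: "is_poly f \<Longrightarrow> is_poly g \<Longrightarrow> is_poly (\<lambda>x. f x + g x)"
  unfolding is_poly_def by (metis poly_add)

lemma is_poly_mult: "is_poly f \<Longrightarrow> is_poly g \<Longrightarrow> is_poly (\<lambda>x. f x * g x)"
  unfolding is_poly_def by (metis poly_mult)

lemma is_poly_power: "is_poly f \<Longrightarrow> is_poly (\<lambda>x. f x ^ k)"
  unfolding is_poly_def by (metis poly_power)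

lemma is_poly_c_main: "is_poly c_main"
proof -
  have "is_poly (\<lambda>N. c_main N)"
    unfolding c_main_def c_solve_def c_search_def c_extend_def c_triple_def c_hole_def c_adj_def
      c_bfs_def c_expand_def c_parent_def
    by (intro is_poly_add is_poly_mult is_poly_power is_poly_id is_poly_const)
  then show ?thesis .
qed

lemma computes_runs: "computes P 0 [x] y b \<Longrightarrow> \<exists>t. runs P x y t \<and> t \<le> b + 2"
proof -
  assume *: "computes P 0 [x] y b"
  have "wp P [x] (Call 0 [Var 0]) (\<lambda>v t. v = y \<and> t \<le> b + 2)"
    using computes_run(2)[OF *] by (simp add: computes_run(1)[OF *])
  then show ?thesis unfolding wp_def runs_def by blast
qed

lemma solvable: "solvable_in_O_star encode_instance d_sc1p_0e parameter (\<lambda>d. 18 ^ d)"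
proof -
  obtain q where q: "\<And>N. c_main N = poly q N" using is_poly_c_main unfolding is_poly_def by blast
  have "\<exists>t. runs prog (encode_instance x) (tree_of_bool (d_sc1p_0e x)) t \<and>
    t \<le> 18 ^ parameter x * poly q (size (encode_instance x))" for x
  proof -
    obtain M d where x: "x = (M, d)" by (cases x)
    define b where "b = 18 ^ d * c_main (size (encode_instance x))"
    have "1 * 2 \<le> b" unfolding b_def c_main_def by (intro mult_le_mono) auto
    with computes_runs[OF instance_computes[of M d]] show ?thesis
      unfolding x b_def parameter.simps q[symmetric] by auto
  qed
  then show ?thesis unfolding solvable_in_O_star_def by blast
qed

section \<open>Computing the parameter function\<close>

definition "add_body = Cond (Var 0) (Pair Atom (Call 1 [Second (Var 0), Var 1])) (Var 1)"

text \<open>Multiplication by 18 is done by additions, along v, 2v, 4v, 8v, 9v, 18v.\<close>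

definition "power_body =
  Cond (Var 0)
    (Bind (Call 0 [Second (Var 0)]) (Bind (Call 1 [Var 0, Var 0]) (Bind (Call 1 [Var 0, Var 0])
      (Bind (Call 1 [Var 0, Var 0]) (Bind (Call 1 [Var 0, Var 3]) (Call 1 [Var 0, Var 0]))))))
    T"

definition "power_prog = [power_body, add_body]"

lemma power_prog_nth: "power_prog ! 0 = power_body" "power_prog ! Suc 0 = add_body" "length power_prog = 2"
  by (simp_all add: power_prog_def)

lemma add_computes: "computes power_prog 1 [unary x, unary y] (unary (x + y)) (10 * x + 10)"
proof (induction x)
  case 0
  show ?case by (intro computesI) (simp_all add: power_prog_nth add_body_def)
next
  case (Suc x)
  note 1 = computes_run[OF Suc, unfolded One_nat_def]
  show ?case
    using 1(2) by (intro computesI) (simp_all add: power_prog_nth add_body_def 1(1))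
qed

lemma power_computes: "\<exists>b. computes power_prog 0 [unary n] (unary (18 ^ n)) b"
proof (induction n)
  case 0
  have "computes power_prog 0 [unary 0] (unary (18 ^ 0)) 10"
    by (intro computesI) (simp_all add: power_prog_nth power_body_def)
  then show ?case by blast
next
  case (Suc n)
  then obtain b where b: "computes power_prog 0 [unary n] (unary (18 ^ n)) b" by blast
  note 1 = computes_run[OF b] and 2 = computes_run[OF add_computes, unfolded One_nat_def]
  define t where "t = time power_prog"
  define v where "v = (18 :: nat) ^ n"
  define w where "w = v + v + (v + v) + (v + v + (v + v)) + v"
  have e: "18 ^ Suc n = w + w" unfolding w_def v_def by simp
  have "computes power_prog 0 [unary (Suc n)] (unary (w + w)) (t 0 [unary n] + t 1 [unary v, unary v]
      + t 1 [unary (v + v), unary (v + v)] + t 1 [unary (v + v + (v + v)), unary (v + v + (v + v))]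
      + t 1 [unary (v + v + (v + v) + (v + v + (v + v))), unary v]
      + t 1 [unary w, unary w] + 60)"
    by (intro computesI)
      (simp_all add: power_prog_nth power_body_def 1(1) 2(1) t_def w_def flip: v_def)
  then show ?case unfolding e by blast
qed

lemma computable_power: "computable (\<lambda>n. 18 ^ n)"
  unfolding computable_def using power_computes computes_runs by blast

theorem theorem13:
  shows "solvable_in_O_star encode_instance d_sc1p_0e parameter (\<lambda>d. 18 ^ d) \<and>
         fixed_parameter_tractable encode_instance d_sc1p_0e parameter"
  unfolding fixed_parameter_tractable_def using solvable computable_power by blast

end
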